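(* Let $X$ be a càdlàg special weak Dirichlet process of the type $$X=M^c+M^d+A,$$ where $M^c$ is a continuous local martingale, $M^d$ is a purely discontinuous local martingale, and $A$ is a predictable $(\mathcal F_t)$-orthogonal process. Supposing that $A_0=M^d_0=0$, this decomposition is unique.
   Context: Fix $T>0$ and a probability space $(\Omega,\mathcal F,\mathbb P)$ with a filtration $(\mathcal F_t)_{t\in[0,T]}$ satisfying the usual conditions; (local) martingales, adapted and predictable processes are with respect to it. Càdlàg processes on $[0,T]$ are extended to $\mathbb R_+$ by continuity (constant after $T$). "u.c.p." means uniform (in $t\in[0,T]$) convergence in probability. Covariation: $[X,Y]$ is the u.c.p. limit as $\varepsilon\to0$, when it exists, of $\int_{]0,t]}\frac{(X_{(s+\varepsilon)\wedge t}-X_s)(Y_{(s+\varepsilon)\wedge t}-Y_s)}{\varepsilon}ds$. An adapted process $A$ is $(\mathcal F_t)$-orthogonal if $[A,N]=0$ for every continuous local martingale $N$. An adapted process $X$ is special weak Dirichlet if $X=M+A$ with $M$ a local martingale and $A$ predictable and $(\mathcal F_t)$-orthogonal. Uniqueness is up to indistinguishability, among decompositions of the stated type. *)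

theory Defs
  imports "HOL-Probability.Probability"
begin

text \<open>
  A process on \<open>[0,T]\<close> is a function \<open>X :: real \<Rightarrow> 'a \<Rightarrow> real\<close> of time and scenario.
  Only its values at times in \<open>{0..T}\<close> matter: every condition below is restricted to them,
  so the extension of \<open>X\<close> beyond \<open>T\<close> never has to be mentioned.
\<close>

locale usual_filtered_prob_space = prob_space M
  for M :: "'a measure" and F :: "real \<Rightarrow> 'a measure" and T :: real +
  assumes T_pos: "0 < T"
    and subalgebra_F: "\<And>t. t \<in> {0..T} \<Longrightarrow> subalgebra M (F t)"
    and F_mono: "\<And>s t. 0 \<le> s \<Longrightarrow> s \<le> t \<Longrightarrow> t \<le> T \<Longrightarrow> sets (F s) \<subseteq> sets (F t)"
    and F_right_continuous: "\<And>t. 0 \<le> t \<Longrightarrow> t < T \<Longrightarrow> sets (F t) = (\<Inter>s\<in>{t<..T}. sets (F s))"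
    and F_complete: "\<And>N B. N \<in> null_sets M \<Longrightarrow> B \<subseteq> N \<Longrightarrow> B \<in> sets (F 0)"

definition indistinguishable ::
  "'a measure \<Rightarrow> real \<Rightarrow> (real \<Rightarrow> 'a \<Rightarrow> real) \<Rightarrow> (real \<Rightarrow> 'a \<Rightarrow> real) \<Rightarrow> bool" where
  "indistinguishable M T X Y \<longleftrightarrow> (AE \<omega> in M. \<forall>t\<in>{0..T}. X t \<omega> = Y t \<omega>)"

definition adapted :: "(real \<Rightarrow> 'a measure) \<Rightarrow> real \<Rightarrow> (real \<Rightarrow> 'a \<Rightarrow> real) \<Rightarrow> bool" where
  "adapted F T X \<longleftrightarrow> (\<forall>t\<in>{0..T}. X t \<in> borel_measurable (F t))"

definition cadlag_path :: "real \<Rightarrow> (real \<Rightarrow> real) \<Rightarrow> bool" where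
  "cadlag_path T x \<longleftrightarrow>
     (\<forall>t\<in>{0..<T}. (x \<longlongrightarrow> x t) (at_right t)) \<and>
     (\<forall>t\<in>{0<..T}. \<exists>l. (x \<longlongrightarrow> l) (at_left t))"

definition cadlag :: "'a measure \<Rightarrow> real \<Rightarrow> (real \<Rightarrow> 'a \<Rightarrow> real) \<Rightarrow> bool" where
  "cadlag M T X \<longleftrightarrow> (\<forall>\<omega>\<in>space M. cadlag_path T (\<lambda>t. X t \<omega>))"

definition predictable_algebra ::
  "'a measure \<Rightarrow> (real \<Rightarrow> 'a measure) \<Rightarrow> real \<Rightarrow> ('a \<times> real) measure" where
  "predictable_algebra M F T = sigma (space M \<times> {0..T})
     ({B \<times> {0} | B. B \<in> sets (F 0)} \<union>
      {B \<times> {s<..t} | B s t. 0 \<le> s \<and> s < t \<and> t \<le> T \<and> B \<in> sets (F s)})"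

definition predictable ::
  "'a measure \<Rightarrow> (real \<Rightarrow> 'a measure) \<Rightarrow> real \<Rightarrow> (real \<Rightarrow> 'a \<Rightarrow> real) \<Rightarrow> bool" where
  "predictable M F T X \<longleftrightarrow> (\<lambda>(\<omega>, t). X t \<omega>) \<in> borel_measurable (predictable_algebra M F T)"

definition martingale ::
  "'a measure \<Rightarrow> (real \<Rightarrow> 'a measure) \<Rightarrow> real \<Rightarrow> (real \<Rightarrow> 'a \<Rightarrow> real) \<Rightarrow> bool" where
  "martingale M F T X \<longleftrightarrow> adapted F T X \<and>
     (\<forall>t\<in>{0..T}. integrable M (X t)) \<and>
     (\<forall>s t. 0 \<le> s \<and> s \<le> t \<and> t \<le> T \<longrightarrow> (AE \<omega> in M. real_cond_exp M (F s) (X t) \<omega> = X s \<omega>))"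

text \<open>
  On the closed time interval, with processes constant after \<open>T\<close>, a sequence of stopping times
  increases to infinity precisely when, after truncation at \<open>T\<close>, it almost surely reaches \<open>T\<close>
  at a finite stage.
\<close>

definition localizing_sequence ::
  "'a measure \<Rightarrow> (real \<Rightarrow> 'a measure) \<Rightarrow> real \<Rightarrow> (nat \<Rightarrow> 'a \<Rightarrow> real) \<Rightarrow> bool" where
  "localizing_sequence M F T \<tau> \<longleftrightarrow>
     (\<forall>n. stopping_time F (\<tau> n)) \<and>
     (\<forall>n \<omega>. \<tau> n \<omega> \<in> {0..T}) \<and>
     (AE \<omega> in M. incseq (\<lambda>n. \<tau> n \<omega>) \<and> (\<exists>n. \<tau> n \<omega> = T))"

text \<open>The initial value is subtracted, so that it need not be integrable.\<close>

definition local_martingale ::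
  "'a measure \<Rightarrow> (real \<Rightarrow> 'a measure) \<Rightarrow> real \<Rightarrow> (real \<Rightarrow> 'a \<Rightarrow> real) \<Rightarrow> bool" where
  "local_martingale M F T X \<longleftrightarrow> adapted F T X \<and> cadlag M T X \<and>
     (\<exists>\<tau>. localizing_sequence M F T \<tau> \<and>
       (\<forall>n. martingale M F T (\<lambda>t \<omega>. X (min t (\<tau> n \<omega>)) \<omega> - X 0 \<omega>)))"

definition continuous_local_martingale ::
  "'a measure \<Rightarrow> (real \<Rightarrow> 'a measure) \<Rightarrow> real \<Rightarrow> (real \<Rightarrow> 'a \<Rightarrow> real) \<Rightarrow> bool" where
  "continuous_local_martingale M F T X \<longleftrightarrow> local_martingale M F T X \<and>
     (\<forall>\<omega>\<in>space M. continuous_on {0..T} (\<lambda>t. X t \<omega>))"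

text \<open>Some authors include \<open>X\<^sub>0 = 0\<close> in this notion; here that is a separate condition.\<close>

definition purely_discontinuous_local_martingale ::
  "'a measure \<Rightarrow> (real \<Rightarrow> 'a measure) \<Rightarrow> real \<Rightarrow> (real \<Rightarrow> 'a \<Rightarrow> real) \<Rightarrow> bool" where
  "purely_discontinuous_local_martingale M F T X \<longleftrightarrow> local_martingale M F T X \<and>
     (\<forall>N. continuous_local_martingale M F T N \<longrightarrow> local_martingale M F T (\<lambda>t \<omega>. X t \<omega> * N t \<omega>))"

text \<open>
  Convergence is as \<open>\<epsilon>\<close> decreases to \<open>0\<close>. The event is \<open>sup\<^sub>t |Y\<^sub>\<epsilon>(t) - Z(t)| > \<delta>\<close>; the outer
  measure is used because for general processes it need not be measurable.
\<close>

definition ucp_limit ::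
  "'a measure \<Rightarrow> real \<Rightarrow> (real \<Rightarrow> real \<Rightarrow> 'a \<Rightarrow> real) \<Rightarrow> (real \<Rightarrow> 'a \<Rightarrow> real) \<Rightarrow> bool" where
  "ucp_limit M T Y Z \<longleftrightarrow>
     (\<forall>\<delta>>0. ((\<lambda>\<epsilon>. outer_measure_of M {\<omega> \<in> space M. \<exists>t\<in>{0..T}. \<bar>Y \<epsilon> t \<omega> - Z t \<omega>\<bar> > \<delta>})
       \<longlongrightarrow> 0) (at_right 0))"

definition cov_integrand ::
  "(real \<Rightarrow> 'a \<Rightarrow> real) \<Rightarrow> (real \<Rightarrow> 'a \<Rightarrow> real) \<Rightarrow> real \<Rightarrow> real \<Rightarrow> 'a \<Rightarrow> real \<Rightarrow> real" where
  "cov_integrand X Y \<epsilon> t \<omega> s =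
     (X (min (s + \<epsilon>) t) \<omega> - X s \<omega>) * (Y (min (s + \<epsilon>) t) \<omega> - Y s \<omega>) / \<epsilon>"

text \<open>
  \<open>has_covariation M T X Y Z\<close> means that \<open>[X,Y]\<close> exists and equals \<open>Z\<close>. The integrability clause
  (automatic for cadlag paths) excludes the default value \<open>0\<close> of a non-existing integral.
\<close>

definition has_covariation ::
  "'a measure \<Rightarrow> real \<Rightarrow> (real \<Rightarrow> 'a \<Rightarrow> real) \<Rightarrow> (real \<Rightarrow> 'a \<Rightarrow> real) \<Rightarrow> (real \<Rightarrow> 'a \<Rightarrow> real) \<Rightarrow> bool" where
  "has_covariation M T X Y Z \<longleftrightarrow>
     (AE \<omega> in M. \<forall>\<epsilon>>0. \<forall>t\<in>{0..T}. set_integrable lborel {0<..t} (cov_integrand X Y \<epsilon> t \<omega>)) \<and>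
     ucp_limit M T (\<lambda>\<epsilon> t \<omega>. LINT s:{0<..t}|lborel. cov_integrand X Y \<epsilon> t \<omega> s) Z"

definition orthogonal_process ::
  "'a measure \<Rightarrow> (real \<Rightarrow> 'a measure) \<Rightarrow> real \<Rightarrow> (real \<Rightarrow> 'a \<Rightarrow> real) \<Rightarrow> bool" where
  "orthogonal_process M F T A \<longleftrightarrow> adapted F T A \<and>
     (\<forall>N. continuous_local_martingale M F T N \<longrightarrow> has_covariation M T A N (\<lambda>t \<omega>. 0))"

definition special_weak_dirichlet ::
  "'a measure \<Rightarrow> (real \<Rightarrow> 'a measure) \<Rightarrow> real \<Rightarrow> (real \<Rightarrow> 'a \<Rightarrow> real) \<Rightarrow> bool" where
  "special_weak_dirichlet M F T X \<longleftrightarrow> adapted F T X \<and>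
     (\<exists>L A. local_martingale M F T L \<and> predictable M F T A \<and> orthogonal_process M F T A \<and>
        indistinguishable M T X (\<lambda>t \<omega>. L t \<omega> + A t \<omega>))"

definition cont_disc_decomposition ::
  "'a measure \<Rightarrow> (real \<Rightarrow> 'a measure) \<Rightarrow> real \<Rightarrow> (real \<Rightarrow> 'a \<Rightarrow> real) \<Rightarrow>
    (real \<Rightarrow> 'a \<Rightarrow> real) \<Rightarrow> (real \<Rightarrow> 'a \<Rightarrow> real) \<Rightarrow> (real \<Rightarrow> 'a \<Rightarrow> real) \<Rightarrow> bool" where
  "cont_disc_decomposition M F T X Mc Md A \<longleftrightarrow>
     continuous_local_martingale M F T Mc \<and>
     purely_discontinuous_local_martingale M F T Md \<and>
     predictable M F T A \<and> orthogonal_process M F T A \<and>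
     indistinguishable M T X (\<lambda>t \<omega>. Mc t \<omega> + Md t \<omega> + A t \<omega>)"

end

theory Submission
  imports Defs
begin

text \<open>
  Subtracting the two decompositions gives a local martingale
  \<open>L = (Mc - Mc') - (Md' - Md)\<close> which agrees almost surely with \<open>A' - A\<close>, so it is predictable,
  orthogonal to every continuous local martingale, and zero at time \<open>0\<close>. Everything rests on three
  facts about such a process.

  A predictable local martingale is continuous (\<open>predictable_local_martingale_continuous\<close>).
  Suppose that \<open>L\<close> has jumps of size at least \<open>d\<close>. The set of pairs (scenario, time) at which
  they happen is predictable, because both \<open>A' - A\<close> and the left limits of \<open>L\<close> are. A predictable
  set can be approximated from inside by zero sets of continuous adapted processes \<open>Y \<ge> 0\<close>, just as
  a Borel set is approximated by compact sets (\<open>inner_approx_predictable\<close>); the relevant measure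
  sits on the graph of the first such jump. The first zero of \<open>Y\<close> is announced by the times at
  which \<open>Y\<close> reaches \<open>1/(n+1)\<close>, and these lie strictly before it. By optional stopping the stopped
  values of a martingale have the same expectation at the announcing times and at the first zero, so
  in the limit the expected jump at the first zero is \<open>0\<close>. As every such jump is at least \<open>d\<close>, almost
  surely \<open>Y\<close> has no zero (\<open>martingale_no_jump_at_zero_set\<close>), and \<open>L\<close> has no jump.

  A continuous local martingale \<open>L\<close> with \<open>[L,L] = 0\<close> that starts at \<open>0\<close> vanishes
  (\<open>self_orthogonal_continuous_local_martingale_zero\<close>). After stopping, \<open>L\<close> is bounded.
  Summing \<open>(b - a)\<^sup>2 = b\<^sup>2 - a\<^sup>2 - 2 a (b - a)\<close> over all increments of length \<open>\<epsilon>\<close> shows that the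
  regularized bracket is \<open>L\<^sub>T\<^sup>2\<close> up to a boundary term that tends to \<open>0\<close> and a term of mean zero,
  whose second moment is bounded uniformly in \<open>\<epsilon>\<close> because increments over disjoint intervals are
  orthogonal (\<open>gains_second_moment\<close>). Hence the brackets are uniformly integrable, their limit \<open>0\<close> in probability
  is also the limit of their expectations, and \<open>E L\<^sub>T\<^sup>2 = 0\<close>.

  Hence \<open>L = 0\<close> and \<open>A = A'\<close>. Then \<open>C = Mc - Mc' = Md' - Md\<close> is both continuous and purely
  discontinuous, so that \<open>C\<^sup>2\<close> is a nonnegative local martingale starting at \<open>0\<close>; it vanishes
  (\<open>purely_discontinuous_difference_zero\<close>).
\<close>


section \<open>Grids and right-continuous paths\<close>

text \<open>
  Rounding up to the multiples of \<open>1/(n+1)\<close>, capped at \<open>t\<close>. A stopping time rounded in this way is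
  again a stopping time, takes finitely many values, and approaches the original one from the right.
\<close>
definition ceil_grid :: "nat \<Rightarrow> real \<Rightarrow> real \<Rightarrow> real" where
  "ceil_grid n t r = min t (of_int \<lceil>r * real (Suc n)\<rceil> / real (Suc n))"

lemma ceil_grid_bounds:
  assumes "r \<le> t"
  shows "r \<le> ceil_grid n t r" "ceil_grid n t r \<le> t" "ceil_grid n t r \<le> r + 1 / Suc n"
proof -
  have "r * Suc n \<le> of_int \<lceil>r * Suc n\<rceil>" "of_int \<lceil>r * Suc n\<rceil> \<le> r * Suc n + 1"
    by linarith+
  hence "r \<le> of_int \<lceil>r * Suc n\<rceil> / Suc n" "of_int \<lceil>r * Suc n\<rceil> / Suc n \<le> (r * Suc n + 1) / Suc n"
    by (auto simp: pos_le_divide_eq intro!: divide_right_mono)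
  moreover have "(r * Suc n + 1) / Suc n = r + 1 / Suc n"
    by (simp add: field_simps)
  ultimately show "r \<le> ceil_grid n t r" "ceil_grid n t r \<le> t" "ceil_grid n t r \<le> r + 1 / Suc n"
    using assms by (auto simp: ceil_grid_def min_def)
qed

lemma ceil_grid_tendsto:
  assumes "r \<le> t"
  shows "(\<lambda>n. ceil_grid n t r) \<longlonglongrightarrow> r"
proof (rule tendsto_sandwich)
  show "\<forall>\<^sub>F n in sequentially. r \<le> ceil_grid n t r"
    "\<forall>\<^sub>F n in sequentially. ceil_grid n t r \<le> r + 1 / Suc n"
    using ceil_grid_bounds[OF assms] by auto
  show "(\<lambda>n. r + 1 / Suc n) \<longlonglongrightarrow> r"
    using tendsto_add[OF tendsto_const LIMSEQ_inverse_real_of_nat, of r]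
    by (simp add: inverse_eq_divide)
qed simp

lemma finite_ceil_grid: "finite (ceil_grid n t ` {0..t})"
proof -
  have "ceil_grid n t ` {0..t} \<subseteq> (\<lambda>i. min t (of_int i / Suc n)) ` {0..\<lceil>t * Suc n\<rceil>}"
  proof safe
    fix r assume r: "r \<in> {0..t}"
    have "0 \<le> r * real (Suc n)" "r * real (Suc n) \<le> t * real (Suc n)"
      using r by (auto intro: mult_right_mono)
    hence "\<lceil>r * real (Suc n)\<rceil> \<in> {0..\<lceil>t * real (Suc n)\<rceil>}"
      by (auto intro: ceiling_mono simp del: of_nat_Suc)
    thus "ceil_grid n t r \<in> (\<lambda>i. min t (of_int i / Suc n)) ` {0..\<lceil>t * Suc n\<rceil>}"
      unfolding ceil_grid_def by (rule image_eqI[OF refl])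
  qed
  thus ?thesis
    using finite_subset by blast
qed

lemma measurable_ceil_grid [measurable]: "ceil_grid n t \<in> borel_measurable borel"
  unfolding ceil_grid_def by measurable

lemma cadlag_path_right_tendsto:
  assumes "cadlag_path T x" "r \<in> {0..T}" "u \<longlonglongrightarrow> r" "\<And>n::nat. r \<le> u n" "\<And>n. u n \<le> T"
  shows "(\<lambda>n. x (u n)) \<longlonglongrightarrow> x r"
proof (cases "r = T")
  case True
  hence "u n = r" for n
    using assms(4,5)[of n] by auto
  thus ?thesis by simp
next
  case False
  hence "(x \<longlongrightarrow> x r) (at_right r)"
    using assms(1,2) by (auto simp: cadlag_path_def)
  hence "(x \<longlongrightarrow> x r) (at r within {r..})"
    by (simp add: at_within_Ici_at_right)
  hence *: "(x \<longlongrightarrow> x r) (inf (nhds r) (principal {r..}))"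
    unfolding tendsto_def eventually_inf_principal eventually_at_filter
    by (auto elim!: eventually_mono dest: eventually_nhds_x_imp_x)
  have "filterlim u (inf (nhds r) (principal {r..})) sequentially"
    using assms(3,4) by (auto simp: filterlim_inf filterlim_principal)
  thus ?thesis
    using * filterlim_compose by blast
qed

lemma cadlag_path_ceil_grid_tendsto:
  assumes "cadlag_path T x" "0 \<le> r" "r \<le> t" "t \<le> T"
  shows "(\<lambda>n. x (ceil_grid n t r)) \<longlonglongrightarrow> x r"
proof (rule cadlag_path_right_tendsto[OF assms(1)])
  show "(\<lambda>n. ceil_grid n t r) \<longlonglongrightarrow> r"
    "r \<le> ceil_grid n t r" "ceil_grid n t r \<le> T" for n
    using ceil_grid_tendsto[of r t] ceil_grid_bounds[of r t n] assms by auto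
qed (use assms in auto)

text \<open>
  By right-continuity the random time may be replaced by times on a grid, and there only
  finitely many of the variables \<open>X s\<close> occur. The space \<open>G\<close> is arbitrary because the lemma is applied
  to members of the filtration, to the full space, and to its product with the time axis.
\<close>
lemma measurable_at_random_time:
  fixes X :: "real \<Rightarrow> 'b \<Rightarrow> real"
  assumes X: "\<And>s. s \<in> {0..t} \<Longrightarrow> X s \<in> borel_measurable G"
    and cadlag: "\<And>\<omega>. \<omega> \<in> space G \<Longrightarrow> cadlag_path T (\<lambda>t. X t \<omega>)" and "t \<le> T"
    and \<rho>: "\<rho> \<in> borel_measurable G" "\<And>\<omega>. \<rho> \<omega> \<in> {0..t}"
  shows "(\<lambda>\<omega>. X (\<rho> \<omega>) \<omega>) \<in> borel_measurable G"
proof (rule borel_measurable_LIMSEQ_real)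
  show "(\<lambda>n. X (ceil_grid n t (\<rho> \<omega>)) \<omega>) \<longlonglongrightarrow> X (\<rho> \<omega>) \<omega>" if "\<omega> \<in> space G" for \<omega>
    using cadlag_path_ceil_grid_tendsto[OF cadlag[OF that], of "\<rho> \<omega>" t] \<rho>(2)[of \<omega>] \<open>t \<le> T\<close> by auto
  fix n
  define I where "I = ceil_grid n t ` {0..t}"
  have I: "I \<subseteq> {0..t}"
  proof
    fix x assume "x \<in> I"
    then obtain r where "r \<in> {0..t}" "x = ceil_grid n t r" by (auto simp: I_def)
    thus "x \<in> {0..t}" using ceil_grid_bounds[of r t n] by auto
  qed
  show "(\<lambda>\<omega>. X (ceil_grid n t (\<rho> \<omega>)) \<omega>) \<in> borel_measurable G"
  proof (rule measurable_compose_countable'[where I=I and f=X])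
    show "X i \<in> borel_measurable G" if "i \<in> I" for i
      using that I X by blast
    show "countable I"
      unfolding I_def by (rule countable_finite[OF finite_ceil_grid])
    show "(\<lambda>\<omega>. ceil_grid n t (\<rho> \<omega>)) \<in> G \<rightarrow>\<^sub>M count_space I"
    proof (subst measurable_count_space_eq2[OF finite_ceil_grid[of n t, folded I_def]], intro conjI ballI)
      show "(\<lambda>\<omega>. ceil_grid n t (\<rho> \<omega>)) \<in> space G \<rightarrow> I"
        using \<rho>(2) by (auto simp: I_def)
      fix a
      show "(\<lambda>\<omega>. ceil_grid n t (\<rho> \<omega>)) -` {a} \<inter> space G \<in> sets G"
        using \<rho>(1) by measurable
    qed
  qed
qed

lemma cadlag_path_stopped:
  assumes x: "cadlag_path T x"
  shows "cadlag_path T (\<lambda>t. x (min t r) - c)"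
  unfolding cadlag_path_def
proof (intro conjI ballI)
  fix t assume t: "t \<in> {0..<T}"
  show "((\<lambda>t. x (min t r) - c) \<longlongrightarrow> x (min t r) - c) (at_right t)"
  proof (cases "t < r")
    case True
    have "\<forall>\<^sub>F s in at_right t. s < r"
      using eventually_at_right_real[OF True] by eventually_elim auto
    hence "\<forall>\<^sub>F s in at_right t. x s - c = x (min s r) - c"
      by eventually_elim auto
    moreover have "((\<lambda>s. x s - c) \<longlongrightarrow> x t - c) (at_right t)"
      using x t by (auto simp: cadlag_path_def intro!: tendsto_intros)
    ultimately have "((\<lambda>s. x (min s r) - c) \<longlongrightarrow> x t - c) (at_right t)"
      by (rule Lim_transform_eventually[rotated])
    thus ?thesis
      using True by (simp add: min_def)
  next
    case False
    have "\<forall>\<^sub>F s in at_right t. x (min t r) - c = x (min s r) - c"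
      using False by (auto simp: eventually_at_filter min_def)
    thus ?thesis
      by (rule Lim_transform_eventually[OF tendsto_const])
  qed
next
  fix t assume t: "t \<in> {0<..T}"
  show "\<exists>l. ((\<lambda>t. x (min t r) - c) \<longlongrightarrow> l) (at_left t)"
  proof (cases "t \<le> r")
    case True
    from x t obtain l where l: "(x \<longlongrightarrow> l) (at_left t)"
      unfolding cadlag_path_def by blast
    hence "((\<lambda>s. x s - c) \<longlongrightarrow> l - c) (at_left t)"
      by (intro tendsto_intros)
    moreover have "\<forall>\<^sub>F s in at_left t. x s - c = x (min s r) - c"
      using True by (auto simp: eventually_at_filter min_def)
    ultimately show ?thesis
      by (intro exI) (rule Lim_transform_eventually)
  next
    case False
    have "\<forall>\<^sub>F s in at_left t. r < s"
      using eventually_at_left_real[of r t] False by (auto elim: eventually_mono)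
    hence "\<forall>\<^sub>F s in at_left t. x r - c = x (min s r) - c"
      by eventually_elim auto
    thus ?thesis
      by (intro exI) (rule Lim_transform_eventually[OF tendsto_const])
  qed
qed

lemma cadlag_path_diff:
  assumes "cadlag_path T x" "cadlag_path T y"
  shows "cadlag_path T (\<lambda>t. x t - y t)"
  using assms unfolding cadlag_path_def by (blast intro: tendsto_diff)

section \<open>Uniform integrability by comparison of tails\<close>

text \<open>
  The part of \<open>\<bar>x\<bar>\<close> above the level \<open>c\<close>. It is the error made by clipping \<open>x\<close> to \<open>[-c, c]\<close>, and it is
  convex, so that conditioning does not increase its mean.
\<close>
definition excess :: "real \<Rightarrow> real \<Rightarrow> real" where
  "excess c x = max 0 (\<bar>x\<bar> - c)"

lemma measurable_excess [measurable]: "excess c \<in> borel_measurable borel"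
  unfolding excess_def by measurable

text \<open>
  A form of uniform integrability with an explicit bound: the tails of \<open>Z\<close> are no heavier than those of
  one fixed \<open>Y\<close>. Being a family of upper bounds for integrals of nonnegative functions, it passes to
  almost sure limits by Fatou's lemma.
\<close>
definition excess_dominated :: "'a measure \<Rightarrow> ('a \<Rightarrow> real) \<Rightarrow> ('a \<Rightarrow> real) \<Rightarrow> bool" where
  "excess_dominated M Y Z \<longleftrightarrow> Z \<in> borel_measurable M \<and>
     (\<forall>c\<ge>0. (\<integral>\<^sup>+\<omega>. ennreal (excess c (Z \<omega>)) \<partial>M) \<le> (\<integral>\<^sup>+\<omega>. ennreal (excess c (Y \<omega>)) \<partial>M))"

lemma excess_dominated_integrable:
  assumes "integrable M Y" "excess_dominated M Y Z"
  shows "integrable M Z"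
proof -
  have "(\<integral>\<^sup>+\<omega>. ennreal (excess 0 (Z \<omega>)) \<partial>M) \<le> (\<integral>\<^sup>+\<omega>. ennreal (excess 0 (Y \<omega>)) \<partial>M)"
    using assms unfolding excess_dominated_def by blast
  also have "\<dots> < \<infinity>"
    using assms(1) by (simp add: excess_def integrable_iff_bounded)
  finally show ?thesis
    using assms(2) by (simp add: excess_def integrable_iff_bounded excess_dominated_def)
qed

context prob_space
begin

lemma excess_dominated_tail:
  assumes Y: "integrable M Y" and "e > 0"
  obtains c where "c \<ge> 0" "(\<integral>\<^sup>+\<omega>. ennreal (excess c (Y \<omega>)) \<partial>M) < ennreal e"
proof -
  have "(\<lambda>n. \<integral>\<omega>. excess (real n) (Y \<omega>) \<partial>M) \<longlonglongrightarrow> (\<integral>\<omega>. 0 \<partial>M)"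
  proof (rule integral_dominated_convergence)
    show "integrable M (\<lambda>\<omega>. \<bar>Y \<omega>\<bar>)" using Y by simp
    show "(\<lambda>\<omega>. excess (real n) (Y \<omega>)) \<in> borel_measurable M" for n
      using Y by measurable
    show "AE \<omega> in M. norm (excess (real n) (Y \<omega>)) \<le> \<bar>Y \<omega>\<bar>" for n
      by (auto simp: excess_def)
    show "AE \<omega> in M. (\<lambda>n. excess (real n) (Y \<omega>)) \<longlonglongrightarrow> 0"
    proof (intro AE_I2 tendsto_eventually)
      fix \<omega>
      obtain m :: nat where "\<bar>Y \<omega>\<bar> \<le> m" using real_arch_simple by blast
      thus "\<forall>\<^sub>F n in sequentially. excess (real n) (Y \<omega>) = 0"
        by (intro eventually_sequentiallyI[of m]) (auto simp: excess_def)
    qed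
  qed simp
  hence "\<forall>\<^sub>F n in sequentially. (\<integral>\<omega>. excess (real n) (Y \<omega>) \<partial>M) < e"
    using \<open>e > 0\<close> by (intro order_tendstoD) auto
  then obtain n :: nat where n: "(\<integral>\<omega>. excess (real n) (Y \<omega>) \<partial>M) < e"
    by (auto simp: eventually_sequentially)
  have "integrable M (\<lambda>\<omega>. excess (real n) (Y \<omega>))"
    by (rule Bochner_Integration.integrable_bound[OF Y]) (use Y in \<open>auto simp: excess_def\<close>)
  hence "(\<integral>\<^sup>+\<omega>. ennreal (excess n (Y \<omega>)) \<partial>M) = ennreal (\<integral>\<omega>. excess n (Y \<omega>) \<partial>M)"
    by (intro nn_integral_eq_integral) (auto simp: excess_def)
  also have "\<dots> < ennreal e"
    using n \<open>e > 0\<close> by (intro ennreal_lessI) auto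
  finally show ?thesis
    by (intro that[of "real n"]) auto
qed

text \<open>
  Clipping at a level \<open>c\<close> changes each expectation by at most the mean excess over \<open>c\<close>, which is small
  uniformly in \<open>n\<close>; the clipped variables converge by bounded convergence.
\<close>
lemma excess_dominated_limit:
  assumes Y: "integrable M Y" and dom: "\<And>n. excess_dominated M Y (Z n)"
    and Z: "Z' \<in> borel_measurable M" and lim: "AE \<omega> in M. (\<lambda>n. Z n \<omega>) \<longlonglongrightarrow> Z' \<omega>"
  shows "excess_dominated M Y Z'" and "(\<lambda>n. expectation (Z n)) \<longlonglongrightarrow> expectation Z'"
proof -
  have meas [measurable]: "Z n \<in> borel_measurable M" for n
    using dom by (auto simp: excess_dominated_def)
  note Z [measurable]
  show dom': "excess_dominated M Y Z'"
    unfolding excess_dominated_def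
  proof (intro conjI allI impI)
    fix c :: real assume c: "c \<ge> 0"
    have "AE \<omega> in M. ennreal (excess c (Z' \<omega>)) = liminf (\<lambda>n. ennreal (excess c (Z n \<omega>)))"
      using lim
    proof eventually_elim
      case (elim \<omega>)
      have "(\<lambda>n. ennreal (excess c (Z n \<omega>))) \<longlonglongrightarrow> ennreal (excess c (Z' \<omega>))"
        unfolding excess_def by (intro tendsto_intros elim)
      thus ?case
        using lim_imp_Liminf[OF trivial_limit_sequentially] by metis
    qed
    hence "(\<integral>\<^sup>+\<omega>. ennreal (excess c (Z' \<omega>)) \<partial>M)
        = (\<integral>\<^sup>+\<omega>. liminf (\<lambda>n. ennreal (excess c (Z n \<omega>))) \<partial>M)"
      by (rule nn_integral_cong_AE)
    also have "\<dots> \<le> liminf (\<lambda>n. \<integral>\<^sup>+\<omega>. ennreal (excess c (Z n \<omega>)) \<partial>M)"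
      by (rule nn_integral_liminf) measurable
    also have "\<dots> \<le> (\<integral>\<^sup>+\<omega>. ennreal (excess c (Y \<omega>)) \<partial>M)"
      using dom c by (intro Liminf_le) (auto simp: excess_dominated_def)
    finally show "(\<integral>\<^sup>+\<omega>. ennreal (excess c (Z' \<omega>)) \<partial>M) \<le> (\<integral>\<^sup>+\<omega>. ennreal (excess c (Y \<omega>)) \<partial>M)" .
  qed fact
  define clip where "clip c x = max (-c) (min c x)" for c x :: real
  have [measurable]: "clip c \<in> borel_measurable borel" for c
    unfolding clip_def by measurable
  have clip_excess: "\<bar>x - clip c x\<bar> = excess c x" if "c \<ge> 0" for c x
    using that by (auto simp: clip_def excess_def)
  have clip_int: "integrable M (\<lambda>\<omega>. clip c (V \<omega>))" if "V \<in> borel_measurable M" "c \<ge> 0" for c V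
    by (rule integrable_const_bound[where B=c]) (use that in \<open>auto simp: clip_def\<close>)
  have clip_error: "\<bar>expectation V - expectation (\<lambda>\<omega>. clip c (V \<omega>))\<bar> < e"
    if V: "excess_dominated M Y V" and c: "c \<ge> 0" "(\<integral>\<^sup>+\<omega>. ennreal (excess c (Y \<omega>)) \<partial>M) < ennreal e"
    for V c e
  proof -
    have mV [measurable]: "V \<in> borel_measurable M"
      using V by (simp add: excess_dominated_def)
    have iV: "integrable M V"
      using excess_dominated_integrable[OF Y V] .
    have "ennreal \<bar>expectation V - expectation (\<lambda>\<omega>. clip c (V \<omega>))\<bar>
        = ennreal (norm (expectation (\<lambda>\<omega>. V \<omega> - clip c (V \<omega>))))"
      using iV clip_int[OF mV c(1)] by simp
    also have "\<dots> \<le> (\<integral>\<^sup>+\<omega>. ennreal (norm (V \<omega> - clip c (V \<omega>))) \<partial>M)"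
      by (rule integral_norm_bound_ennreal) (use iV clip_int[OF mV c(1)] in auto)
    also have "\<dots> = (\<integral>\<^sup>+\<omega>. ennreal (excess c (V \<omega>)) \<partial>M)"
      using clip_excess[OF c(1)] by simp
    also have "\<dots> < ennreal e"
      using V c by (auto simp: excess_dominated_def intro: le_less_trans)
    finally show ?thesis
      by (simp add: ennreal_less_iff)
  qed
  show "(\<lambda>n. expectation (Z n)) \<longlonglongrightarrow> expectation Z'"
  proof (rule LIMSEQ_I)
    fix r :: real assume r: "r > 0"
    then obtain c where c: "c \<ge> 0" "(\<integral>\<^sup>+\<omega>. ennreal (excess c (Y \<omega>)) \<partial>M) < ennreal (r/3)"
      using excess_dominated_tail[OF Y, of "r/3"] by auto
    have "(\<lambda>n. expectation (\<lambda>\<omega>. clip c (Z n \<omega>))) \<longlonglongrightarrow> expectation (\<lambda>\<omega>. clip c (Z' \<omega>))"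
    proof (rule integral_dominated_convergence[where w="\<lambda>_. c"])
      show "AE \<omega> in M. (\<lambda>n. clip c (Z n \<omega>)) \<longlonglongrightarrow> clip c (Z' \<omega>)"
        using lim unfolding clip_def by eventually_elim (intro tendsto_intros)
      show "AE \<omega> in M. norm (clip c (Z n \<omega>)) \<le> c" for n
        using c by (auto simp: clip_def)
    qed measurable
    from LIMSEQ_D[OF this, of "r/3"] r obtain n0 where n0: "\<forall>n\<ge>n0.
        norm (expectation (\<lambda>\<omega>. clip c (Z n \<omega>)) - expectation (\<lambda>\<omega>. clip c (Z' \<omega>))) < r/3"
      by auto
    have "norm (expectation (Z n) - expectation Z') < r" if "n \<ge> n0" for n
      using n0[rule_format, OF that] clip_error[OF dom[of n] c] clip_error[OF dom' c]
      by (simp only: real_norm_def)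
    thus "\<exists>n0. \<forall>n\<ge>n0. norm (expectation (Z n) - expectation Z') < r"
      by blast
  qed
qed

end

context usual_filtered_prob_space
begin

section \<open>Martingales and stopping\<close>

lemma space_F: "t \<in> {0..T} \<Longrightarrow> space (F t) = space M"
  using subalgebra_F by (simp add: subalgebra_def)

lemma sets_F: "t \<in> {0..T} \<Longrightarrow> B \<in> sets (F t) \<Longrightarrow> B \<in> sets M"
  using subalgebra_F by (auto simp: subalgebra_def)

lemma sets_F_mono: "s \<in> {0..T} \<Longrightarrow> t \<in> {0..T} \<Longrightarrow> s \<le> t \<Longrightarrow> B \<in> sets (F s) \<Longrightarrow> B \<in> sets (F t)"
  using F_mono[of s t] by auto

lemma measurable_F_mono:
  "s \<in> {0..T} \<Longrightarrow> t \<in> {0..T} \<Longrightarrow> s \<le> t \<Longrightarrow> f \<in> borel_measurable (F s) \<Longrightarrow> f \<in> borel_measurable (F t)"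
  using F_mono[of s t] space_F by (auto simp: measurable_def)

lemma measurable_F_M: "t \<in> {0..T} \<Longrightarrow> f \<in> borel_measurable (F t) \<Longrightarrow> f \<in> borel_measurable M"
  using measurable_from_subalg[OF subalgebra_F] by blast

lemma null_in_F:
  assumes "N \<in> null_sets M" "t \<in> {0..T}" shows "N \<in> sets (F t)"
  using F_complete[OF assms(1) order_refl] sets_F_mono[of 0 t] assms T_pos by auto

lemma adapted_mono_measurable:
  "adapted F T X \<Longrightarrow> s \<in> {0..T} \<Longrightarrow> t \<in> {0..T} \<Longrightarrow> s \<le> t \<Longrightarrow> X s \<in> borel_measurable (F t)"
  using measurable_F_mono[of s t] unfolding adapted_def by blast

lemma adapted_measurable: "adapted F T X \<Longrightarrow> t \<in> {0..T} \<Longrightarrow> X t \<in> borel_measurable M"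
  using measurable_F_M unfolding adapted_def by blast

text \<open>
  Outside \<open>{0..T}\<close> nothing is known about \<open>F\<close>, but for a time with values in \<open>{0..T}\<close> the events to be
  tested there are trivial.
\<close>
lemma stopping_time_iff:
  assumes "\<And>\<omega>. \<rho> \<omega> \<in> {0..T}"
  shows "stopping_time F \<rho> \<longleftrightarrow> (\<forall>t\<in>{0..<T}. {\<omega>\<in>space M. \<rho> \<omega> \<le> t} \<in> sets (F t))"
proof
  assume \<rho>: "stopping_time F \<rho>"
  show "\<forall>t\<in>{0..<T}. {\<omega>\<in>space M. \<rho> \<omega> \<le> t} \<in> sets (F t)"
  proof
    fix t assume "t \<in> {0..<T}"
    thus "{\<omega>\<in>space M. \<rho> \<omega> \<le> t} \<in> sets (F t)"
      using stopping_timeD[OF \<rho>, of t] space_F[of t] by (simp add: Measurable.pred_def)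
  qed
next
  assume *: "\<forall>t\<in>{0..<T}. {\<omega>\<in>space M. \<rho> \<omega> \<le> t} \<in> sets (F t)"
  show "stopping_time F \<rho>"
  proof
    fix t
    consider "t < 0" | "t \<in> {0..<T}" | "t \<ge> T" by fastforce
    thus "Measurable.pred (F t) (\<lambda>\<omega>. \<rho> \<omega> \<le> t)"
    proof cases
      case 1
      hence "\<not> \<rho> \<omega> \<le> t" for \<omega> using assms[of \<omega>] by auto
      thus ?thesis by simp
    next
      case 2
      thus ?thesis using * space_F[of t] by (simp add: Measurable.pred_def)
    next
      case 3
      hence "\<rho> \<omega> \<le> t" for \<omega> using assms[of \<omega>] by auto
      thus ?thesis by simp
    qed
  qed
qed

lemma stopping_le_sets:
  assumes "stopping_time F \<rho>" "s \<in> {0..T}" "t \<in> {0..T}" "s \<le> t"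
  shows "{\<omega>\<in>space M. \<rho> \<omega> \<le> s} \<in> sets (F t)"
proof -
  have "{\<omega>\<in>space M. \<rho> \<omega> \<le> s} \<in> sets (F s)"
    using stopping_timeD[OF assms(1), of s] space_F[OF assms(2)] by (simp add: Measurable.pred_def)
  thus ?thesis by (rule sets_F_mono[OF assms(2-4)])
qed

lemma stopping_less_sets:
  assumes \<rho>: "stopping_time F \<rho>" "\<And>\<omega>. \<rho> \<omega> \<in> {0..T}" and t: "t \<in> {0..T}"
  shows "{\<omega>\<in>space M. \<rho> \<omega> < t} \<in> sets (F t)"
proof -
  have "{\<omega>\<in>space M. \<rho> \<omega> < t} = (\<Union>q\<in>\<rat> \<inter> {0..<t}. {\<omega>\<in>space M. \<rho> \<omega> \<le> q})"
  proof safe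
    fix \<omega> assume "\<rho> \<omega> < t"
    then obtain q where "q \<in> \<rat>" "\<rho> \<omega> < q" "q < t"
      using Rats_dense_in_real by blast
    moreover have "0 \<le> q" using \<rho>(2)[of \<omega>] \<open>\<rho> \<omega> < q\<close> by auto
    moreover assume "\<omega> \<in> space M"
    ultimately show "\<omega> \<in> (\<Union>q\<in>\<rat> \<inter> {0..<t}. {\<omega>\<in>space M. \<rho> \<omega> \<le> q})"
      by (intro UN_I[of q]) auto
  qed auto
  also have "\<dots> \<in> sets (F t)"
  proof (rule sets.countable_UN'')
    show "{\<omega>\<in>space M. \<rho> \<omega> \<le> q} \<in> sets (F t)" if "q \<in> \<rat> \<inter> {0..<t}" for q
      using stopping_le_sets[OF \<rho>(1), of q t] that t by auto
    show "countable (\<rat> \<inter> {0..<t})"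
      by (rule countable_subset[OF _ countable_rat]) auto
  qed
  finally show ?thesis .
qed

lemma stopping_eq_sets:
  assumes \<rho>: "stopping_time F \<rho>" "\<And>\<omega>. \<rho> \<omega> \<in> {0..T}" and t: "t \<in> {0..T}"
  shows "{\<omega>\<in>space M. \<rho> \<omega> = t} \<in> sets (F t)"
proof -
  have "{\<omega>\<in>space M. \<rho> \<omega> = t} = {\<omega>\<in>space M. \<rho> \<omega> \<le> t} - {\<omega>\<in>space M. \<rho> \<omega> < t}"
    by auto
  thus ?thesis
    using stopping_less_sets[OF assms] stopping_le_sets[OF \<rho>(1) t t order_refl] by simp
qed

lemma stopping_min_measurable:
  assumes \<rho>: "stopping_time F \<rho>" "\<And>\<omega>. \<rho> \<omega> \<in> {0..T}" and t: "t \<in> {0..T}"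
  shows "(\<lambda>\<omega>. min t (\<rho> \<omega>)) \<in> borel_measurable (F t)"
proof (rule borel_measurableI_le)
  fix y
  show "{\<omega> \<in> space (F t). min t (\<rho> \<omega>) \<le> y} \<in> sets (F t)"
  proof (cases "y \<in> {0..<t}")
    case True
    thus ?thesis
      using stopping_le_sets[OF \<rho>(1), of y t] t space_F[OF t] by (auto simp: min_le_iff_disj)
  next
    case False
    hence "{\<omega> \<in> space (F t). min t (\<rho> \<omega>) \<le> y} = (if y < 0 then {} else space (F t))"
      using \<rho>(2) t by (auto simp: min_le_iff_disj not_le intro: less_le_trans)
    thus ?thesis by (auto split: if_splits)
  qed
qed

lemma stopping_time_ceil_grid:
  assumes \<rho>: "stopping_time F \<rho>" "\<And>\<omega>. \<rho> \<omega> \<in> {0..T}"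
  shows "stopping_time F (\<lambda>\<omega>. ceil_grid n T (\<rho> \<omega>))"
    and "ceil_grid n T (\<rho> \<omega>) \<in> {0..T}"
proof -
  show in_range: "ceil_grid n T (\<rho> \<omega>) \<in> {0..T}" for \<omega>
    using ceil_grid_bounds[of "\<rho> \<omega>" T n] \<rho>(2)[of \<omega>] by auto
  show "stopping_time F (\<lambda>\<omega>. ceil_grid n T (\<rho> \<omega>))"
  proof (subst stopping_time_iff[OF in_range], intro ballI)
    fix t assume t: "t \<in> {0..<T}"
    define k where "k = real (Suc n)"
    have k: "k > 0" by (simp add: k_def)
    define s where "s = of_int \<lfloor>t * k\<rfloor> / k"
    have s: "0 \<le> s" "s \<le> t"
      using t k by (auto simp: s_def pos_divide_le_eq)
    have "ceil_grid n T r \<le> t \<longleftrightarrow> r \<le> s" for r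
    proof -
      have "ceil_grid n T r \<le> t \<longleftrightarrow> of_int \<lceil>r * k\<rceil> / k \<le> t"
        using t by (auto simp: ceil_grid_def k_def min_le_iff_disj)
      also have "\<dots> \<longleftrightarrow> of_int \<lceil>r * k\<rceil> \<le> t * k"
        using k by (simp add: pos_divide_le_eq)
      also have "\<dots> \<longleftrightarrow> \<lceil>r * k\<rceil> \<le> \<lfloor>t * k\<rfloor>"
        by (simp add: le_floor_iff)
      also have "\<dots> \<longleftrightarrow> r \<le> s"
        using k by (simp add: s_def ceiling_le_iff pos_le_divide_eq)
      finally show ?thesis .
    qed
    thus "{\<omega> \<in> space M. ceil_grid n T (\<rho> \<omega>) \<le> t} \<in> sets (F t)"
      using stopping_le_sets[OF \<rho>(1), of s t] s t by auto
  qed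
qed

text \<open>
  Stopping arguments cut and paste events of the past, so they use the martingale property in the form
  of integrals over such events.
\<close>
lemma martingale_iff_integrals:
  "martingale M F T X \<longleftrightarrow> adapted F T X \<and> (\<forall>t\<in>{0..T}. integrable M (X t)) \<and>
     (\<forall>s t B. 0 \<le> s \<longrightarrow> s \<le> t \<longrightarrow> t \<le> T \<longrightarrow> B \<in> sets (F s) \<longrightarrow>
        expectation (\<lambda>\<omega>. indicator B \<omega> * X t \<omega>) = expectation (\<lambda>\<omega>. indicator B \<omega> * X s \<omega>))"
proof -
  have *: "(AE \<omega> in M. real_cond_exp M (F s) (X t) \<omega> = X s \<omega>) \<longleftrightarrow>
     (\<forall>B\<in>sets (F s). expectation (\<lambda>\<omega>. indicator B \<omega> * X t \<omega>) = expectation (\<lambda>\<omega>. indicator B \<omega> * X s \<omega>))"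
    if X: "adapted F T X" "\<forall>t\<in>{0..T}. integrable M (X t)" and st: "0 \<le> s" "s \<le> t" "t \<le> T" for s t
  proof -
    have sub: "subalgebra M (F s)" using st subalgebra_F by auto
    interpret sub: sigma_finite_subalgebra M "F s"
      by (intro finite_measure_subalgebra_is_sigma_finite finite_measure_subalgebra.intro
          finite_measure_subalgebra_axioms.intro sub) unfold_locales
    have int: "integrable M (X s)" "integrable M (X t)" and meas: "X s \<in> borel_measurable (F s)"
      using X st by (auto simp: adapted_def)
    show ?thesis
    proof (intro iffI ballI)
      fix B assume AE: "AE \<omega> in M. real_cond_exp M (F s) (X t) \<omega> = X s \<omega>" and B: "B \<in> sets (F s)"
      have "expectation (\<lambda>\<omega>. indicator B \<omega> * X t \<omega>)
          = expectation (\<lambda>\<omega>. indicator B \<omega> * real_cond_exp M (F s) (X t) \<omega>)"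
        using sub.real_cond_exp_intA[OF int(2) B] by (simp add: set_lebesgue_integral_def)
      also have "\<dots> = expectation (\<lambda>\<omega>. indicator B \<omega> * X s \<omega>)"
        using AE sets_F[of s B] B st int by (intro integral_cong_AE) auto
      finally show "expectation (\<lambda>\<omega>. indicator B \<omega> * X t \<omega>) = expectation (\<lambda>\<omega>. indicator B \<omega> * X s \<omega>)" .
    next
      assume "\<forall>B\<in>sets (F s). expectation (\<lambda>\<omega>. indicator B \<omega> * X t \<omega>) = expectation (\<lambda>\<omega>. indicator B \<omega> * X s \<omega>)"
      thus "AE \<omega> in M. real_cond_exp M (F s) (X t) \<omega> = X s \<omega>"
        by (intro sub.real_cond_exp_charact int meas) (simp add: set_lebesgue_integral_def)
    qed
  qed
  show ?thesis
  proof (cases "adapted F T X \<and> (\<forall>t\<in>{0..T}. integrable M (X t))")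
    case True
    hence *: "(AE \<omega> in M. real_cond_exp M (F s) (X t) \<omega> = X s \<omega>) \<longleftrightarrow>
      (\<forall>B. B \<in> sets (F s) \<longrightarrow> expectation (\<lambda>\<omega>. indicator B \<omega> * X t \<omega>) = expectation (\<lambda>\<omega>. indicator B \<omega> * X s \<omega>))"
      if "0 \<le> s \<and> s \<le> t \<and> t \<le> T" for s t
      using *[of s t] that by blast
    have "(\<forall>s t. 0 \<le> s \<and> s \<le> t \<and> t \<le> T \<longrightarrow> (AE \<omega> in M. real_cond_exp M (F s) (X t) \<omega> = X s \<omega>)) \<longleftrightarrow>
      (\<forall>s t. 0 \<le> s \<and> s \<le> t \<and> t \<le> T \<longrightarrow> (\<forall>B. B \<in> sets (F s) \<longrightarrow>
        expectation (\<lambda>\<omega>. indicator B \<omega> * X t \<omega>) = expectation (\<lambda>\<omega>. indicator B \<omega> * X s \<omega>)))"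
      by (intro iff_allI imp_cong refl *)
    thus ?thesis
      unfolding martingale_def by blast
  next
    case False
    thus ?thesis unfolding martingale_def by blast
  qed
qed

lemma martingale_adapted: "martingale M F T X \<Longrightarrow> adapted F T X"
  unfolding martingale_def by blast

lemma martingale_integrable: "martingale M F T X \<Longrightarrow> t \<in> {0..T} \<Longrightarrow> integrable M (X t)"
  unfolding martingale_def by blast

lemma martingale_indicator:
  assumes "martingale M F T X" "s \<in> {0..T}" "t \<in> {0..T}" "s \<le> t" "B \<in> sets (F s)"
  shows "expectation (\<lambda>\<omega>. indicator B \<omega> * X t \<omega>) = expectation (\<lambda>\<omega>. indicator B \<omega> * X s \<omega>)"
proof -
  have "0 \<le> s" "t \<le> T" using assms(2,3) by auto
  thus ?thesis
    using assms(1)[unfolded martingale_iff_integrals] assms(4,5) by blast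
qed

lemma indicator_integrable:
  fixes f :: "'a \<Rightarrow> real"
  assumes "integrable M f" "B \<in> sets M"
  shows "integrable M (\<lambda>\<omega>. indicator B \<omega> * f \<omega>)"
  using integrable_mult_indicator[OF assms(2,1)] by simp

text \<open>
  Conditional Jensen inequality for \<open>excess c\<close>: on each of the events \<open>X g > c\<close>, \<open>X g < -c\<close> and the
  remaining one, the function is affine in \<open>X g\<close>, and the affine function lies below \<open>excess c\<close>
  everywhere.
\<close>
lemma martingale_excess_indicator:
  assumes X: "martingale M F T X" and g: "g \<in> {0..T}" and B: "B \<in> sets (F g)" and c: "c \<ge> 0"
  shows "expectation (\<lambda>\<omega>. indicator B \<omega> * excess c (X g \<omega>))
    \<le> expectation (\<lambda>\<omega>. indicator B \<omega> * excess c (X T \<omega>))"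
proof -
  have T: "T \<in> {0..T}" "g \<le> T" using T_pos g by auto
  have int: "integrable M (X g)" "integrable M (X T)" and meas [measurable]: "X g \<in> borel_measurable (F g)"
    using X g T unfolding martingale_def adapted_def by blast+
  define P where "P = B \<inter> {\<omega>\<in>space (F g). X g \<omega> > c}"
  define N where "N = B \<inter> {\<omega>\<in>space (F g). X g \<omega> < - c}"
  have PN: "P \<in> sets (F g)" "N \<in> sets (F g)"
    unfolding P_def N_def using B by measurable
  have PN': "P \<in> sets M" "N \<in> sets M" "B \<in> sets M"
    using PN B sets_F[OF g] by auto
  have ic: "integrable M (\<lambda>\<omega>. indicator A \<omega> * c)" if "A \<in> sets M" for A
    using indicator_integrable[OF integrable_const that] .
  have iexc: "integrable M (\<lambda>\<omega>. excess c (Y \<omega>))" if "integrable M Y" for Y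
    by (rule Bochner_Integration.integrable_bound[OF that]) (use that c in \<open>auto simp: excess_def\<close>)
  have "expectation (\<lambda>\<omega>. indicator B \<omega> * excess c (X g \<omega>)) =
    expectation (\<lambda>\<omega>. indicator P \<omega> * X g \<omega> - indicator P \<omega> * c - indicator N \<omega> * X g \<omega> - indicator N \<omega> * c)"
    using c sets.sets_into_space[OF B]
    by (intro Bochner_Integration.integral_cong) (auto simp: P_def N_def excess_def indicator_def)
  also have "\<dots> = expectation (\<lambda>\<omega>. indicator P \<omega> * X g \<omega>) - expectation (\<lambda>\<omega>. indicator P \<omega> * c)
      - expectation (\<lambda>\<omega>. indicator N \<omega> * X g \<omega>) - expectation (\<lambda>\<omega>. indicator N \<omega> * c)"
    by (simp only: Bochner_Integration.integral_diff Bochner_Integration.integrable_diff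
        indicator_integrable ic int PN')
  also have "\<dots> = expectation (\<lambda>\<omega>. indicator P \<omega> * X T \<omega>) - expectation (\<lambda>\<omega>. indicator P \<omega> * c)
      - expectation (\<lambda>\<omega>. indicator N \<omega> * X T \<omega>) - expectation (\<lambda>\<omega>. indicator N \<omega> * c)"
    using martingale_indicator[OF X g T] PN by simp
  also have "\<dots> = expectation (\<lambda>\<omega>. indicator P \<omega> * X T \<omega> - indicator P \<omega> * c
      - indicator N \<omega> * X T \<omega> - indicator N \<omega> * c)"
    by (simp only: Bochner_Integration.integral_diff Bochner_Integration.integrable_diff
        indicator_integrable ic int PN')
  also have "\<dots> \<le> expectation (\<lambda>\<omega>. indicator B \<omega> * excess c (X T \<omega>))"
  proof (rule integral_mono)
    show "integrable M (\<lambda>\<omega>. indicator P \<omega> * X T \<omega> - indicator P \<omega> * c - indicator N \<omega> * X T \<omega> - indicator N \<omega> * c)"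
      by (intro Bochner_Integration.integrable_diff indicator_integrable ic int PN')
    show "integrable M (\<lambda>\<omega>. indicator B \<omega> * excess c (X T \<omega>))"
      by (intro indicator_integrable iexc int PN')
  qed (use c in \<open>auto simp: P_def N_def excess_def indicator_def\<close>)
  finally show ?thesis .
qed

lemma optional_stopping_finite:
  assumes X: "martingale M F T X" and \<rho>: "stopping_time F \<rho>" "\<And>\<omega>. \<rho> \<omega> \<in> {0..T}"
    and fin: "finite (range \<rho>)"
  shows "excess_dominated M (X T) (\<lambda>\<omega>. X (\<rho> \<omega>) \<omega>)"
    and "expectation (\<lambda>\<omega>. X (\<rho> \<omega>) \<omega>) = expectation (X T)"
proof -
  have T: "T \<in> {0..T}" using T_pos by auto
  define G where "G = range \<rho>"
  have G: "finite G" "G \<subseteq> {0..T}" using fin \<rho>(2) unfolding G_def by blast+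
  define B where "B g = {\<omega>\<in>space M. \<rho> \<omega> = g}" for g
  have B: "B g \<in> sets (F g)" if "g \<in> G" for g
    using stopping_eq_sets[OF \<rho>, of g] that G by (auto simp: B_def)
  have BM: "B g \<in> sets M" if "g \<in> G" for g
    using B[OF that] sets_F[of g] that G by auto
  have split: "f (\<rho> \<omega>) = (\<Sum>g\<in>G. indicator (B g) \<omega> * f g)" if "\<omega> \<in> space M" for f :: "real \<Rightarrow> real" and \<omega>
  proof -
    have "(\<Sum>g\<in>G. indicator (B g) \<omega> * f g) = (\<Sum>g\<in>G. if g = \<rho> \<omega> then f g else 0)"
      using that by (intro sum.cong) (auto simp: B_def indicator_def)
    also have "\<dots> = f (\<rho> \<omega>)"
      using G(1) by (simp add: G_def)
    finally show ?thesis by simp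
  qed
  have int: "integrable M (X t)" if "t \<in> {0..T}" for t
    using martingale_integrable[OF X that] .
  have meas [measurable]: "(\<lambda>\<omega>. X (\<rho> \<omega>) \<omega>) \<in> borel_measurable M"
  proof (subst measurable_cong[OF split])
    show "(\<lambda>\<omega>. \<Sum>g\<in>G. indicator (B g) \<omega> * X g \<omega>) \<in> borel_measurable M"
      using int G BM by (intro borel_measurable_sum borel_measurable_times) auto
  qed
  have "expectation (\<lambda>\<omega>. X (\<rho> \<omega>) \<omega>) = expectation (\<lambda>\<omega>. \<Sum>g\<in>G. indicator (B g) \<omega> * X g \<omega>)"
    by (rule Bochner_Integration.integral_cong[OF refl split])
  also have "\<dots> = (\<Sum>g\<in>G. expectation (\<lambda>\<omega>. indicator (B g) \<omega> * X g \<omega>))"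
    using int G BM by (intro Bochner_Integration.integral_sum indicator_integrable) auto
  also have "\<dots> = (\<Sum>g\<in>G. expectation (\<lambda>\<omega>. indicator (B g) \<omega> * X T \<omega>))"
    using martingale_indicator[OF X _ T _ B] G T by (intro sum.cong) (auto simp: subset_iff)
  also have "\<dots> = expectation (\<lambda>\<omega>. \<Sum>g\<in>G. indicator (B g) \<omega> * X T \<omega>)"
    using int T BM by (intro Bochner_Integration.integral_sum[symmetric] indicator_integrable) auto
  also have "\<dots> = expectation (X T)"
    by (rule Bochner_Integration.integral_cong[OF refl split[symmetric]])
  finally show "expectation (\<lambda>\<omega>. X (\<rho> \<omega>) \<omega>) = expectation (X T)" .
  show "excess_dominated M (X T) (\<lambda>\<omega>. X (\<rho> \<omega>) \<omega>)"
    unfolding excess_dominated_def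
  proof (intro conjI allI impI meas)
    fix c :: real assume c: "c \<ge> 0"
    have iexc: "integrable M (\<lambda>\<omega>. excess c (X t \<omega>))" if "t \<in> {0..T}" for t
      by (rule Bochner_Integration.integrable_bound[OF int[OF that]])
        (use int[OF that] c in \<open>auto simp: excess_def\<close>)
    have "(\<integral>\<^sup>+\<omega>. ennreal (excess c (X (\<rho> \<omega>) \<omega>)) \<partial>M)
        = (\<integral>\<^sup>+\<omega>. ennreal (\<Sum>g\<in>G. indicator (B g) \<omega> * excess c (X g \<omega>)) \<partial>M)"
      using split by (intro nn_integral_cong) simp
    also have "\<dots> = ennreal (expectation (\<lambda>\<omega>. \<Sum>g\<in>G. indicator (B g) \<omega> * excess c (X g \<omega>)))"
      using iexc G BM
      by (intro nn_integral_eq_integral Bochner_Integration.integrable_sum indicator_integrable AE_I2 sum_nonneg)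
        (auto simp: excess_def)
    also have "expectation (\<lambda>\<omega>. \<Sum>g\<in>G. indicator (B g) \<omega> * excess c (X g \<omega>))
        = (\<Sum>g\<in>G. expectation (\<lambda>\<omega>. indicator (B g) \<omega> * excess c (X g \<omega>)))"
      using iexc G BM by (intro Bochner_Integration.integral_sum indicator_integrable) auto
    also have "\<dots> \<le> (\<Sum>g\<in>G. expectation (\<lambda>\<omega>. indicator (B g) \<omega> * excess c (X T \<omega>)))"
      using G B c by (intro sum_mono martingale_excess_indicator[OF X]) auto
    also have "\<dots> = expectation (\<lambda>\<omega>. \<Sum>g\<in>G. indicator (B g) \<omega> * excess c (X T \<omega>))"
      using iexc T BM by (intro Bochner_Integration.integral_sum[symmetric] indicator_integrable) auto
    also have "\<dots> = expectation (\<lambda>\<omega>. excess c (X T \<omega>))"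
      by (rule Bochner_Integration.integral_cong[OF refl split[symmetric]])
    also have "ennreal \<dots> = (\<integral>\<^sup>+\<omega>. ennreal (excess c (X T \<omega>)) \<partial>M)"
      using iexc[OF T] by (intro nn_integral_eq_integral[symmetric]) (auto simp: excess_def)
    finally show "(\<integral>\<^sup>+\<omega>. ennreal (excess c (X (\<rho> \<omega>) \<omega>)) \<partial>M) \<le> (\<integral>\<^sup>+\<omega>. ennreal (excess c (X T \<omega>)) \<partial>M)"
      by (simp add: ennreal_leI)
  qed
qed

lemma adapted_at_random_time:
  assumes X: "adapted F T X" "cadlag M T X" and t: "t \<in> {0..T}"
    and \<rho>: "\<rho> \<in> borel_measurable (F t)" "\<And>\<omega>. \<rho> \<omega> \<in> {0..t}"
  shows "(\<lambda>\<omega>. X (\<rho> \<omega>) \<omega>) \<in> borel_measurable (F t)"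
proof (rule measurable_at_random_time[where X=X, OF _ _ _ \<rho>])
  show "X s \<in> borel_measurable (F t)" if "s \<in> {0..t}" for s
    using adapted_mono_measurable[OF X(1), of s t] that t by auto
  show "cadlag_path T (\<lambda>t. X t \<omega>)" if "\<omega> \<in> space (F t)" for \<omega>
    using X(2) that space_F[OF t] by (simp add: cadlag_def)
qed (use t in auto)

text \<open>
  The grid times decrease to \<open>\<rho>\<close>, and the excess bound, uniform along the grid, allows the limit to be
  taken under the expectation. The excess bound is kept in the conclusion since further limits along
  sequences of stopping times follow.
\<close>
lemma optional_stopping:
  assumes X: "martingale M F T X" "cadlag M T X" and \<rho>: "stopping_time F \<rho>" "\<And>\<omega>. \<rho> \<omega> \<in> {0..T}"
  shows "excess_dominated M (X T) (\<lambda>\<omega>. X (\<rho> \<omega>) \<omega>)"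
    and "expectation (\<lambda>\<omega>. X (\<rho> \<omega>) \<omega>) = expectation (X T)"
proof -
  have T: "T \<in> {0..T}" using T_pos by auto
  have fin: "finite (range (\<lambda>\<omega>. ceil_grid n T (\<rho> \<omega>)))" for n
    by (rule finite_subset[OF _ finite_ceil_grid[of n T]]) (use \<rho>(2) in blast)
  note disc = optional_stopping_finite[OF X(1) stopping_time_ceil_grid[OF \<rho>] fin]
  have "min T (\<rho> \<omega>) = \<rho> \<omega>" for \<omega> using \<rho>(2)[of \<omega>] by auto
  hence "\<rho> \<in> borel_measurable (F T)"
    using stopping_min_measurable[OF \<rho> T] by simp
  hence meas: "(\<lambda>\<omega>. X (\<rho> \<omega>) \<omega>) \<in> borel_measurable M"
    by (intro measurable_F_M[OF T] adapted_at_random_time[OF martingale_adapted[OF X(1)] X(2) T] \<rho>(2))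
  have lim: "AE \<omega> in M. (\<lambda>n. X (ceil_grid n T (\<rho> \<omega>)) \<omega>) \<longlonglongrightarrow> X (\<rho> \<omega>) \<omega>"
  proof (rule AE_I2)
    fix \<omega> assume "\<omega> \<in> space M"
    hence "cadlag_path T (\<lambda>t. X t \<omega>)" using X(2) by (simp add: cadlag_def)
    thus "(\<lambda>n. X (ceil_grid n T (\<rho> \<omega>)) \<omega>) \<longlonglongrightarrow> X (\<rho> \<omega>) \<omega>"
      using cadlag_path_ceil_grid_tendsto[of T "\<lambda>t. X t \<omega>" "\<rho> \<omega>" T] \<rho>(2)[of \<omega>] by simp
  qed
  have int: "integrable M (X T)"
    by (rule martingale_integrable[OF X(1) T])
  show "excess_dominated M (X T) (\<lambda>\<omega>. X (\<rho> \<omega>) \<omega>)"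
    by (rule excess_dominated_limit(1)[OF int disc(1) meas lim])
  have "(\<lambda>n. expectation (\<lambda>\<omega>. X (ceil_grid n T (\<rho> \<omega>)) \<omega>)) \<longlonglongrightarrow> expectation (\<lambda>\<omega>. X (\<rho> \<omega>) \<omega>)"
    by (rule excess_dominated_limit(2)[OF int disc(1) meas lim])
  thus "expectation (\<lambda>\<omega>. X (\<rho> \<omega>) \<omega>) = expectation (X T)"
    by (simp add: disc(2) LIMSEQ_const_iff)
qed

text \<open>
  At time \<open>s\<close> it is known whether \<open>B\<close> has occurred, so one may decide then to go on until \<open>t\<close>.
  Comparing this time with \<open>min s (\<sigma> \<omega>)\<close> by optional stopping isolates the integrals over \<open>B\<close>.
\<close>
lemma stopping_time_switch:
  assumes \<sigma>: "stopping_time F \<sigma>" "\<And>\<omega>. \<sigma> \<omega> \<in> {0..T}"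
    and st: "s \<in> {0..T}" "t \<in> {0..T}" "s \<le> t" and B: "B \<in> sets (F s)"
  shows "stopping_time F (\<lambda>\<omega>. min (if \<omega> \<in> B then t else s) (\<sigma> \<omega>))"
    and "min (if \<omega> \<in> B then t else s) (\<sigma> \<omega>) \<in> {0..T}"
proof -
  show range: "min (if \<omega> \<in> B then t else s) (\<sigma> \<omega>) \<in> {0..T}" for \<omega>
    using \<sigma>(2)[of \<omega>] st by auto
  show "stopping_time F (\<lambda>\<omega>. min (if \<omega> \<in> B then t else s) (\<sigma> \<omega>))"
  proof (subst stopping_time_iff[OF range], intro ballI)
    fix u assume u: "u \<in> {0..<T}"
    hence u': "u \<in> {0..T}" by auto
    have \<sigma>u: "{\<omega>\<in>space M. \<sigma> \<omega> \<le> u} \<in> sets (F u)"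
      using stopping_le_sets[OF \<sigma>(1) u' u'] by simp
    have sp: "space M \<in> sets (F u)"
      using sets.top[of "F u"] space_F[OF u'] by simp
    consider "t \<le> u" | "s \<le> u" "u < t" | "u < s" by linarith
    thus "{\<omega> \<in> space M. min (if \<omega> \<in> B then t else s) (\<sigma> \<omega>) \<le> u} \<in> sets (F u)"
    proof cases
      case 1
      hence "{\<omega> \<in> space M. min (if \<omega> \<in> B then t else s) (\<sigma> \<omega>) \<le> u} = space M"
        using st(3) by (auto simp: min_le_iff_disj)
      thus ?thesis using sp by simp
    next
      case 2
      hence "{\<omega> \<in> space M. min (if \<omega> \<in> B then t else s) (\<sigma> \<omega>) \<le> u} = {\<omega>\<in>space M. \<sigma> \<omega> \<le> u} \<union> (space M - B)"
        by (auto simp: min_le_iff_disj)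
      thus ?thesis using sp \<sigma>u sets_F_mono[OF st(1) u' 2(1) B] by simp
    next
      case 3
      hence "{\<omega> \<in> space M. min (if \<omega> \<in> B then t else s) (\<sigma> \<omega>) \<le> u} = {\<omega>\<in>space M. \<sigma> \<omega> \<le> u}"
        using st(3) by (auto simp: min_le_iff_disj)
      thus ?thesis using \<sigma>u by simp
    qed
  qed
qed

lemma stopping_time_const_min:
  assumes \<sigma>: "stopping_time F \<sigma>" "\<And>\<omega>. \<sigma> \<omega> \<in> {0..T}" and t: "t \<in> {0..T}"
  shows "stopping_time F (\<lambda>\<omega>. min t (\<sigma> \<omega>))" "min t (\<sigma> \<omega>) \<in> {0..T}"
  using stopping_time_min[OF stopping_time_const \<sigma>(1), of t] \<sigma>(2)[of \<omega>] t by auto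

lemma adapted_stopped:
  assumes X: "adapted F T X" "cadlag M T X" and \<sigma>: "stopping_time F \<sigma>" "\<And>\<omega>. \<sigma> \<omega> \<in> {0..T}"
  shows "adapted F T (\<lambda>t \<omega>. X (min t (\<sigma> \<omega>)) \<omega>)"
  unfolding adapted_def
proof
  fix t assume t: "t \<in> {0..T}"
  have "min t (\<sigma> \<omega>) \<in> {0..t}" for \<omega> using \<sigma>(2)[of \<omega>] t by auto
  thus "(\<lambda>\<omega>. X (min t (\<sigma> \<omega>)) \<omega>) \<in> borel_measurable (F t)"
    by (rule adapted_at_random_time[OF X t stopping_min_measurable[OF \<sigma> t]])
qed

lemma martingale_stopped:
  assumes X: "martingale M F T X" "cadlag M T X" and \<sigma>: "stopping_time F \<sigma>" "\<And>\<omega>. \<sigma> \<omega> \<in> {0..T}"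
  shows "martingale M F T (\<lambda>t \<omega>. X (min t (\<sigma> \<omega>)) \<omega>)"
  unfolding martingale_iff_integrals
proof (intro conjI ballI allI impI)
  have T: "T \<in> {0..T}" using T_pos by auto
  note iT = martingale_integrable[OF X(1) T]
  show "adapted F T (\<lambda>t \<omega>. X (min t (\<sigma> \<omega>)) \<omega>)"
    by (rule adapted_stopped[OF martingale_adapted[OF X(1)] X(2) \<sigma>])
  show int: "integrable M (\<lambda>\<omega>. X (min t (\<sigma> \<omega>)) \<omega>)" if "t \<in> {0..T}" for t
    by (rule excess_dominated_integrable[OF iT
          optional_stopping(1)[OF X stopping_time_const_min[OF \<sigma> that]]])
  fix s t B assume "0 \<le> s" "s \<le> t" "t \<le> T" and B: "B \<in> sets (F s)"
  hence st: "s \<in> {0..T}" "t \<in> {0..T}" "s \<le> t" by auto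
  note \<rho> = stopping_time_switch[OF \<sigma> st B]
  have BM: "B \<in> sets M" using sets_F[OF st(1) B] .
  have BM': "space M - B \<in> sets M" using BM by simp
  let ?Y = "\<lambda>t \<omega>. X (min t (\<sigma> \<omega>)) \<omega>"
  have "expectation (\<lambda>\<omega>. indicator B \<omega> * ?Y t \<omega>) + expectation (\<lambda>\<omega>. indicator (space M - B) \<omega> * ?Y s \<omega>)
    = expectation (\<lambda>\<omega>. indicator B \<omega> * ?Y t \<omega> + indicator (space M - B) \<omega> * ?Y s \<omega>)"
    using indicator_integrable int st BM BM' by simp
  also have "\<dots> = expectation (\<lambda>\<omega>. X (min (if \<omega> \<in> B then t else s) (\<sigma> \<omega>)) \<omega>)"
    by (rule Bochner_Integration.integral_cong) (auto simp: indicator_def)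
  also have "\<dots> = expectation (X T)"
    by (rule optional_stopping(2)[OF X \<rho>])
  also have "\<dots> = expectation (?Y s)"
    by (rule optional_stopping(2)[OF X stopping_time_const_min[OF \<sigma> st(1)], symmetric])
  also have "\<dots> = expectation (\<lambda>\<omega>. indicator B \<omega> * ?Y s \<omega> + indicator (space M - B) \<omega> * ?Y s \<omega>)"
    by (rule Bochner_Integration.integral_cong) (auto simp: indicator_def)
  also have "\<dots> = expectation (\<lambda>\<omega>. indicator B \<omega> * ?Y s \<omega>) + expectation (\<lambda>\<omega>. indicator (space M - B) \<omega> * ?Y s \<omega>)"
    using indicator_integrable int st BM BM' by simp
  finally show "expectation (\<lambda>\<omega>. indicator B \<omega> * ?Y t \<omega>) = expectation (\<lambda>\<omega>. indicator B \<omega> * ?Y s \<omega>)"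
    by simp
qed

section \<open>Local martingales\<close>

lemma adapted_diff: "adapted F T X \<Longrightarrow> adapted F T Y \<Longrightarrow> adapted F T (\<lambda>t \<omega>. X t \<omega> - Y t \<omega>)"
  unfolding adapted_def by (auto intro: borel_measurable_diff)

lemma cadlag_diff: "cadlag M T X \<Longrightarrow> cadlag M T Y \<Longrightarrow> cadlag M T (\<lambda>t \<omega>. X t \<omega> - Y t \<omega>)"
  unfolding cadlag_def by (auto intro: cadlag_path_diff)

lemma cadlag_stopped: "cadlag M T X \<Longrightarrow> cadlag M T (\<lambda>t \<omega>. X (min t (\<sigma> \<omega>)) \<omega> - c \<omega>)"
  unfolding cadlag_def by (auto intro: cadlag_path_stopped)

lemma martingale_diff:
  assumes X: "martingale M F T X" and Y: "martingale M F T Y"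
  shows "martingale M F T (\<lambda>t \<omega>. X t \<omega> - Y t \<omega>)"
  unfolding martingale_iff_integrals
proof (intro conjI ballI allI impI)
  show "adapted F T (\<lambda>t \<omega>. X t \<omega> - Y t \<omega>)"
    by (intro adapted_diff martingale_adapted X Y)
  show "integrable M (\<lambda>\<omega>. X t \<omega> - Y t \<omega>)" if "t \<in> {0..T}" for t
    by (intro Bochner_Integration.integrable_diff martingale_integrable[OF X that] martingale_integrable[OF Y that])
  fix s t B assume "0 \<le> s" "s \<le> t" "t \<le> T" and B: "B \<in> sets (F s)"
  hence st: "s \<in> {0..T}" "t \<in> {0..T}" "s \<le> t" by auto
  have "expectation (\<lambda>\<omega>. indicator B \<omega> * (X u \<omega> - Y u \<omega>))
      = expectation (\<lambda>\<omega>. indicator B \<omega> * X u \<omega>) - expectation (\<lambda>\<omega>. indicator B \<omega> * Y u \<omega>)"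
    if "u \<in> {0..T}" for u
    unfolding right_diff_distrib
    by (intro Bochner_Integration.integral_diff indicator_integrable martingale_integrable[OF X that]
        martingale_integrable[OF Y that] sets_F[OF st(1) B])
  thus "expectation (\<lambda>\<omega>. indicator B \<omega> * (X t \<omega> - Y t \<omega>)) = expectation (\<lambda>\<omega>. indicator B \<omega> * (X s \<omega> - Y s \<omega>))"
    using martingale_indicator[OF X st B] martingale_indicator[OF Y st B] st by simp
qed

lemma martingale_modification:
  assumes X: "martingale M F T X" and Y: "adapted F T Y"
    and eq: "AE \<omega> in M. \<forall>t\<in>{0..T}. Y t \<omega> = X t \<omega>"
  shows "martingale M F T Y"
  unfolding martingale_iff_integrals
proof (intro conjI ballI allI impI Y)
  have eqt: "AE \<omega> in M. Y t \<omega> = X t \<omega>" if "t \<in> {0..T}" for t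
    using eq that by auto
  show "integrable M (Y t)" if "t \<in> {0..T}" for t
    by (rule integrable_cong_AE_imp[OF martingale_integrable[OF X that]])
       (use eqt[OF that] adapted_measurable[OF Y that] in auto)
  fix s t B assume "0 \<le> s" "s \<le> t" "t \<le> T" and B: "B \<in> sets (F s)"
  hence st: "s \<in> {0..T}" "t \<in> {0..T}" "s \<le> t" by auto
  have "expectation (\<lambda>\<omega>. indicator B \<omega> * Y u \<omega>) = expectation (\<lambda>\<omega>. indicator B \<omega> * X u \<omega>)"
    if u: "u \<in> {0..T}" for u
  proof (rule integral_cong_AE)
    have [measurable]: "Y u \<in> borel_measurable M" "X u \<in> borel_measurable M" "B \<in> sets M"
      using adapted_measurable[OF Y u] martingale_integrable[OF X u] sets_F[OF st(1) B] by auto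
    show "(\<lambda>\<omega>. indicator B \<omega> * Y u \<omega>) \<in> borel_measurable M"
      "(\<lambda>\<omega>. indicator B \<omega> * X u \<omega>) \<in> borel_measurable M"
      by measurable
    show "AE \<omega> in M. indicator B \<omega> * Y u \<omega> = indicator B \<omega> * X u \<omega>"
      using eqt[OF u] by eventually_elim simp
  qed
  thus "expectation (\<lambda>\<omega>. indicator B \<omega> * Y t \<omega>) = expectation (\<lambda>\<omega>. indicator B \<omega> * Y s \<omega>)"
    using martingale_indicator[OF X st B] st by simp
qed

lemma localizing_sequenceD:
  assumes "localizing_sequence M F T \<tau>"
  shows "stopping_time F (\<tau> n)" "\<tau> n \<omega> \<in> {0..T}"
    and "AE \<omega> in M. incseq (\<lambda>n. \<tau> n \<omega>) \<and> (\<exists>n. \<tau> n \<omega> = T)"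
  using assms unfolding localizing_sequence_def by blast+

lemma localizing_sequence_min:
  assumes \<tau>: "localizing_sequence M F T \<tau>" and \<sigma>: "localizing_sequence M F T \<sigma>"
  shows "localizing_sequence M F T (\<lambda>n \<omega>. min (\<tau> n \<omega>) (\<sigma> n \<omega>))"
  unfolding localizing_sequence_def
proof (intro conjI allI)
  show "stopping_time F (\<lambda>\<omega>. min (\<tau> n \<omega>) (\<sigma> n \<omega>))" for n
    by (intro stopping_time_min localizing_sequenceD[OF \<tau>] localizing_sequenceD[OF \<sigma>])
  show "min (\<tau> n \<omega>) (\<sigma> n \<omega>) \<in> {0..T}" for n \<omega>
    using localizing_sequenceD(2)[OF \<tau>, of n \<omega>] localizing_sequenceD(2)[OF \<sigma>, of n \<omega>] by auto
  show "AE \<omega> in M. incseq (\<lambda>n. min (\<tau> n \<omega>) (\<sigma> n \<omega>)) \<and> (\<exists>n. min (\<tau> n \<omega>) (\<sigma> n \<omega>) = T)"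
    using localizing_sequenceD(3)[OF \<tau>] localizing_sequenceD(3)[OF \<sigma>]
  proof eventually_elim
    case (elim \<omega>)
    then obtain m n where mn: "\<tau> m \<omega> = T" "\<sigma> n \<omega> = T" by blast
    have inc: "incseq (\<lambda>n. \<tau> n \<omega>)" "incseq (\<lambda>n. \<sigma> n \<omega>)" using elim by auto
    have "T \<le> \<tau> (max m n) \<omega>" "T \<le> \<sigma> (max m n) \<omega>"
      using incseqD[OF inc(1), of m "max m n"] incseqD[OF inc(2), of n "max m n"] mn by auto
    hence "min (\<tau> (max m n) \<omega>) (\<sigma> (max m n) \<omega>) = T"
      using localizing_sequenceD(2)[OF \<tau>, of "max m n" \<omega>] localizing_sequenceD(2)[OF \<sigma>, of "max m n" \<omega>] by auto
    moreover have "incseq (\<lambda>n. min (\<tau> n \<omega>) (\<sigma> n \<omega>))"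
      using inc unfolding incseq_def by (meson min.mono)
    ultimately show ?case by blast
  qed
qed

lemma local_martingaleD:
  assumes "local_martingale M F T X"
  shows "adapted F T X" "cadlag M T X"
  using assms unfolding local_martingale_def by blast+

text \<open>
  Each localized martingale is stopped once more at the localizing time of the other process, which gives
  a common localizing sequence.
\<close>
lemma local_martingale_diff:
  assumes X: "local_martingale M F T X" and Y: "local_martingale M F T Y"
  shows "local_martingale M F T (\<lambda>t \<omega>. X t \<omega> - Y t \<omega>)"
proof -
  obtain \<tau> where \<tau>: "localizing_sequence M F T \<tau>"
    "\<And>n. martingale M F T (\<lambda>t \<omega>. X (min t (\<tau> n \<omega>)) \<omega> - X 0 \<omega>)"
    using X unfolding local_martingale_def by blast
  obtain \<sigma> where \<sigma>: "localizing_sequence M F T \<sigma>"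
    "\<And>n. martingale M F T (\<lambda>t \<omega>. Y (min t (\<sigma> n \<omega>)) \<omega> - Y 0 \<omega>)"
    using Y unfolding local_martingale_def by blast
  show ?thesis
    unfolding local_martingale_def
  proof (intro conjI exI allI)
    show "adapted F T (\<lambda>t \<omega>. X t \<omega> - Y t \<omega>)" "cadlag M T (\<lambda>t \<omega>. X t \<omega> - Y t \<omega>)"
      by (intro adapted_diff cadlag_diff local_martingaleD X Y)+
    show "localizing_sequence M F T (\<lambda>n \<omega>. min (\<tau> n \<omega>) (\<sigma> n \<omega>))"
      by (rule localizing_sequence_min[OF \<tau>(1) \<sigma>(1)])
    fix n
    note \<tau>n = localizing_sequenceD(1,2)[OF \<tau>(1), of n] and \<sigma>n = localizing_sequenceD(1,2)[OF \<sigma>(1), of n]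
    have "martingale M F T (\<lambda>t \<omega>. (X (min (min t (\<sigma> n \<omega>)) (\<tau> n \<omega>)) \<omega> - X 0 \<omega>)
        - (Y (min (min t (\<tau> n \<omega>)) (\<sigma> n \<omega>)) \<omega> - Y 0 \<omega>))"
      by (intro martingale_diff martingale_stopped[OF \<tau>(2) _ \<sigma>n] martingale_stopped[OF \<sigma>(2) _ \<tau>n]
          cadlag_stopped local_martingaleD X Y)
    thus "martingale M F T (\<lambda>t \<omega>. X (min t (min (\<tau> n \<omega>) (\<sigma> n \<omega>))) \<omega> - Y (min t (min (\<tau> n \<omega>) (\<sigma> n \<omega>))) \<omega>
        - (X 0 \<omega> - Y 0 \<omega>))"
      by (simp add: algebra_simps min.commute min.left_commute)
  qed
qed

text \<open>
  Subsets of null sets belong to \<open>F 0\<close>, so a discrepancy on a null set is invisible to measurability.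
\<close>
lemma adapted_modification:
  assumes X: "adapted F T X" and eq: "AE \<omega> in M. \<forall>t\<in>{0..T}. Y t \<omega> = X t \<omega>"
  shows "adapted F T Y"
  unfolding adapted_def
proof
  fix t assume t: "t \<in> {0..T}"
  obtain N where N: "N \<in> null_sets M" "\<And>\<omega>. \<omega> \<in> space M - N \<Longrightarrow> \<forall>t\<in>{0..T}. Y t \<omega> = X t \<omega>"
    using AE_E3[OF eq] by blast
  have NF: "N \<in> sets (F t)" by (rule null_in_F[OF N(1) t])
  have XF: "X t \<in> borel_measurable (F t)" using X t by (simp add: adapted_def)
  show "Y t \<in> borel_measurable (F t)"
  proof (rule measurableI)
    fix S :: "real set" assume S: "S \<in> sets borel"
    have Y: "Y t -` S \<inter> space (F t) = (X t -` S \<inter> space (F t) - N) \<union> {\<omega>\<in>N \<inter> space M. Y t \<omega> \<in> S}"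
      using N(2) t space_F[OF t] by auto
    have "{\<omega>\<in>N \<inter> space M. Y t \<omega> \<in> S} \<in> sets (F 0)"
      by (rule F_complete[OF N(1)]) auto
    hence "{\<omega>\<in>N \<inter> space M. Y t \<omega> \<in> S} \<in> sets (F t)"
      using t T_pos by (intro sets_F_mono[of 0 t]) auto
    thus "Y t -` S \<inter> space (F t) \<in> sets (F t)"
      unfolding Y by (intro sets.Un sets.Diff measurable_sets[OF XF S] NF)
  qed simp
qed

lemma local_martingale_modification:
  assumes X: "local_martingale M F T X" and Y: "cadlag M T Y"
    and eq: "AE \<omega> in M. \<forall>t\<in>{0..T}. Y t \<omega> = X t \<omega>"
  shows "local_martingale M F T Y"
proof -
  obtain \<tau> where \<tau>: "localizing_sequence M F T \<tau>"
    "\<And>n. martingale M F T (\<lambda>t \<omega>. X (min t (\<tau> n \<omega>)) \<omega> - X 0 \<omega>)"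
    using X unfolding local_martingale_def by blast
  show ?thesis
    unfolding local_martingale_def
  proof (intro conjI exI allI)
    show "adapted F T Y" by (rule adapted_modification[OF local_martingaleD(1)[OF X] eq])
    show "cadlag M T Y" by fact
    show "localizing_sequence M F T \<tau>" by fact
    fix n
    have eq': "AE \<omega> in M. \<forall>t\<in>{0..T}. Y (min t (\<tau> n \<omega>)) \<omega> - Y 0 \<omega> = X (min t (\<tau> n \<omega>)) \<omega> - X 0 \<omega>"
      using eq
    proof eventually_elim
      case (elim \<omega>)
      have "min t (\<tau> n \<omega>) \<in> {0..T}" if "t \<in> {0..T}" for t
        using localizing_sequenceD(2)[OF \<tau>(1), of n \<omega>] that by auto
      thus ?case using elim T_pos by simp
    qed
    show "martingale M F T (\<lambda>t \<omega>. Y (min t (\<tau> n \<omega>)) \<omega> - Y 0 \<omega>)"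
      by (rule martingale_modification[OF \<tau>(2) adapted_modification[OF martingale_adapted[OF \<tau>(2)] eq'] eq'])
  qed
qed

end

section \<open>Hitting times of continuous processes\<close>

text \<open>
  The value is \<open>T\<close> also for a path that never reaches the level.
\<close>
definition hit_time :: "real \<Rightarrow> real \<Rightarrow> (real \<Rightarrow> real) \<Rightarrow> real" where
  "hit_time T c y = (if \<exists>t\<in>{0..T}. y t \<le> c then Inf {t\<in>{0..T}. y t \<le> c} else T)"

lemma hit_time_range:
  assumes "0 \<le> T" shows "hit_time T c y \<in> {0..T}"
proof (cases "\<exists>t\<in>{0..T}. y t \<le> c")
  case True
  then obtain t where t: "t \<in> {0..T}" "y t \<le> c" by blast
  have bdd: "bdd_below {t\<in>{0..T}. y t \<le> c}" by (rule bdd_belowI[of _ 0]) auto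
  have "Inf {t\<in>{0..T}. y t \<le> c} \<le> t" by (rule cInf_lower[OF _ bdd]) (use t in simp)
  moreover have "0 \<le> Inf {t\<in>{0..T}. y t \<le> c}" by (rule cInf_greatest) (use t in auto)
  ultimately show ?thesis using True t by (auto simp: hit_time_def)
next
  case False
  thus ?thesis using assms by (simp add: hit_time_def)
qed

lemma hit_time_le:
  assumes "t \<in> {0..T}" "y t \<le> c" shows "hit_time T c y \<le> t"
proof -
  have bdd: "bdd_below {t\<in>{0..T}. y t \<le> c}" by (rule bdd_belowI[of _ 0]) auto
  show ?thesis
    using assms cInf_lower[OF _ bdd, of t] by (auto simp: hit_time_def)
qed

lemma hit_time_attained:
  assumes y: "continuous_on {0..T} y" and t: "t \<in> {0..T}" "y t \<le> c"
  shows "y (hit_time T c y) \<le> c"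
proof -
  let ?S = "{t\<in>{0..T}. y t \<le> c}"
  have "closed ?S"
    using continuous_closed_preimage[OF y, of "{..c}"] by (simp add: vimage_def Int_def)
  moreover have "bdd_below ?S" by (rule bdd_belowI[of _ 0]) auto
  ultimately have "Inf ?S \<in> ?S" using t by (intro closed_contains_Inf) auto
  thus ?thesis using t by (auto simp: hit_time_def)
qed

text \<open>
  By compactness the infimum is attained, so reaching the level is the same as approaching it along
  rational times, a countable condition.
\<close>
lemma exists_le_iff_rational:
  fixes y :: "real \<Rightarrow> real"
  assumes y: "continuous_on {0..t} y" and t: "0 \<le> t"
  shows "(\<exists>s\<in>{0..t}. y s \<le> c) \<longleftrightarrow> (\<forall>k. \<exists>q\<in>\<rat> \<inter> {0..t}. y q < c + 1 / real (Suc k))"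
proof
  assume "\<exists>s\<in>{0..t}. y s \<le> c"
  then obtain s where s: "s \<in> {0..t}" "y s \<le> c" by blast
  show "\<forall>k. \<exists>q\<in>\<rat> \<inter> {0..t}. y q < c + 1 / real (Suc k)"
  proof
    fix k
    have "0 < 1 / real (Suc k)" by simp
    then obtain d where d: "d > 0" "\<And>q. q \<in> {0..t} \<Longrightarrow> dist q s < d \<Longrightarrow> dist (y q) (y s) < 1 / real (Suc k)"
      using y s(1) unfolding continuous_on_iff by blast
    have "\<exists>q\<in>\<rat> \<inter> {0..t}. dist q s < d"
    proof (cases "t = 0")
      case True
      thus ?thesis using s d by (intro bexI[of _ 0]) auto
    next
      case False
      hence "max 0 (s - d) < min t (s + d)" using s d t by auto
      then obtain q where "q \<in> \<rat>" "max 0 (s - d) < q" "q < min t (s + d)"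
        using Rats_dense_in_real by blast
      thus ?thesis by (intro bexI[of _ q]) (auto simp: dist_real_def)
    qed
    then obtain q where q: "q \<in> \<rat> \<inter> {0..t}" "dist q s < d" by blast
    hence "dist (y q) (y s) < 1 / real (Suc k)" using d by blast
    hence "y q < c + 1 / real (Suc k)" using s by (auto simp: dist_real_def)
    thus "\<exists>q\<in>\<rat> \<inter> {0..t}. y q < c + 1 / real (Suc k)" using q by blast
  qed
next
  assume q: "\<forall>k. \<exists>q\<in>\<rat> \<inter> {0..t}. y q < c + 1 / real (Suc k)"
  obtain s where s: "s \<in> {0..t}" "\<And>q. q \<in> {0..t} \<Longrightarrow> y s \<le> y q"
    using continuous_attains_inf[OF compact_Icc _ y] t by auto
  have "y s \<le> c"
  proof (rule field_le_epsilon)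
    fix e :: real assume "e > 0"
    then obtain k where k: "1 / real (Suc k) < e" using nat_approx_posE by blast
    obtain q where "q \<in> {0..t}" "y q < c + 1 / real (Suc k)" using q by blast
    thus "y s \<le> c + e" using s(2)[of q] k by linarith
  qed
  thus "\<exists>s\<in>{0..t}. y s \<le> c" using s by blast
qed

lemma continuous_cadlag_path:
  assumes "continuous_on {0..T} x"
  shows "cadlag_path T x"
proof -
  have "(x \<longlongrightarrow> x t) (at_right t)" if "t \<in> {0..<T}" for t
  proof -
    have "(x \<longlongrightarrow> x t) (at t within {t..T})"
      using assms that continuous_on_subset[OF assms, of "{t..T}"] by (auto simp: continuous_on_def)
    thus ?thesis using that by (simp add: at_within_Icc_at_right)
  qed
  moreover have "(x \<longlongrightarrow> x t) (at_left t)" if "t \<in> {0<..T}" for t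
  proof -
    have "(x \<longlongrightarrow> x t) (at t within {0..t})"
      using that continuous_on_subset[OF assms, of "{0..t}"] by (auto simp: continuous_on_def)
    thus ?thesis using that by (simp add: at_within_Icc_at_left)
  qed
  ultimately show ?thesis unfolding cadlag_path_def by blast
qed

context usual_filtered_prob_space
begin

definition continuous_process :: "(real \<Rightarrow> 'a \<Rightarrow> real) \<Rightarrow> bool" where
  "continuous_process Y \<longleftrightarrow> adapted F T Y \<and> (\<forall>\<omega>\<in>space M. continuous_on {0..T} (\<lambda>t. Y t \<omega>))"

lemma continuous_process_cadlag: "continuous_process Y \<Longrightarrow> cadlag M T Y"
  by (simp add: continuous_process_def cadlag_def continuous_cadlag_path)

lemma exists_le_sets:
  assumes Y: "continuous_process Y" and t: "t \<in> {0..T}"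
  shows "{\<omega>\<in>space M. \<exists>s\<in>{0..t}. Y s \<omega> \<le> c} \<in> sets (F t)"
proof -
  have cont: "continuous_on {0..t} (\<lambda>s. Y s \<omega>)" if "\<omega> \<in> space M" for \<omega>
    using Y that t by (auto simp: continuous_process_def intro: continuous_on_subset)
  have "{\<omega>\<in>space M. \<exists>s\<in>{0..t}. Y s \<omega> \<le> c}
      = (\<Inter>k. \<Union>q\<in>\<rat> \<inter> {0..t}. {\<omega>\<in>space M. Y q \<omega> < c + 1 / real (Suc k)})"
    (is "?L = ?R")
  proof (rule set_eqI)
    fix \<omega>
    show "\<omega> \<in> ?L \<longleftrightarrow> \<omega> \<in> ?R"
    proof (cases "\<omega> \<in> space M")
      case True
      have "(\<exists>s\<in>{0..t}. Y s \<omega> \<le> c) \<longleftrightarrow> (\<forall>k. \<exists>q\<in>\<rat> \<inter> {0..t}. Y q \<omega> < c + 1 / real (Suc k))"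
        using exists_le_iff_rational[OF cont[OF True]] t by simp
      thus ?thesis using True by blast
    qed auto
  qed
  also have "\<dots> \<in> sets (F t)"
  proof (rule sets.countable_INT, safe, rule sets.countable_UN'')
    show "countable (\<rat> \<inter> {0..t})" by (rule countable_subset[OF _ countable_rat]) auto
    fix k q assume q: "q \<in> \<rat> \<inter> {0..t}"
    have [measurable]: "Y q \<in> borel_measurable (F t)"
      using adapted_mono_measurable[of Y q t] q t Y by (auto simp: continuous_process_def)
    have "{\<omega>\<in>space (F t). Y q \<omega> < c + 1 / real (Suc k)} \<in> sets (F t)" by measurable
    thus "{\<omega>\<in>space M. Y q \<omega> < c + 1 / real (Suc k)} \<in> sets (F t)" using space_F[OF t] by simp
  qed
  finally show ?thesis .
qed

lemma hit_time_stopping: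
  assumes Y: "continuous_process Y"
  shows "stopping_time F (\<lambda>\<omega>. hit_time T c (\<lambda>t. Y t \<omega>))"
proof (subst stopping_time_iff)
  show "hit_time T c (\<lambda>t. Y t \<omega>) \<in> {0..T}" for \<omega> using hit_time_range T_pos by simp
  show "\<forall>t\<in>{0..<T}. {\<omega> \<in> space M. hit_time T c (\<lambda>t. Y t \<omega>) \<le> t} \<in> sets (F t)"
  proof
    fix t assume t: "t \<in> {0..<T}"
    have "hit_time T c (\<lambda>t. Y t \<omega>) \<le> t \<longleftrightarrow> (\<exists>s\<in>{0..t}. Y s \<omega> \<le> c)" if \<omega>: "\<omega> \<in> space M" for \<omega>
    proof
      assume le: "hit_time T c (\<lambda>t. Y t \<omega>) \<le> t"
      have "\<exists>s\<in>{0..T}. Y s \<omega> \<le> c"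
        using le t by (rule_tac ccontr) (simp add: hit_time_def)
      hence "Y (hit_time T c (\<lambda>t. Y t \<omega>)) \<omega> \<le> c"
        using hit_time_attained[of T "\<lambda>t. Y t \<omega>"] Y \<omega> by (auto simp: continuous_process_def)
      moreover have "hit_time T c (\<lambda>t. Y t \<omega>) \<in> {0..t}"
        using le hit_time_range[of T c "\<lambda>t. Y t \<omega>"] T_pos by simp
      ultimately show "\<exists>s\<in>{0..t}. Y s \<omega> \<le> c" by blast
    next
      assume "\<exists>s\<in>{0..t}. Y s \<omega> \<le> c"
      then obtain s where s: "s \<in> {0..t}" "Y s \<omega> \<le> c" by blast
      thus "hit_time T c (\<lambda>t. Y t \<omega>) \<le> t"
        using hit_time_le[of s T "\<lambda>t. Y t \<omega>" c] t by auto
    qed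
    hence "{\<omega> \<in> space M. hit_time T c (\<lambda>t. Y t \<omega>) \<le> t} = {\<omega> \<in> space M. \<exists>s\<in>{0..t}. Y s \<omega> \<le> c}"
      by blast
    thus "{\<omega> \<in> space M. hit_time T c (\<lambda>t. Y t \<omega>) \<le> t} \<in> sets (F t)"
      using exists_le_sets[OF Y, of t c] t by simp
  qed
qed

section \<open>Inner approximation of predictable sets by zero sets\<close>

lemma sets_predictable_algebra:
  "sets (predictable_algebra M F T) = sigma_sets (space M \<times> {0..T})
     ({B \<times> {0} | B. B \<in> sets (F 0)} \<union>
      {B \<times> {s<..t} | B s t. 0 \<le> s \<and> s < t \<and> t \<le> T \<and> B \<in> sets (F s)})"
  and space_predictable_algebra: "space (predictable_algebra M F T) = space M \<times> {0..T}"
proof -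
  have "{B \<times> {0} | B. B \<in> sets (F 0)} \<union>
      {B \<times> {s<..t} | B s t. 0 \<le> s \<and> s < t \<and> t \<le> T \<and> B \<in> sets (F s)} \<subseteq> Pow (space M \<times> {0..T})"
  proof safe
    fix B a assume "B \<in> sets (F 0)" "a \<in> B"
    thus "a \<in> space M" using sets.sets_into_space[of B "F 0"] space_F[of 0] T_pos by auto
  next
    fix B s t a assume "0 \<le> s" "s < t" "t \<le> T" "B \<in> sets (F s)" "a \<in> B"
    thus "a \<in> space M" using sets.sets_into_space[of B "F s"] space_F[of s] by auto
  qed (use T_pos in auto)
  thus "sets (predictable_algebra M F T) = sigma_sets (space M \<times> {0..T})
     ({B \<times> {0} | B. B \<in> sets (F 0)} \<union>
      {B \<times> {s<..t} | B s t. 0 \<le> s \<and> s < t \<and> t \<le> T \<and> B \<in> sets (F s)})"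
   and "space (predictable_algebra M F T) = space M \<times> {0..T}"
    by (simp_all add: predictable_algebra_def)
qed

text \<open>
  Zero sets of continuous adapted processes take the part of the compact sets in the inner regularity of
  Borel measures, and their first points are announced by hitting times of positive levels. The measure
  is the image of the probability under \<open>\<omega> \<mapsto> (\<omega>, \<sigma> \<omega>)\<close>; the bounds on \<open>Y\<close> make weighted series of
  such processes converge.
\<close>
definition approximates :: "('a \<Rightarrow> real) \<Rightarrow> ('a \<times> real) set \<Rightarrow> real \<Rightarrow> (real \<Rightarrow> 'a \<Rightarrow> real) \<Rightarrow> bool" where
  "approximates \<sigma> E \<eta> Y \<longleftrightarrow> continuous_process Y \<and> (\<forall>t \<omega>. 0 \<le> Y t \<omega> \<and> Y t \<omega> \<le> 1) \<and>
     (\<forall>\<omega>\<in>space M. \<forall>t\<in>{0..T}. Y t \<omega> = 0 \<longrightarrow> (\<omega>, t) \<in> E) \<and>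
     prob {\<omega>\<in>space M. (\<omega>, \<sigma> \<omega>) \<in> E \<and> Y (\<sigma> \<omega>) \<omega> \<noteq> 0} \<le> \<eta>"

definition inner_approx :: "('a \<Rightarrow> real) \<Rightarrow> ('a \<times> real) set \<Rightarrow> bool" where
  "inner_approx \<sigma> E \<longleftrightarrow> (\<forall>\<eta>>0. \<exists>Y. approximates \<sigma> E \<eta> Y)"

lemma approximatesD:
  assumes "approximates \<sigma> E \<eta> Y"
  shows "continuous_process Y" "0 \<le> Y t \<omega>" "Y t \<omega> \<le> 1"
    "\<omega> \<in> space M \<Longrightarrow> t \<in> {0..T} \<Longrightarrow> Y t \<omega> = 0 \<Longrightarrow> (\<omega>, t) \<in> E"
    "prob {\<omega>\<in>space M. (\<omega>, \<sigma> \<omega>) \<in> E \<and> Y (\<sigma> \<omega>) \<omega> \<noteq> 0} \<le> \<eta>"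
  using assms unfolding approximates_def by blast+

lemma approximatesI:
  assumes "continuous_process Y" "\<And>t \<omega>. 0 \<le> Y t \<omega>" "\<And>t \<omega>. Y t \<omega> \<le> 1"
    "\<And>\<omega> t. \<omega> \<in> space M \<Longrightarrow> t \<in> {0..T} \<Longrightarrow> Y t \<omega> = 0 \<Longrightarrow> (\<omega>, t) \<in> E"
    "prob {\<omega>\<in>space M. (\<omega>, \<sigma> \<omega>) \<in> E \<and> Y (\<sigma> \<omega>) \<omega> \<noteq> 0} \<le> \<eta>"
  shows "approximates \<sigma> E \<eta> Y"
  using assms unfolding approximates_def by blast

lemma graph_measurable:
  assumes \<sigma>: "\<sigma> \<in> borel_measurable M" "\<And>\<omega>. \<sigma> \<omega> \<in> {0..T}" and E: "E \<in> sets (predictable_algebra M F T)"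
  shows "{\<omega>\<in>space M. (\<omega>, \<sigma> \<omega>) \<in> E} \<in> sets M"
proof -
  have "(\<lambda>\<omega>. (\<omega>, \<sigma> \<omega>)) \<in> M \<rightarrow>\<^sub>M predictable_algebra M F T"
  proof (rule measurable_sigma_sets[OF sets_predictable_algebra])
    show "{B \<times> {0} | B. B \<in> sets (F 0)} \<union>
      {B \<times> {s<..t} | B s t. 0 \<le> s \<and> s < t \<and> t \<le> T \<and> B \<in> sets (F s)} \<subseteq> Pow (space M \<times> {0..T})"
      using sets.space_closed[of "predictable_algebra M F T"]
      unfolding sets_predictable_algebra space_predictable_algebra
      by (rule subset_trans[OF sigma_sets_superset_generator])
    show "(\<lambda>\<omega>. (\<omega>, \<sigma> \<omega>)) \<in> space M \<rightarrow> space M \<times> {0..T}" using \<sigma>(2) by blast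
    fix A assume "A \<in> {B \<times> {0} | B. B \<in> sets (F 0)} \<union>
      {B \<times> {s<..t} | B s t. 0 \<le> s \<and> s < t \<and> t \<le> T \<and> B \<in> sets (F s)}"
    then consider (zero) B where "B \<in> sets (F 0)" "A = B \<times> {0}"
      | (interval) B s t where "0 \<le> s" "s < t" "t \<le> T" "B \<in> sets (F s)" "A = B \<times> {s<..t}"
      by blast
    then obtain B s I where B: "s \<in> {0..T}" "B \<in> sets (F s)" "A = B \<times> I" and I: "I \<in> sets borel"
    proof cases
      case zero
      show ?thesis by (rule that[of 0 B "{0}"]) (use zero T_pos in auto)
    next
      case interval
      show ?thesis by (rule that[of s B "{s<..t}"]) (use interval in auto)
    qed
    have "(\<lambda>\<omega>. (\<omega>, \<sigma> \<omega>)) -` A \<inter> space M = B \<inter> (\<sigma> -` I \<inter> space M)"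
      using B by auto
    thus "(\<lambda>\<omega>. (\<omega>, \<sigma> \<omega>)) -` A \<inter> space M \<in> sets M"
      using sets_F[OF B(1,2)] measurable_sets[OF \<sigma>(1) I] by simp
  qed
  hence "(\<lambda>\<omega>. (\<omega>, \<sigma> \<omega>)) -` E \<inter> space M \<in> sets M" using E by (rule measurable_sets)
  moreover have "(\<lambda>\<omega>. (\<omega>, \<sigma> \<omega>)) -` E \<inter> space M = {\<omega>\<in>space M. (\<omega>, \<sigma> \<omega>) \<in> E}" by auto
  ultimately show ?thesis by simp
qed

lemma continuous_process_at_random_time:
  assumes Y: "continuous_process Y" and \<sigma>: "\<sigma> \<in> borel_measurable M" "\<And>\<omega>. \<sigma> \<omega> \<in> {0..T}"
  shows "(\<lambda>\<omega>. Y (\<sigma> \<omega>) \<omega>) \<in> borel_measurable M"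
proof (rule measurable_at_random_time[where t=T and X=Y, OF _ _ order_refl \<sigma>])
  show "Y s \<in> borel_measurable M" if "s \<in> {0..T}" for s
    using Y that adapted_measurable by (auto simp: continuous_process_def)
  show "cadlag_path T (\<lambda>t. Y t \<omega>)" if "\<omega> \<in> space M" for \<omega>
    using continuous_process_cadlag[OF Y] that by (simp add: cadlag_def)
qed

lemma loss_measurable:
  assumes \<sigma>: "\<sigma> \<in> borel_measurable M" "\<And>\<omega>. \<sigma> \<omega> \<in> {0..T}" and E: "E \<in> sets (predictable_algebra M F T)"
    and Y: "continuous_process Y"
  shows "{\<omega>\<in>space M. (\<omega>, \<sigma> \<omega>) \<in> E \<and> Y (\<sigma> \<omega>) \<omega> \<noteq> 0} \<in> sets M"
proof -
  have [measurable]: "(\<lambda>\<omega>. Y (\<sigma> \<omega>) \<omega>) \<in> borel_measurable M"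
    by (rule continuous_process_at_random_time[OF Y \<sigma>])
  have "{\<omega>\<in>space M. (\<omega>, \<sigma> \<omega>) \<in> E} \<inter> {\<omega>\<in>space M. Y (\<sigma> \<omega>) \<omega> \<noteq> 0} \<in> sets M"
    by (intro sets.Int graph_measurable[OF \<sigma> E]) measurable
  thus ?thesis by (simp add: Int_def conj_ac)
qed

text \<open>
  Continuity from above, as the interval shrinks to the empty set.
\<close>
lemma prob_tail_small:
  fixes \<sigma> :: "'a \<Rightarrow> real"
  assumes \<sigma>: "\<sigma> \<in> borel_measurable M" and "s < t" "\<eta> > 0"
  obtains s' where "s < s'" "s' < t" "prob {\<omega>\<in>space M. s < \<sigma> \<omega> \<and> \<sigma> \<omega> < s'} < \<eta>"
proof -
  note \<sigma>[measurable]
  define A where "A n = {\<omega>\<in>space M. s < \<sigma> \<omega> \<and> \<sigma> \<omega> < s + (t - s) / real (n + 2)}" for n :: nat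
  have "(\<lambda>n. prob (A n)) \<longlonglongrightarrow> prob (\<Inter>n. A n)"
  proof (rule finite_Lim_measure_decseq)
    show "range A \<subseteq> sets M" unfolding A_def by auto
    show "decseq A"
    proof (rule decseq_SucI)
      fix n
      have "(t - s) / real (Suc n + 2) \<le> (t - s) / real (n + 2)"
        using \<open>s < t\<close> by (intro divide_left_mono) auto
      thus "A (Suc n) \<subseteq> A n" unfolding A_def by auto
    qed
  qed
  moreover have "(\<Inter>n. A n) = {}"
  proof -
    have False if "\<omega> \<in> (\<Inter>n. A n)" for \<omega>
    proof -
      have *: "0 < \<sigma> \<omega> - s" "\<And>n::nat. \<sigma> \<omega> - s < (t - s) / real (n + 2)"
        using that by (auto simp: A_def algebra_simps)
      obtain n :: nat where n: "(t - s) / (\<sigma> \<omega> - s) < real n" using reals_Archimedean2 by blast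
      hence "t - s < real n * (\<sigma> \<omega> - s)" using *(1) by (simp add: pos_divide_less_eq)
      also have "\<dots> \<le> real (n + 2) * (\<sigma> \<omega> - s)" using *(1) by (intro mult_right_mono) auto
      also have "\<dots> < t - s" using *(2)[of n] by (subst (asm) pos_less_divide_eq) (auto simp: mult.commute)
      finally show False .
    qed
    thus ?thesis by blast
  qed
  ultimately have "\<forall>\<^sub>F n in sequentially. prob (A n) < \<eta>"
    using \<open>\<eta> > 0\<close> by (intro order_tendstoD) auto
  then obtain n where n: "prob (A n) < \<eta>" by (auto simp: eventually_sequentially)
  have "(t - s) / real (n + 2) < (t - s) / 1"
    using \<open>s < t\<close> by (intro divide_strict_left_mono) auto
  hence "s + (t - s) / real (n + 2) < t" unfolding div_by_1 by (simp only: less_diff_eq add.commute)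
  moreover have "s < s + (t - s) / real (n + 2)" using \<open>s < t\<close> by simp
  ultimately show ?thesis
    using n unfolding A_def by (intro that[of "s + (t - s) / real (n + 2)"])
qed

lemma sum_geometric_half: "summable (\<lambda>n. \<eta> * (1/2)^(n+2) :: real)" "(\<Sum>n. \<eta> * (1/2)^(n+2) :: real) = \<eta> / 2"
proof -
  have "(\<lambda>n. \<eta> * (1/4) * (1/2)^n) sums (\<eta> * (1/4) * (1 / (1 - 1/2)))"
    by (intro sums_mult geometric_sums) auto
  hence "(\<lambda>n. \<eta> * (1/2)^(n+2)) sums (\<eta> / 2)" by (simp add: power_add mult_ac)
  thus "summable (\<lambda>n. \<eta> * (1/2)^(n+2) :: real)" "(\<Sum>n. \<eta> * (1/2)^(n+2) :: real) = \<eta> / 2"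
    by (auto simp: sums_iff)
qed

lemma prob_UN_le_geometric:
  assumes "\<And>n::nat. A n \<in> sets M" "\<And>n. prob (A n) \<le> \<eta> * (1/2)^(n+2)"
  shows "prob (\<Union>n. A n) \<le> \<eta> / 2"
proof -
  have s: "summable (\<lambda>n. prob (A n))"
    by (rule summable_comparison_test'[OF sum_geometric_half(1)[of \<eta>], of 0]) (use assms in simp)
  have "prob (\<Union>n. A n) \<le> (\<Sum>n. prob (A n))"
    using assms s by (intro finite_measure_subadditive_countably) auto
  also have "\<dots> \<le> (\<Sum>n. \<eta> * (1/2)^(n+2))"
    by (rule suminf_le[OF assms(2) s sum_geometric_half(1)])
  finally show ?thesis by (simp only: sum_geometric_half)
qed

lemma inner_approx_sequence:
  assumes "\<And>n::nat. inner_approx \<sigma> (E n)" and \<eta>: "\<eta> > 0"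
  shows "\<exists>Y. \<forall>n. approximates \<sigma> (E n) (\<eta> * (1/2)^(n+2)) (Y n)"
proof (intro choice allI)
  fix n
  have "0 < \<eta> * (1/2)^(n+2)" using \<eta> by simp
  thus "\<exists>Y. approximates \<sigma> (E n) (\<eta> * (1/2)^(n+2)) Y"
    using assms(1)[of n] unfolding inner_approx_def by blast
qed

text \<open>
  A convergent series of nonnegative continuous processes with positive weights vanishes exactly where all
  of them vanish.
\<close>
lemma inner_approx_Inter:
  assumes \<sigma>: "\<sigma> \<in> borel_measurable M" "\<And>\<omega>. \<sigma> \<omega> \<in> {0..T}"
    and E: "\<And>n::nat. E n \<in> sets (predictable_algebra M F T)" "\<And>n. inner_approx \<sigma> (E n)"
  shows "inner_approx \<sigma> (\<Inter>n. E n)"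
  unfolding inner_approx_def
proof (intro allI impI)
  fix \<eta> :: real assume \<eta>: "\<eta> > 0"
  obtain Y where Y': "\<forall>n. approximates \<sigma> (E n) (\<eta> * (1/2)^(n+2)) (Y n)"
    using inner_approx_sequence[where E=E, OF E(2) \<eta>] by blast
  note Y = approximatesD[OF Y'[rule_format]]
  define Z where "Z t \<omega> = (\<Sum>n. (1/2)^Suc n * Y n t \<omega>)" for t \<omega>
  have half: "(\<lambda>n. (1/2::real)^Suc n) sums 1" by (rule power_half_series)
  have bound: "norm ((1/2)^Suc n * Y n t \<omega>) \<le> (1/2)^Suc n" for n t \<omega>
    using Y(2,3)[of n t \<omega>] by (simp add: mult_left_le)
  have summable: "summable (\<lambda>n. (1/2)^Suc n * Y n t \<omega>)" for t \<omega>
    by (rule summable_comparison_test'[OF sums_summable[OF half], of 0]) (rule bound)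
  have terms_nonneg: "0 \<le> (1/2)^Suc n * Y n t \<omega>" for n t \<omega> using Y(2) by simp
  have Z0: "0 \<le> Z t \<omega>" for t \<omega>
    unfolding Z_def by (rule suminf_nonneg[OF summable]) (rule terms_nonneg)
  have Z1: "Z t \<omega> \<le> 1" for t \<omega>
  proof -
    have "Z t \<omega> \<le> (\<Sum>n. (1/2::real)^Suc n)"
      unfolding Z_def by (intro suminf_le summable sums_summable[OF half] mult_left_le Y(3)) simp
    thus ?thesis using sums_unique[OF half] by linarith
  qed
  have Z_zero: "Z t \<omega> = 0 \<longleftrightarrow> (\<forall>n. Y n t \<omega> = 0)" for t \<omega>
    unfolding Z_def by (subst suminf_eq_zero_iff[OF summable]) (use terms_nonneg in auto)
  have Z: "continuous_process Z"
    unfolding continuous_process_def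
  proof (intro conjI ballI)
    show "adapted F T Z"
      unfolding adapted_def
    proof
      fix t assume "t \<in> {0..T}"
      hence [measurable]: "Y n t \<in> borel_measurable (F t)" for n
        using Y(1)[of n] by (simp add: continuous_process_def adapted_def)
      show "Z t \<in> borel_measurable (F t)"
        unfolding Z_def by (intro borel_measurable_suminf) measurable
    qed
    fix \<omega> assume \<omega>: "\<omega> \<in> space M"
    have "uniform_limit {0..T} (\<lambda>n t. \<Sum>i<n. (1/2)^Suc i * Y i t \<omega>) (\<lambda>t. Z t \<omega>) sequentially"
      unfolding Z_def by (rule Weierstrass_m_test[OF bound sums_summable[OF half]])
    moreover have "continuous_on {0..T} (\<lambda>t. \<Sum>i<n. (1/2)^Suc i * Y i t \<omega>)" for n
      using Y(1) \<omega> by (intro continuous_intros) (auto simp: continuous_process_def)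
    ultimately show "continuous_on {0..T} (\<lambda>t. Z t \<omega>)"
      by (intro uniform_limit_theorem[where F=sequentially]) auto
  qed
  let ?L = "\<lambda>n. {\<omega>\<in>space M. (\<omega>, \<sigma> \<omega>) \<in> E n \<and> Y n (\<sigma> \<omega>) \<omega> \<noteq> 0}"
  have L: "?L n \<in> sets M" for n
    by (rule loss_measurable[OF \<sigma> E(1) Y(1)])
  have "prob {\<omega>\<in>space M. (\<omega>, \<sigma> \<omega>) \<in> (\<Inter>n. E n) \<and> Z (\<sigma> \<omega>) \<omega> \<noteq> 0} \<le> prob (\<Union>n. ?L n)"
    using L by (intro finite_measure_mono) (auto simp: Z_zero)
  also have "\<dots> \<le> \<eta> / 2" by (rule prob_UN_le_geometric[OF L Y(5)])
  also have "\<dots> < \<eta>" using \<eta> by simp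
  finally have "prob {\<omega>\<in>space M. (\<omega>, \<sigma> \<omega>) \<in> (\<Inter>n. E n) \<and> Z (\<sigma> \<omega>) \<omega> \<noteq> 0} \<le> \<eta>" by simp
  moreover have "(\<omega>, t) \<in> (\<Inter>n. E n)" if "\<omega> \<in> space M" "t \<in> {0..T}" "Z t \<omega> = 0" for \<omega> t
    using Y(4)[OF that(1,2)] that(3) Z_zero by blast
  ultimately have "approximates \<sigma> (\<Inter>n. E n) \<eta> Z"
    by (intro approximatesI Z Z0 Z1)
  thus "\<exists>Y. approximates \<sigma> (\<Inter>n. E n) \<eta> Y" by blast
qed

text \<open>
  A finite product of processes vanishes exactly on the union of the zero sets; finitely many of the sets
  already carry almost all mass.
\<close>
lemma inner_approx_Union:
  assumes \<sigma>: "\<sigma> \<in> borel_measurable M" "\<And>\<omega>. \<sigma> \<omega> \<in> {0..T}"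
    and E: "\<And>n::nat. E n \<in> sets (predictable_algebra M F T)" "\<And>n. inner_approx \<sigma> (E n)"
  shows "inner_approx \<sigma> (\<Union>n. E n)"
  unfolding inner_approx_def
proof (intro allI impI)
  fix \<eta> :: real assume \<eta>: "\<eta> > 0"
  obtain Y where Y': "\<forall>n. approximates \<sigma> (E n) (\<eta> * (1/2)^(n+2)) (Y n)"
    using inner_approx_sequence[where E=E, OF E(2) \<eta>] by blast
  note Y = approximatesD[OF Y'[rule_format]]
  let ?L = "\<lambda>n. {\<omega>\<in>space M. (\<omega>, \<sigma> \<omega>) \<in> E n \<and> Y n (\<sigma> \<omega>) \<omega> \<noteq> 0}"
  have L: "?L n \<in> sets M" for n
    by (rule loss_measurable[OF \<sigma> E(1) Y(1)])
  define A where "A N = {\<omega>\<in>space M. (\<omega>, \<sigma> \<omega>) \<in> (\<Union>n. E n)} - {\<omega>\<in>space M. (\<omega>, \<sigma> \<omega>) \<in> (\<Union>n<N. E n)}" for N :: nat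
  have A: "A N \<in> sets M" for N
    unfolding A_def using E(1) by (intro sets.Diff graph_measurable[OF \<sigma>] sets.countable_UN sets.finite_UN) auto
  have "(\<lambda>N. prob (A N)) \<longlonglongrightarrow> prob (\<Inter>N. A N)"
  proof (rule finite_Lim_measure_decseq)
    show "range A \<subseteq> sets M" using A by auto
    show "decseq A" by (rule decseq_SucI) (auto simp: A_def lessThan_Suc)
  qed
  moreover have "(\<Inter>N. A N) = {}"
    by (auto simp: A_def)
  ultimately have "\<forall>\<^sub>F N in sequentially. prob (A N) < \<eta> / 2"
    using \<eta> by (intro order_tendstoD) auto
  then obtain N where N: "prob (A N) < \<eta> / 2" by (auto simp: eventually_sequentially)
  define Z where "Z t \<omega> = (\<Prod>n<N. Y n t \<omega>)" for t \<omega>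
  have Z0: "0 \<le> Z t \<omega>" and Z1: "Z t \<omega> \<le> 1" for t \<omega>
    unfolding Z_def using Y(2,3) by (auto intro!: prod_nonneg prod_le_1)
  have Z: "continuous_process Z"
    unfolding continuous_process_def adapted_def Z_def
    using Y(1) by (auto simp: continuous_process_def adapted_def intro!: borel_measurable_prod continuous_on_prod)
  have "prob {\<omega>\<in>space M. (\<omega>, \<sigma> \<omega>) \<in> (\<Union>n. E n) \<and> Z (\<sigma> \<omega>) \<omega> \<noteq> 0} \<le> prob (A N \<union> (\<Union>n. ?L n))"
  proof (rule finite_measure_mono)
    show "A N \<union> (\<Union>n. ?L n) \<in> sets M" using A L by auto
    show "{\<omega>\<in>space M. (\<omega>, \<sigma> \<omega>) \<in> (\<Union>n. E n) \<and> Z (\<sigma> \<omega>) \<omega> \<noteq> 0} \<subseteq> A N \<union> (\<Union>n. ?L n)"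
      by (auto simp: A_def Z_def)
  qed
  also have "\<dots> \<le> prob (A N) + prob (\<Union>n. ?L n)"
    using A L by (intro measure_Un_le) auto
  also have "\<dots> < \<eta>" using N prob_UN_le_geometric[OF L Y(5)] by simp
  finally have "prob {\<omega>\<in>space M. (\<omega>, \<sigma> \<omega>) \<in> (\<Union>n. E n) \<and> Z (\<sigma> \<omega>) \<omega> \<noteq> 0} \<le> \<eta>" by simp
  moreover have "(\<omega>, t) \<in> (\<Union>n. E n)" if "\<omega> \<in> space M" "t \<in> {0..T}" "Z t \<omega> = 0" for \<omega> t
    using Y(4)[OF that(1,2)] that(3) by (auto simp: Z_def)
  ultimately have "approximates \<sigma> (\<Union>n. E n) \<eta> Z"
    by (intro approximatesI Z Z0 Z1)
  thus "\<exists>Y. approximates \<sigma> (\<Union>n. E n) \<eta> Y" by blast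
qed

lemma inner_approx_Un:
  assumes \<sigma>: "\<sigma> \<in> borel_measurable M" "\<And>\<omega>. \<sigma> \<omega> \<in> {0..T}"
    and E: "E \<in> sets (predictable_algebra M F T)" "E' \<in> sets (predictable_algebra M F T)"
      "inner_approx \<sigma> E" "inner_approx \<sigma> E'"
  shows "inner_approx \<sigma> (E \<union> E')"
proof -
  have "inner_approx \<sigma> (\<Union>n::nat. if n = 0 then E else E')"
    by (rule inner_approx_Union[OF \<sigma>]) (use E in auto)
  moreover have "(\<Union>n::nat. if n = 0 then E else E') = E \<union> E'"
    by (auto split: if_splits intro: exI[of _ 1])
  ultimately show ?thesis by simp
qed

lemma inner_approx_zero_set:
  assumes "continuous_process Y" "\<And>t \<omega>. 0 \<le> Y t \<omega>" "\<And>t \<omega>. Y t \<omega> \<le> 1"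
  shows "inner_approx \<sigma> {(\<omega>, t). \<omega> \<in> space M \<and> t \<in> {0..T} \<and> Y t \<omega> = 0}"
  unfolding inner_approx_def by (intro allI impI exI[of _ Y] approximatesI assms) auto

lemma inner_approx_at_zero:
  assumes B: "B \<in> sets (F 0)"
  shows "inner_approx \<sigma> (B \<times> {0})"
proof -
  define Y where "Y t \<omega> = (if \<omega> \<in> B then min 1 (max 0 t) else 1)" for t :: real and \<omega> :: 'a
  have "continuous_process Y"
    unfolding continuous_process_def adapted_def
  proof (intro conjI ballI)
    fix t assume t: "t \<in> {0..T}"
    have "{\<omega>\<in>space (F t). \<omega> \<in> B} \<in> sets (F t)"
      using sets_F_mono[OF _ t _ B] T_pos t sets.sets_into_space[of B "F t"] by (simp add: Int_absorb1 Collect_conj_eq)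
    thus "Y t \<in> borel_measurable (F t)"
      unfolding Y_def by (intro measurable_If) auto
  next
    fix \<omega> show "continuous_on {0..T} (\<lambda>t. Y t \<omega>)"
      unfolding Y_def by (cases "\<omega> \<in> B") (auto intro!: continuous_intros)
  qed
  moreover have "0 \<le> Y t \<omega>" "Y t \<omega> \<le> 1" for t \<omega> by (auto simp: Y_def)
  ultimately have "inner_approx \<sigma> {(\<omega>, t). \<omega> \<in> space M \<and> t \<in> {0..T} \<and> Y t \<omega> = 0}"
    by (rule inner_approx_zero_set)
  moreover have "{(\<omega>, t). \<omega> \<in> space M \<and> t \<in> {0..T} \<and> Y t \<omega> = 0} = B \<times> {0}"
    using sets.sets_into_space[OF B] space_F[of 0] T_pos by (auto simp: Y_def min_def max_def split: if_splits)
  ultimately show ?thesis by simp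
qed

lemma inner_approx_initial_interval:
  "inner_approx \<sigma> (space M \<times> ({0..T} \<inter> {0..s}))"
proof -
  define Y where "Y t \<omega> = min 1 (max 0 (t - s))" for t :: real and \<omega> :: 'a
  have "continuous_process Y"
    unfolding continuous_process_def adapted_def Y_def by (auto intro!: continuous_intros)
  moreover have "0 \<le> Y t \<omega>" "Y t \<omega> \<le> 1" for t \<omega> by (auto simp: Y_def)
  ultimately have "inner_approx \<sigma> {(\<omega>, t). \<omega> \<in> space M \<and> t \<in> {0..T} \<and> Y t \<omega> = 0}"
    by (rule inner_approx_zero_set)
  moreover have "{(\<omega>, t). \<omega> \<in> space M \<and> t \<in> {0..T} \<and> Y t \<omega> = 0} = space M \<times> ({0..T} \<inter> {0..s})"
    by (auto simp: Y_def min_def max_def split: if_splits)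
  ultimately show ?thesis by simp
qed

text \<open>
  The rectangle is shrunk to the closed one over \<open>{s'..t}\<close>, with \<open>s' > s\<close> so close to \<open>s\<close> that little mass is
  lost; between \<open>s\<close> and \<open>s'\<close>, when \<open>B\<close> is already known, the process descends continuously to \<open>0\<close> on \<open>B\<close>.
\<close>
lemma inner_approx_rectangle:
  assumes \<sigma>: "\<sigma> \<in> borel_measurable M" "\<And>\<omega>. \<sigma> \<omega> \<in> {0..T}"
    and st: "0 \<le> s" "s < t" "t \<le> T" and B: "B \<in> sets (F s)"
  shows "inner_approx \<sigma> (B \<times> {s<..t})"
  unfolding inner_approx_def
proof (intro allI impI)
  fix \<eta> :: real assume \<eta>: "\<eta> > 0"
  obtain s' where s': "s < s'" "s' < t" "prob {\<omega>\<in>space M. s < \<sigma> \<omega> \<and> \<sigma> \<omega> < s'} < \<eta>"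
    using prob_tail_small[OF \<sigma>(1) st(2) \<eta>] by blast
  \<comment> \<open>Up to time \<open>s\<close> the value is the same on \<open>B\<close> and off \<open>B\<close>, so \<open>B\<close> is not anticipated.\<close>
  define Y where "Y u \<omega> = (if \<omega> \<in> B then min 1 (max 0 (s' - u) + max 0 (u - t)) else min 1 (max (s' - u) (s' - s)))"
    for u \<omega>
  have BM: "B \<subseteq> space M" using sets.sets_into_space[OF B] space_F[of s] st by auto
  have Y: "continuous_process Y"
    unfolding continuous_process_def adapted_def
  proof (intro conjI ballI)
    fix u assume u: "u \<in> {0..T}"
    show "Y u \<in> borel_measurable (F u)"
    proof (cases "s \<le> u")
      case True
      have "{\<omega>\<in>space (F u). \<omega> \<in> B} \<in> sets (F u)"
        using sets_F_mono[OF _ u True B] st BM space_F[OF u] by (simp add: Int_absorb1 Collect_conj_eq)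
      thus ?thesis unfolding Y_def by (intro measurable_If) auto
    next
      case False
      hence "Y u = (\<lambda>\<omega>. min 1 (s' - u))" using s' by (auto simp: Y_def fun_eq_iff max_def)
      thus ?thesis by simp
    qed
  next
    fix \<omega> show "continuous_on {0..T} (\<lambda>u. Y u \<omega>)"
      unfolding Y_def by (cases "\<omega> \<in> B") (auto intro!: continuous_intros)
  qed
  have Y01: "0 \<le> Y u \<omega>" "Y u \<omega> \<le> 1" for u \<omega> using s' by (auto simp: Y_def le_max_iff_disj)
  have zero: "Y u \<omega> = 0 \<longleftrightarrow> \<omega> \<in> B \<and> s' \<le> u \<and> u \<le> t" for u \<omega>
    using s' by (auto simp: Y_def min_def max_def split: if_splits)
  have "prob {\<omega>\<in>space M. (\<omega>, \<sigma> \<omega>) \<in> B \<times> {s<..t} \<and> Y (\<sigma> \<omega>) \<omega> \<noteq> 0} \<le> prob {\<omega>\<in>space M. s < \<sigma> \<omega> \<and> \<sigma> \<omega> < s'}"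
    using \<sigma>(1) by (intro finite_measure_mono) (auto simp: zero)
  also have "\<dots> < \<eta>" by (rule s'(3))
  finally have "prob {\<omega>\<in>space M. (\<omega>, \<sigma> \<omega>) \<in> B \<times> {s<..t} \<and> Y (\<sigma> \<omega>) \<omega> \<noteq> 0} \<le> \<eta>" by simp
  moreover have "(\<omega>, u) \<in> B \<times> {s<..t}" if "Y u \<omega> = 0" for u \<omega>
    using s' that by (auto simp: zero)
  ultimately have "approximates \<sigma> (B \<times> {s<..t}) \<eta> Y"
    by (intro approximatesI Y Y01)
  thus "\<exists>Y. approximates \<sigma> (B \<times> {s<..t}) \<eta> Y" by blast
qed

lemma predictable_rectangle:
  assumes "0 \<le> s" "s < t" "t \<le> T" "B \<in> sets (F s)"
  shows "B \<times> {s<..t} \<in> sets (predictable_algebra M F T)"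
  unfolding sets_predictable_algebra using assms by (intro sigma_sets.Basic) blast

lemma predictable_zero:
  assumes "B \<in> sets (F 0)"
  shows "B \<times> {0} \<in> sets (predictable_algebra M F T)"
  unfolding sets_predictable_algebra using assms by (intro sigma_sets.Basic) blast

text \<open>
  Sets that can be approximated together with their complements form a \<open>\<sigma>\<close>-algebra; complements are
  included because a countable union has a countable intersection as its complement. It contains the
  generating rectangles.
\<close>
theorem inner_approx_predictable:
  assumes \<sigma>: "\<sigma> \<in> borel_measurable M" "\<And>\<omega>. \<sigma> \<omega> \<in> {0..T}"
    and E: "E \<in> sets (predictable_algebra M F T)"
  shows "inner_approx \<sigma> E"
proof -
  let ?\<Omega> = "space M \<times> {0..T}"
  let ?P = "sets (predictable_algebra M F T)"
  have spF: "space M \<in> sets (F t)" if "t \<in> {0..T}" for t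
    using sets.top[of "F t"] space_F[OF that] by simp
  have T0: "0 \<in> {0..T}" using T_pos by simp
  have full: "inner_approx \<sigma> (space M \<times> {s<..T})" "space M \<times> {s<..T} \<in> ?P" if "s \<in> {0..T}" for s
  proof -
    have "inner_approx \<sigma> (space M \<times> {s<..T}) \<and> space M \<times> {s<..T} \<in> ?P"
    proof (cases "s < T")
      case True
      have s0: "0 \<le> s" using that by simp
      show ?thesis
        by (intro conjI inner_approx_rectangle[OF \<sigma> s0 True order_refl spF[OF that]]
          predictable_rectangle[OF s0 True order_refl spF[OF that]])
    next
      case False
      hence "{s<..T} = {}" by auto
      moreover have "inner_approx \<sigma> {}" using inner_approx_at_zero[of "{}"] by simp
      ultimately show ?thesis by (simp only: Sigma_empty2 Times_empty simp_thms sets.empty_sets)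
    qed
    thus "inner_approx \<sigma> (space M \<times> {s<..T})" "space M \<times> {s<..T} \<in> ?P" by auto
  qed
  have "E \<in> sigma_sets ?\<Omega> ({B \<times> {0} | B. B \<in> sets (F 0)} \<union>
      {B \<times> {s<..t} | B s t. 0 \<le> s \<and> s < t \<and> t \<le> T \<and> B \<in> sets (F s)})"
    using E unfolding sets_predictable_algebra .
  hence "E \<in> ?P \<and> inner_approx \<sigma> E \<and> inner_approx \<sigma> (?\<Omega> - E)"
  proof (induction rule: sigma_sets.induct)
    case (Basic A)
    then consider (zero) B where "B \<in> sets (F 0)" "A = B \<times> {0}"
      | (interval) B s t where "0 \<le> s" "s < t" "t \<le> T" "B \<in> sets (F s)" "A = B \<times> {s<..t}"
      by blast
    thus ?case
    proof cases
      case zero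
      have cB: "space M - B \<in> sets (F 0)" using spF[OF T0] zero(1) by simp
      have "inner_approx \<sigma> ((space M - B) \<times> {0} \<union> space M \<times> {0<..T})"
        by (intro inner_approx_Un[OF \<sigma>] predictable_zero full inner_approx_at_zero cB T0)
      moreover have "(space M - B) \<times> {0} \<union> space M \<times> {0<..T} = ?\<Omega> - A"
        using zero T_pos by auto
      ultimately show ?thesis
        using predictable_zero[OF zero(1)] inner_approx_at_zero[OF zero(1)] zero(2) by simp
    next
      case interval
      have s: "s \<in> {0..T}" "t \<in> {0..T}" using interval by auto
      have cB: "space M - B \<in> sets (F s)" using spF[OF s(1)] interval(4) by simp
      have init: "space M \<times> ({0..T} \<inter> {0..s}) \<in> ?P"
      proof -
        have "?\<Omega> - space M \<times> {s<..T} \<in> ?P"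
          using full(2)[OF s(1)] sets.compl_sets[of _ "predictable_algebra M F T"]
          by (simp add: space_predictable_algebra)
        moreover have "?\<Omega> - space M \<times> {s<..T} = space M \<times> ({0..T} \<inter> {0..s})"
          using s by auto
        ultimately show ?thesis by simp
      qed
      have "inner_approx \<sigma> (((space M - B) \<times> {s<..t} \<union> space M \<times> ({0..T} \<inter> {0..s})) \<union> space M \<times> {t<..T})"
        by (intro inner_approx_Un[OF \<sigma>] sets.Un predictable_rectangle[OF interval(1-3) cB] full init
            inner_approx_initial_interval inner_approx_rectangle[OF \<sigma> interval(1-3) cB] s)
      moreover have "((space M - B) \<times> {s<..t} \<union> space M \<times> ({0..T} \<inter> {0..s})) \<union> space M \<times> {t<..T} = ?\<Omega> - A"
        using interval by auto
      ultimately show ?thesis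
        using predictable_rectangle[OF interval(1-4)] inner_approx_rectangle[OF \<sigma> interval(1-4)] interval(5) by simp
    qed
  next
    case Empty
    have "inner_approx \<sigma> (space M \<times> ({0..T} \<inter> {0..T}))" by (rule inner_approx_initial_interval)
    moreover have "inner_approx \<sigma> {}" using inner_approx_at_zero[of "{}"] by simp
    ultimately show ?case by simp
  next
    case (Compl A)
    have "A \<subseteq> ?\<Omega>" using Compl sets.sets_into_space[of A "predictable_algebra M F T"]
      by (simp add: space_predictable_algebra)
    hence "?\<Omega> - (?\<Omega> - A) = A" by auto
    moreover have "?\<Omega> - A \<in> ?P"
      using Compl sets.compl_sets[of A "predictable_algebra M F T"] by (simp add: space_predictable_algebra)
    ultimately show ?case using Compl by simp
  next
    case (Union A)
    have "inner_approx \<sigma> (\<Inter>n. ?\<Omega> - A n)"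
    proof (rule inner_approx_Inter[OF \<sigma>])
      show "?\<Omega> - A n \<in> ?P" "inner_approx \<sigma> (?\<Omega> - A n)" for n
        using Union sets.compl_sets[of "A n" "predictable_algebra M F T"] by (simp_all add: space_predictable_algebra)
    qed
    moreover have "(\<Inter>n. ?\<Omega> - A n) = ?\<Omega> - (\<Union>n. A n)" by auto
    moreover have "inner_approx \<sigma> (\<Union>n. A n)"
      by (rule inner_approx_Union[OF \<sigma>]) (use Union in auto)
    moreover have "(\<Union>n. A n) \<in> ?P" using Union by (intro sets.countable_UN) auto
    ultimately show ?case by simp
  qed
  thus ?thesis by blast
qed

end

section \<open>Jumps of cadlag paths\<close>

text \<open>
  Only upward jumps; downward jumps are upward jumps of the negative path.
\<close>
definition has_jump :: "real \<Rightarrow> (real \<Rightarrow> real) \<Rightarrow> real \<Rightarrow> bool" where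
  "has_jump d x t \<longleftrightarrow> 0 < t \<and> (\<exists>l. (x \<longlongrightarrow> l) (at_left t) \<and> l + d \<le> x t)"

text \<open>
  The two one-sided limits in \<open>\<epsilon>\<close>-form. At \<open>s = 0\<close> the left-hand statement is void and \<open>l\<close> is arbitrary.
\<close>
lemma cadlag_path_nearby:
  assumes x: "cadlag_path T x" and s: "s \<in> {0..T}" and e: "e > 0"
  obtains r l where "r > 0" "\<And>u. u \<in> {s..T} \<Longrightarrow> u < s + r \<Longrightarrow> \<bar>x u - x s\<bar> < e"
    "\<And>u. 0 \<le> u \<Longrightarrow> s - r < u \<Longrightarrow> u < s \<Longrightarrow> \<bar>x u - l\<bar> < e" "s > 0 \<Longrightarrow> (x \<longlongrightarrow> l) (at_left s)"
proof -
  obtain r1 where r1: "r1 > 0" "\<And>u. u \<in> {s..T} \<Longrightarrow> u < s + r1 \<Longrightarrow> \<bar>x u - x s\<bar> < e"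
  proof (cases "s < T")
    case True
    hence "(x \<longlongrightarrow> x s) (at_right s)" using x s by (auto simp: cadlag_path_def)
    hence "\<forall>\<^sub>F u in at_right s. dist (x u) (x s) < e" using e by (rule tendstoD)
    then obtain b where b: "b > s" "\<And>u. s < u \<Longrightarrow> u < b \<Longrightarrow> dist (x u) (x s) < e"
      unfolding eventually_at_right_field by blast
    show ?thesis
    proof (rule that[of "b - s"])
      fix u assume "u \<in> {s..T}" "u < s + (b - s)"
      thus "\<bar>x u - x s\<bar> < e" using b(2)[of u] e by (cases "u = s") (auto simp: dist_real_def)
    qed (use b in simp)
  next
    case False
    show ?thesis
    proof (rule that[of 1])
      fix u assume "u \<in> {s..T}"
      hence "u = s" using False by auto
      thus "\<bar>x u - x s\<bar> < e" using e by simp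
    qed simp
  qed
  obtain r2 l where r2: "r2 > 0" "\<And>u. 0 \<le> u \<Longrightarrow> s - r2 < u \<Longrightarrow> u < s \<Longrightarrow> \<bar>x u - l\<bar> < e"
    "s > 0 \<Longrightarrow> (x \<longlongrightarrow> l) (at_left s)"
  proof (cases "s > 0")
    case True
    hence "s \<in> {0<..T}" using s by simp
    then obtain l where l: "(x \<longlongrightarrow> l) (at_left s)" using x unfolding cadlag_path_def by blast
    hence "\<forall>\<^sub>F u in at_left s. dist (x u) l < e" using e by (rule tendstoD)
    then obtain b where b: "b < s" "\<And>u. b < u \<Longrightarrow> u < s \<Longrightarrow> dist (x u) l < e"
      unfolding eventually_at_left_field by blast
    show ?thesis
      by (rule that[of "s - b" l]) (use b l in \<open>auto simp: dist_real_def\<close>)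
  next
    case False
    show ?thesis by (rule that[of 1 0]) (use False in auto)
  qed
  show ?thesis
    by (rule that[of "min r1 r2" l]) (use r1 r2 in auto)
qed

text \<open>
  The end point is included since a jump at \<open>t\<close> itself is visible only there.
\<close>
definition jump_grid :: "real \<Rightarrow> real set" where
  "jump_grid t = insert t (\<rat> \<inter> {0..t})"

lemma countable_jump_grid: "countable (jump_grid t)"
  unfolding jump_grid_def by (intro countable_insert countable_subset[OF _ countable_rat]) auto

text \<open>
  A countable description of a jump of size \<open>d\<close> up to time \<open>t\<close>: rises of almost \<open>d\<close> within arbitrarily short
  intervals. It makes the time of the first jump measurable.
\<close>
definition rapid_rise :: "real \<Rightarrow> real \<Rightarrow> (real \<Rightarrow> real) \<Rightarrow> bool" where
  "rapid_rise d t x \<longleftrightarrow> (\<forall>k. \<exists>p\<in>jump_grid t. \<exists>q\<in>jump_grid t.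
     p < q \<and> q < p + 1 / real (Suc k) \<and> d - 1 / real (Suc k) < x q - x p)"

lemma jump_imp_rapid_rise:
  assumes x: "cadlag_path T x" and t: "t \<le> T" and s: "s \<le> t" "has_jump d x s"
  shows "rapid_rise d t x"
  unfolding rapid_rise_def
proof
  fix k
  define e where "e = 1 / real (Suc k)"
  have e: "e > 0" by (simp add: e_def)
  from s obtain l where l: "0 < s" "(x \<longlongrightarrow> l) (at_left s)" "l + d \<le> x s" by (auto simp: has_jump_def)
  obtain r l' where r: "r > 0" "\<And>u. u \<in> {s..T} \<Longrightarrow> u < s + r \<Longrightarrow> \<bar>x u - x s\<bar> < e/2"
    "\<And>u. 0 \<le> u \<Longrightarrow> s - r < u \<Longrightarrow> u < s \<Longrightarrow> \<bar>x u - l'\<bar> < e/2" "(x \<longlongrightarrow> l') (at_left s)"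
    using cadlag_path_nearby[OF x, of s "e/2"] l(1) s t e by auto
  have "l' = l" by (rule tendsto_unique[OF _ r(4) l(2)]) simp
  have "max 0 (max (s - r) (s - e/2)) < s" using l r e by auto
  then obtain p where p: "p \<in> \<rat>" "max 0 (max (s - r) (s - e/2)) < p" "p < s"
    using Rats_dense_in_real by blast
  obtain q where q: "q \<in> jump_grid t" "s \<le> q" "q < s + r" "q < s + e/2"
  proof (cases "s = t")
    case True
    thus ?thesis using that[of t] r e by (auto simp: jump_grid_def)
  next
    case False
    hence "s < min t (min (s + r) (s + e/2))" using s r e by auto
    then obtain q where "q \<in> \<rat>" "s < q" "q < min t (min (s + r) (s + e/2))"
      using Rats_dense_in_real by blast
    thus ?thesis using that[of q] l by (auto simp: jump_grid_def)
  qed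
  have "q \<le> t" using q(1) by (auto simp: jump_grid_def)
  have "\<bar>x q - x s\<bar> < e/2" using r(2)[of q] q \<open>q \<le> t\<close> t by auto
  moreover have "\<bar>x p - l\<bar> < e/2" using r(3)[of p] p \<open>l' = l\<close> by auto
  ultimately have "d - e < x q - x p" using l(3) by linarith
  moreover have "p \<in> jump_grid t" using p s by (auto simp: jump_grid_def)
  moreover have "p < q" "q < p + e" using p q by auto
  ultimately show "\<exists>p\<in>jump_grid t. \<exists>q\<in>jump_grid t. p < q \<and> q < p + 1 / real (Suc k) \<and> d - 1 / real (Suc k) < x q - x p"
    using q(1) unfolding e_def by blast
qed

text \<open>
  The short intervals accumulate at some \<open>s\<close>. Near \<open>s\<close> the path is almost constant on either side, so the
  intervals must straddle \<open>s\<close>, and the rise is the jump there.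
\<close>
lemma rapid_rise_imp_jump:
  assumes x: "cadlag_path T x" and t: "0 \<le> t" "t \<le> T" and d: "d > 0" and rise: "rapid_rise d t x"
  obtains s where "s \<le> t" "has_jump d x s"
proof -
  have "\<exists>p q. p \<in> {0..t} \<and> q \<in> {0..t} \<and> p < q \<and> q < p + 1 / real (Suc k) \<and> d - 1 / real (Suc k) < x q - x p" for k
    using rise t(1) unfolding rapid_rise_def jump_grid_def by (metis Int_iff atLeastAtMost_iff insert_iff order_refl)
  then obtain p q where pq: "\<And>k. p k \<in> {0..t}" "\<And>k. q k \<in> {0..t}" "\<And>k. p k < q k"
    "\<And>k. q k < p k + 1 / real (Suc k)" "\<And>k. d - 1 / real (Suc k) < x (q k) - x (p k)"
    by metis
  obtain s \<phi> where s: "s \<in> {0..t}" "strict_mono \<phi>" "(p \<circ> \<phi>) \<longlonglongrightarrow> s"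
    using compact_Icc[of 0 t] pq(1) unfolding compact_def by metis
  have inv: "(\<lambda>k. 1 / real (Suc k)) \<longlonglongrightarrow> 0"
    using LIMSEQ_inverse_real_of_nat by (simp add: inverse_eq_divide)
  have near: "\<exists>l. (s > 0 \<longrightarrow> (x \<longlongrightarrow> l) (at_left s)) \<and> s > 0 \<and> l + d < x s + 3 * e"
    if e: "0 < e" "e \<le> d / 8" for e
  proof -
    obtain r l where r: "r > 0" "\<And>u. u \<in> {s..T} \<Longrightarrow> u < s + r \<Longrightarrow> \<bar>x u - x s\<bar> < e"
      "\<And>u. 0 \<le> u \<Longrightarrow> s - r < u \<Longrightarrow> u < s \<Longrightarrow> \<bar>x u - l\<bar> < e" "s > 0 \<Longrightarrow> (x \<longlongrightarrow> l) (at_left s)"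
      using cadlag_path_nearby[OF x, of s e] s t e by auto
    have "\<forall>\<^sub>F k in sequentially. 1 / real (Suc k) < min e (r/2)"
      using inv e r by (intro order_tendstoD) auto
    moreover have "\<forall>\<^sub>F k in sequentially. dist ((p \<circ> \<phi>) k) s < r / 2"
      by (rule tendstoD[OF s(3)]) (use r in simp)
    ultimately have "\<forall>\<^sub>F k in sequentially. 1 / real (Suc k) < min e (r/2) \<and> dist ((p \<circ> \<phi>) k) s < r / 2"
      by (rule eventually_conj)
    then obtain k where k: "1 / real (Suc k) < min e (r/2)" "dist (p (\<phi> k)) s < r / 2"
      by (auto simp: eventually_sequentially)
    \<comment> \<open>The interval from \<open>P\<close> to \<open>Q\<close> is close to \<open>s\<close>, and its rise is too large for one side of \<open>s\<close>.\<close>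
    define P Q where "P = p (\<phi> k)" and "Q = q (\<phi> k)"
    have "k \<le> \<phi> k" using s(2) by (rule seq_suble)
    hence "1 / real (Suc (\<phi> k)) \<le> 1 / real (Suc k)" by (intro divide_left_mono) auto
    hence inc: "d - e < x Q - x P" "P < Q" "Q < P + r / 2" and "0 \<le> P" "Q \<le> T"
      using pq(1,2,3)[of "\<phi> k"] pq(4,5)[of "\<phi> k"] k t unfolding P_def Q_def by auto
    moreover have "s - r/2 < P" "P < s + r/2"
      using k(2) unfolding P_def dist_real_def abs_diff_less_iff by blast+
    ultimately have bd: "0 \<le> P" "Q \<le> T" "s - r/2 < P" "P < s + r/2"
      by blast+
    have "P < s \<and> s \<le> Q"
    proof (rule ccontr)
      assume "\<not> (P < s \<and> s \<le> Q)"
      then consider "s \<le> P" | "Q < s" by linarith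
      thus False
      proof cases
        case 1
        have "\<bar>x P - x s\<bar> < e" "\<bar>x Q - x s\<bar> < e" using 1 inc bd r(1) by (auto intro!: r(2))
        thus False using inc(1) e d by linarith
      next
        case 2
        have "\<bar>x P - l\<bar> < e" "\<bar>x Q - l\<bar> < e" using 2 inc bd r(1) by (auto intro!: r(3))
        thus False using inc(1) e d by linarith
      qed
    qed
    moreover have "\<bar>x P - l\<bar> < e" "\<bar>x Q - x s\<bar> < e"
      using calculation inc bd r(1) by (auto intro!: r(2,3))
    moreover have "s > 0" using calculation bd by linarith
    ultimately show ?thesis using r(4) inc(1) by (intro exI[of _ l]) linarith
  qed
  obtain l where l: "s > 0" "(x \<longlongrightarrow> l) (at_left s)" using near[of "d/8"] d by auto
  have "l + d \<le> x s"
  proof (rule field_le_epsilon)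
    fix e' :: real assume e': "e' > 0"
    define e where "e = min (d/8) (e'/3)"
    have "0 < e" "e \<le> d/8" "3 * e \<le> e'" using d e' by (auto simp: e_def)
    then obtain l' where l': "(x \<longlongrightarrow> l') (at_left s)" "l' + d < x s + 3 * e" using near[of e] by blast
    have "l' = l" by (rule tendsto_unique[OF _ l'(1) l(2)]) simp
    thus "l + d \<le> x s + e'" using l'(2) \<open>3 * e \<le> e'\<close> by linarith
  qed
  thus ?thesis using that[of s] l s by (auto simp: has_jump_def)
qed

text \<open>
  The default \<open>0\<close> is harmless because no jump happens at time \<open>0\<close>.
\<close>
definition first_jump :: "real \<Rightarrow> real \<Rightarrow> (real \<Rightarrow> real) \<Rightarrow> real" where
  "first_jump T d x = (if \<exists>s\<in>{0..T}. has_jump d x s then Inf {s\<in>{0..T}. has_jump d x s} else 0)"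

text \<open>
  Jumps of size \<open>d\<close> cannot accumulate at a time from the right, where the path is nearly constant.
\<close>
lemma first_jump_attained:
  assumes x: "cadlag_path T x" and d: "d > 0" and s0: "s0 \<in> {0..T}" "has_jump d x s0"
  shows "has_jump d x (first_jump T d x)" "first_jump T d x \<le> s0"
proof -
  let ?J = "{s\<in>{0..T}. has_jump d x s}"
  have bdd: "bdd_below ?J" by (rule bdd_belowI[of _ 0]) auto
  define i where "i = Inf ?J"
  have eq: "first_jump T d x = i" using s0 by (auto simp: first_jump_def i_def)
  have le: "i \<le> s" if "s \<in> ?J" for s unfolding i_def by (rule cInf_lower[OF that bdd])
  show "first_jump T d x \<le> s0" using le s0 eq by auto
  have "0 \<le> i" unfolding i_def by (rule cInf_greatest) (use s0 in auto)
  hence i: "i \<in> {0..T}" using le[of s0] s0 by auto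
  show "has_jump d x (first_jump T d x)"
  proof (rule ccontr)
    assume no: "\<not> has_jump d x (first_jump T d x)"
    obtain r l where r: "r > 0" "\<And>u. u \<in> {i..T} \<Longrightarrow> u < i + r \<Longrightarrow> \<bar>x u - x i\<bar> < d/4"
      using cadlag_path_nearby[OF x i, of "d/4"] d by (metis zero_less_divide_iff zero_less_numeral)
    have "\<exists>s\<in>?J. s < i + r"
      using cInf_lessD[of ?J "i + r"] s0 r(1) unfolding i_def by auto
    then obtain s where s: "s \<in> {0..T}" "has_jump d x s" "s < i + r" by blast
    hence "i < s" using le[of s] no eq by (cases "i = s") auto
    from s obtain l where l: "(x \<longlongrightarrow> l) (at_left s)" "l + d \<le> x s" by (auto simp: has_jump_def)
    have "\<forall>\<^sub>F u in at_left s. i < u \<and> u < s"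
      using eventually_at_left_real[OF \<open>i < s\<close>] by (auto elim: eventually_mono)
    hence "\<forall>\<^sub>F u in at_left s. x i - d/4 \<le> x u"
    proof eventually_elim
      case (elim u)
      hence "\<bar>x u - x i\<bar> < d/4" using s by (intro r(2)) auto
      thus ?case by linarith
    qed
    hence "x i - d/4 \<le> l" by (intro tendsto_lowerbound[OF l(1)]) auto
    moreover have "\<bar>x s - x i\<bar> < d/4" using r(2)[of s] s \<open>i < s\<close> by auto
    ultimately show False using l(2) d by linarith
  qed
qed

lemma first_jump_range: "0 \<le> T \<Longrightarrow> first_jump T d x \<in> {0..T}"
proof -
  assume T: "0 \<le> T"
  have bdd: "bdd_below {s\<in>{0..T}. has_jump d x s}" by (rule bdd_belowI[of _ 0]) auto
  show ?thesis
  proof (cases "\<exists>s\<in>{0..T}. has_jump d x s")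
    case True
    then obtain s where s: "s \<in> {0..T}" "has_jump d x s" by blast
    have "Inf {s\<in>{0..T}. has_jump d x s} \<le> s" by (rule cInf_lower[OF _ bdd]) (use s in simp)
    moreover have "0 \<le> Inf {s\<in>{0..T}. has_jump d x s}" by (rule cInf_greatest) (use s in auto)
    ultimately show ?thesis using True s by (auto simp: first_jump_def)
  qed (use T in \<open>auto simp: first_jump_def\<close>)
qed

lemma continuous_if_no_jumps:
  assumes T: "0 < T" and x: "cadlag_path T x"
    and no: "\<And>n s. s \<in> {0..T} \<Longrightarrow> \<not> has_jump (1 / real (Suc n)) x s"
    "\<And>n s. s \<in> {0..T} \<Longrightarrow> \<not> has_jump (1 / real (Suc n)) (\<lambda>t. - x t) s"
  shows "continuous_on {0..T} x"
  unfolding continuous_on_def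
proof
  fix t assume t: "t \<in> {0..T}"
  have left: "(x \<longlongrightarrow> x t) (at_left t)" if "0 < t"
  proof -
    have "t \<in> {0<..T}" using that t by simp
    then obtain l where l: "(x \<longlongrightarrow> l) (at_left t)" using x unfolding cadlag_path_def by blast
    have "x t \<le> l + e" "l \<le> x t + e" if "e > 0" for e
    proof -
      obtain n where n: "1 / real (Suc n) < e" using nat_approx_posE[OF \<open>e > 0\<close>] by blast
      have "\<not> l + 1 / real (Suc n) \<le> x t"
        using no(1)[OF t, of n] l \<open>0 < t\<close> unfolding has_jump_def by blast
      moreover have "\<not> - l + 1 / real (Suc n) \<le> - x t"
        using no(2)[OF t, of n] tendsto_minus[OF l] \<open>0 < t\<close> unfolding has_jump_def by blast
      ultimately show "x t \<le> l + e" "l \<le> x t + e" using n by linarith+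
    qed
    hence "x t \<le> l" "l \<le> x t" by (auto intro: field_le_epsilon)
    thus ?thesis using l by simp
  qed
  have right: "(x \<longlongrightarrow> x t) (at_right t)" if "t < T"
    using x t that by (auto simp: cadlag_path_def)
  show "(x \<longlongrightarrow> x t) (at t within {0..T})"
  proof (cases "0 < t")
    case True
    show ?thesis
    proof (cases "t < T")
      case True
      hence "(x \<longlongrightarrow> x t) (at t)" using left right \<open>0 < t\<close> by (simp add: filterlim_split_at)
      thus ?thesis by (rule tendsto_within_subset) simp
    next
      case False
      hence "{0..T} = {0..t}" using t by auto
      thus ?thesis using left \<open>0 < t\<close> by (simp add: at_within_Icc_at_left)
    qed
  next
    case False
    hence "t = 0" using t by simp
    thus ?thesis using right T by (simp add: at_within_Icc_at_right)
  qed
qed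

context usual_filtered_prob_space
begin

section \<open>Predictable local martingales are continuous\<close>

lemma first_jump_measurable:
  assumes X: "adapted F T X" "cadlag M T X" and d: "d > 0"
  shows "(\<lambda>\<omega>. first_jump T d (\<lambda>t. X t \<omega>)) \<in> borel_measurable M"
proof (rule borel_measurableI_le)
  have path: "cadlag_path T (\<lambda>t. X t \<omega>)" if "\<omega> \<in> space M" for \<omega>
    using X(2) that by (simp add: cadlag_def)
  have rise: "{\<omega>\<in>space M. rapid_rise d t (\<lambda>t. X t \<omega>)} \<in> sets M" if t: "t \<in> {0..T}" for t
  proof -
    have "{\<omega>\<in>space M. rapid_rise d t (\<lambda>t. X t \<omega>)} = (\<Inter>k. \<Union>p\<in>jump_grid t. \<Union>q\<in>jump_grid t.
        {\<omega>\<in>space M. p < q \<and> q < p + 1 / real (Suc k) \<and> d - 1 / real (Suc k) < X q \<omega> - X p \<omega>})"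
      unfolding rapid_rise_def by auto
    also have "\<dots> \<in> sets M"
    proof (rule sets.countable_INT, safe, rule sets.countable_UN''[OF countable_jump_grid],
        rule sets.countable_UN''[OF countable_jump_grid])
      fix k p q assume "p \<in> jump_grid t" "q \<in> jump_grid t"
      hence "p \<in> {0..T}" "q \<in> {0..T}" using t by (auto simp: jump_grid_def)
      hence [measurable]: "X p \<in> borel_measurable M" "X q \<in> borel_measurable M"
        using adapted_measurable[OF X(1)] by blast+
      show "{\<omega>\<in>space M. p < q \<and> q < p + 1 / real (Suc k) \<and> d - 1 / real (Suc k) < X q \<omega> - X p \<omega>} \<in> sets M"
        by measurable
    qed
    finally show ?thesis .
  qed
  have rise_iff: "rapid_rise d t (\<lambda>t. X t \<omega>) \<longleftrightarrow> (\<exists>s\<in>{0..T}. has_jump d (\<lambda>t. X t \<omega>) s \<and> s \<le> t)"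
    if \<omega>: "\<omega> \<in> space M" and t: "t \<in> {0..T}" for \<omega> t
  proof
    assume "rapid_rise d t (\<lambda>t. X t \<omega>)"
    then obtain s where "s \<le> t" "has_jump d (\<lambda>t. X t \<omega>) s"
      using rapid_rise_imp_jump[OF path[OF \<omega>] _ _ d, of t] t by auto
    thus "\<exists>s\<in>{0..T}. has_jump d (\<lambda>t. X t \<omega>) s \<and> s \<le> t"
      using t by (intro bexI[of _ s]) (auto simp: has_jump_def)
  next
    assume "\<exists>s\<in>{0..T}. has_jump d (\<lambda>t. X t \<omega>) s \<and> s \<le> t"
    thus "rapid_rise d t (\<lambda>t. X t \<omega>)"
      using jump_imp_rapid_rise[OF path[OF \<omega>], of t] t by auto
  qed
  fix u
  let ?\<sigma> = "\<lambda>\<omega>. first_jump T d (\<lambda>t. X t \<omega>)"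
  have range: "?\<sigma> \<omega> \<in> {0..T}" for \<omega> using first_jump_range T_pos by simp
  consider "u < 0" | "u \<in> {0..T}" | "T < u" by fastforce
  thus "{\<omega>\<in>space M. ?\<sigma> \<omega> \<le> u} \<in> sets M"
  proof cases
    case 1
    have "\<not> ?\<sigma> \<omega> \<le> u" for \<omega> using range[of \<omega>] 1 by auto
    thus ?thesis by simp
  next
    case 2
    have "?\<sigma> \<omega> \<le> u \<longleftrightarrow> \<not> rapid_rise d T (\<lambda>t. X t \<omega>) \<or> rapid_rise d u (\<lambda>t. X t \<omega>)" if \<omega>: "\<omega> \<in> space M" for \<omega>
    proof (cases "\<exists>s\<in>{0..T}. has_jump d (\<lambda>t. X t \<omega>) s")
      case True
      then obtain s where s: "s \<in> {0..T}" "has_jump d (\<lambda>t. X t \<omega>) s" by blast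
      have J: "has_jump d (\<lambda>t. X t \<omega>) (?\<sigma> \<omega>)" using first_jump_attained(1)[OF path[OF \<omega>] d s] .
      have "rapid_rise d T (\<lambda>t. X t \<omega>)" using rise_iff[OF \<omega>, of T] s T_pos by auto
      moreover have "?\<sigma> \<omega> \<le> u \<longleftrightarrow> rapid_rise d u (\<lambda>t. X t \<omega>)"
        unfolding rise_iff[OF \<omega> 2]
        using J range[of \<omega>] first_jump_attained(2)[OF path[OF \<omega>] d] order_trans by blast
      ultimately show ?thesis by simp
    next
      case False
      hence "?\<sigma> \<omega> = 0" by (simp add: first_jump_def)
      moreover have "\<not> rapid_rise d T (\<lambda>t. X t \<omega>)" using rise_iff[OF \<omega>, of T] False T_pos by auto
      ultimately show ?thesis using 2 by simp
    qed
    hence "{\<omega>\<in>space M. ?\<sigma> \<omega> \<le> u} = (space M - {\<omega>\<in>space M. rapid_rise d T (\<lambda>t. X t \<omega>)})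
        \<union> {\<omega>\<in>space M. rapid_rise d u (\<lambda>t. X t \<omega>)}"
      by blast
    thus ?thesis using rise[OF 2] rise[of T] T_pos by simp
  next
    case 3
    have "?\<sigma> \<omega> \<le> u" for \<omega> using range[of \<omega>] 3 by auto
    thus ?thesis by simp
  qed
qed

text \<open>
  By continuity the path is below \<open>1/(n+1)\<close> already shortly before its first zero, and before any earlier
  time it is bounded away from \<open>0\<close>.
\<close>
lemma hit_times_announce_zero:
  assumes y: "continuous_on {0..T} y" and s: "s \<in> {0..T}" "y s \<le> 0" and pos: "0 < hit_time T 0 y"
  shows "filterlim (\<lambda>n. hit_time T (1 / real (Suc n)) y) (at_left (hit_time T 0 y)) sequentially"
proof -
  define \<tau> where "\<tau> = hit_time T 0 y"
  have \<tau>: "\<tau> \<in> {0..T}" "0 < \<tau>" using hit_time_range[of T 0 y] pos T_pos by (auto simp: \<tau>_def)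
  have y\<tau>: "y \<tau> \<le> 0" unfolding \<tau>_def by (rule hit_time_attained[OF y s])
  let ?h = "\<lambda>n. hit_time T (1 / real (Suc n)) y"
  have below: "?h n < \<tau>" for n
  proof -
    have "0 < 1 / real (Suc n)" by simp
    then obtain r where r: "r > 0" "\<And>u. u \<in> {0..T} \<Longrightarrow> dist u \<tau> < r \<Longrightarrow> dist (y u) (y \<tau>) < 1 / real (Suc n)"
      using y \<tau>(1) unfolding continuous_on_iff by blast
    define u where "u = max 0 (\<tau> - r/2)"
    have u: "u \<in> {0..T}" "u < \<tau>" "dist u \<tau> < r" using \<tau> r(1) by (auto simp: u_def dist_real_def)
    have "y u \<le> 1 / real (Suc n)" using r(2)[OF u(1,3)] y\<tau> by (auto simp: dist_real_def)
    thus ?thesis using hit_time_le[OF u(1)] u(2) by fastforce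
  qed
  have "?h \<longlonglongrightarrow> \<tau>"
  proof (rule order_tendstoI)
    fix a assume "\<tau> < a"
    thus "\<forall>\<^sub>F n in sequentially. ?h n < a" using below by (intro always_eventually allI) (meson less_trans)
  next
    fix a assume a: "a < \<tau>"
    show "\<forall>\<^sub>F n in sequentially. a < ?h n"
    proof (cases "0 \<le> a")
      case True
      have cont: "continuous_on {0..a} y" using y a \<tau> by (auto intro: continuous_on_subset)
      obtain v where v: "v \<in> {0..a}" "\<And>u. u \<in> {0..a} \<Longrightarrow> y v \<le> y u"
        using continuous_attains_inf[OF compact_Icc _ cont] True by auto
      have "0 < y v"
      proof (rule ccontr)
        assume "\<not> 0 < y v"
        hence "\<tau> \<le> v" unfolding \<tau>_def using v a \<tau> by (intro hit_time_le) auto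
        thus False using v a by auto
      qed
      then obtain m where m: "1 / real (Suc m) < y v" using nat_approx_posE by blast
      have "a < ?h n" if "n \<ge> m" for n
      proof (rule ccontr)
        assume "\<not> a < ?h n"
        hence h: "?h n \<in> {0..a}" using hit_time_range[of T "1 / real (Suc n)" y] T_pos by auto
        have "y s \<le> 1 / real (Suc n)" using s(2) by (rule order_trans) simp
        hence "y (?h n) \<le> 1 / real (Suc n)" by (rule hit_time_attained[OF y s(1)])
        also have "\<dots> \<le> 1 / real (Suc m)" using that by (intro divide_left_mono) auto
        finally show False using m v(2)[OF h] by linarith
      qed
      thus ?thesis by (intro eventually_sequentiallyI)
    next
      case False
      have "a < ?h n" for n
        using hit_time_range[of T "1 / real (Suc n)" y] T_pos False by auto
      thus ?thesis by simp
    qed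
  qed
  thus ?thesis
    unfolding \<tau>_def[symmetric] at_within_def filterlim_inf filterlim_principal
    using below by (auto intro!: always_eventually simp: less_le)
qed

lemma hit_times_eventually_T:
  assumes y: "continuous_on {0..T} y" and pos: "\<And>t. t \<in> {0..T} \<Longrightarrow> 0 < y t"
  shows "\<forall>\<^sub>F n in sequentially. hit_time T (1 / real (Suc n)) y = T"
proof -
  obtain v where v: "v \<in> {0..T}" "\<And>u. u \<in> {0..T} \<Longrightarrow> y v \<le> y u"
    using continuous_attains_inf[OF compact_Icc _ y] T_pos by auto
  obtain m where m: "1 / real (Suc m) < y v" using nat_approx_posE[OF pos[OF v(1)]] by blast
  have "hit_time T (1 / real (Suc n)) y = T" if "n \<ge> m" for n
  proof -
    have "1 / real (Suc n) \<le> 1 / real (Suc m)" using that by (intro divide_left_mono) auto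
    hence "\<not> (\<exists>t\<in>{0..T}. y t \<le> 1 / real (Suc n))" using m v(2) by fastforce
    thus ?thesis by (simp add: hit_time_def)
  qed
  thus ?thesis by (intro eventually_sequentiallyI)
qed

text \<open>
  Let \<open>\<tau>\<close> be the first zero of \<open>Y\<close> and \<open>h n\<close> the time of reaching \<open>1/(n+1)\<close>. Where a zero exists, \<open>h n\<close>
  lies strictly before \<open>\<tau>\<close> and tends to \<open>\<tau>\<close>, and \<open>X\<close> at \<open>h n\<close> tends to the left limit at \<open>\<tau>\<close>; elsewhere \<open>h n\<close> and \<open>\<tau>\<close> are
  eventually equal to \<open>T\<close>. Optional stopping gives all these stopped values the same expectation, so
  the jump at \<open>\<tau>\<close> has mean \<open>0\<close>, whereas it is at least \<open>d\<close>.
\<close>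
lemma martingale_no_jump_at_zero_set:
  assumes X: "martingale M F T X" "cadlag M T X" and d: "d > 0"
    and Y: "continuous_process Y" "\<And>t \<omega>. 0 \<le> Y t \<omega>"
    and jump: "\<And>\<omega> t. \<omega> \<in> space M \<Longrightarrow> t \<in> {0..T} \<Longrightarrow> Y t \<omega> = 0 \<Longrightarrow> has_jump d (\<lambda>s. X s \<omega>) t"
  shows "prob {\<omega>\<in>space M. \<exists>t\<in>{0..T}. Y t \<omega> \<le> 0} = 0"
proof -
  have T: "T \<in> {0..T}" using T_pos by simp
  let ?H = "{\<omega>\<in>space M. \<exists>t\<in>{0..T}. Y t \<omega> \<le> 0}"
  have H: "?H \<in> sets M" using sets_F[OF T exists_le_sets[OF Y(1) T]] .
  let ?\<tau> = "\<lambda>\<omega>. hit_time T 0 (\<lambda>t. Y t \<omega>)"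
  let ?h = "\<lambda>n \<omega>. hit_time T (1 / real (Suc n)) (\<lambda>t. Y t \<omega>)"
  have range: "hit_time T c (\<lambda>t. Y t \<omega>) \<in> {0..T}" for c \<omega> using hit_time_range T_pos by simp
  note stop = hit_time_stopping[OF Y(1)]
  note opt = optional_stopping[OF X stop range]
  \<comment> \<open>The limit \<open>z\<close> is the left limit at the first zero, or the value at \<open>T\<close> when there is no zero.\<close>
  have key: "\<exists>z. (\<lambda>n. X (?h n \<omega>) \<omega>) \<longlonglongrightarrow> z \<and> d * indicator ?H \<omega> \<le> X (?\<tau> \<omega>) \<omega> - z"
    if \<omega>: "\<omega> \<in> space M" for \<omega>
  proof -
    have cont: "continuous_on {0..T} (\<lambda>t. Y t \<omega>)" using Y(1) \<omega> by (auto simp: continuous_process_def)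
    show ?thesis
    proof (cases "\<omega> \<in> ?H")
      case True
      then obtain s where s: "s \<in> {0..T}" "Y s \<omega> \<le> 0" by blast
      have "Y (?\<tau> \<omega>) \<omega> \<le> 0" by (rule hit_time_attained[OF cont s])
      hence "Y (?\<tau> \<omega>) \<omega> = 0" using Y(2)[of "?\<tau> \<omega>" \<omega>] by simp
      hence "has_jump d (\<lambda>s. X s \<omega>) (?\<tau> \<omega>)" by (rule jump[OF \<omega> range])
      then obtain l where l: "0 < ?\<tau> \<omega>" "((\<lambda>s. X s \<omega>) \<longlongrightarrow> l) (at_left (?\<tau> \<omega>))" "l + d \<le> X (?\<tau> \<omega>) \<omega>"
        by (auto simp: has_jump_def)
      have "(\<lambda>n. X (?h n \<omega>) \<omega>) \<longlonglongrightarrow> l"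
        by (rule filterlim_compose[OF l(2) hit_times_announce_zero[OF cont s l(1)]])
      thus ?thesis using l(3) True by (intro exI[of _ l]) simp
    next
      case False
      hence pos: "0 < Y t \<omega>" if "t \<in> {0..T}" for t using that \<omega> by (auto simp: not_le)
      hence "\<not> (\<exists>t\<in>{0..T}. Y t \<omega> \<le> 0)" by (meson not_le)
      hence "?\<tau> \<omega> = T" by (simp add: hit_time_def)
      moreover have "(\<lambda>n. X (?h n \<omega>) \<omega>) \<longlonglongrightarrow> X T \<omega>"
        using hit_times_eventually_T[OF cont pos] by (intro tendsto_eventually) (auto elim: eventually_mono)
      ultimately show ?thesis using False by (intro exI[of _ "X T \<omega>"]) simp
    qed
  qed
  define Z where "Z \<omega> = lim (\<lambda>n. X (?h n \<omega>) \<omega>)" for \<omega>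
  have Z: "(\<lambda>n. X (?h n \<omega>) \<omega>) \<longlonglongrightarrow> Z \<omega>" "d * indicator ?H \<omega> \<le> X (?\<tau> \<omega>) \<omega> - Z \<omega>"
    if \<omega>: "\<omega> \<in> space M" for \<omega>
  proof -
    obtain z where z: "(\<lambda>n. X (?h n \<omega>) \<omega>) \<longlonglongrightarrow> z" "d * indicator ?H \<omega> \<le> X (?\<tau> \<omega>) \<omega> - z"
      using key[OF \<omega>] by blast
    have "Z \<omega> = z" unfolding Z_def by (rule limI[OF z(1)])
    thus "(\<lambda>n. X (?h n \<omega>) \<omega>) \<longlonglongrightarrow> Z \<omega>" "d * indicator ?H \<omega> \<le> X (?\<tau> \<omega>) \<omega> - Z \<omega>" using z by auto
  qed
  have meas: "(\<lambda>\<omega>. X (?h n \<omega>) \<omega>) \<in> borel_measurable M" for n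
    using opt(1) by (simp add: excess_dominated_def)
  have Zm: "Z \<in> borel_measurable M"
    by (rule borel_measurable_LIMSEQ_real[OF Z(1) meas])
  have iT: "integrable M (X T)" by (rule martingale_integrable[OF X(1) T])
  have lim: "AE \<omega> in M. (\<lambda>n. X (?h n \<omega>) \<omega>) \<longlonglongrightarrow> Z \<omega>" using Z(1) by auto
  have iZ: "integrable M Z"
    by (rule excess_dominated_integrable[OF iT excess_dominated_limit(1)[OF iT opt(1) Zm lim]])
  have i\<tau>: "integrable M (\<lambda>\<omega>. X (?\<tau> \<omega>) \<omega>)" by (rule excess_dominated_integrable[OF iT opt(1)])
  have "(\<lambda>n. expectation (\<lambda>\<omega>. X (?h n \<omega>) \<omega>)) \<longlonglongrightarrow> expectation Z"
    by (rule excess_dominated_limit(2)[OF iT opt(1) Zm lim])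
  hence EZ: "expectation Z = expectation (X T)" by (simp add: opt(2) LIMSEQ_const_iff)
  have iH: "integrable M (indicat_real ?H)"
    by (rule integrable_real_indicator[OF H]) (simp add: emeasure_eq_measure)
  have "d * prob ?H = expectation (\<lambda>\<omega>. d * indicator ?H \<omega>)" using H by simp
  also have "\<dots> \<le> expectation (\<lambda>\<omega>. X (?\<tau> \<omega>) \<omega> - Z \<omega>)"
    by (intro integral_mono Bochner_Integration.integrable_diff integrable_mult_right iH i\<tau> iZ Z(2))
  also have "\<dots> = 0" using i\<tau> iZ EZ opt(2) by simp
  finally show ?thesis using d measure_nonneg[of M ?H] by (simp add: mult_le_0_iff)
qed

text \<open>
  Up to mass \<open>\<eta>\<close>, the graph of \<open>\<sigma>\<close> inside \<open>E\<close> is covered by a zero set contained in \<open>E\<close>, which is almost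
  surely empty.
\<close>
lemma martingale_no_predictable_jump:
  assumes X: "martingale M F T X" "cadlag M T X" and d: "d > 0"
    and \<sigma>: "\<sigma> \<in> borel_measurable M" "\<And>\<omega>. \<sigma> \<omega> \<in> {0..T}"
    and E: "E \<in> sets (predictable_algebra M F T)"
    and jump: "\<And>\<omega> t. (\<omega>, t) \<in> E \<Longrightarrow> has_jump d (\<lambda>s. X s \<omega>) t"
  shows "prob {\<omega>\<in>space M. (\<omega>, \<sigma> \<omega>) \<in> E} = 0"
proof -
  have T: "T \<in> {0..T}" using T_pos by simp
  have "prob {\<omega>\<in>space M. (\<omega>, \<sigma> \<omega>) \<in> E} \<le> 0 + \<eta>" if \<eta>: "\<eta> > 0" for \<eta>
  proof -
    obtain Y where Y: "approximates \<sigma> E \<eta> Y"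
      using inner_approx_predictable[OF \<sigma> E] \<eta> unfolding inner_approx_def by blast
    note Y' = approximatesD[OF Y]
    let ?L = "{\<omega>\<in>space M. (\<omega>, \<sigma> \<omega>) \<in> E \<and> Y (\<sigma> \<omega>) \<omega> \<noteq> 0}"
    let ?H = "{\<omega>\<in>space M. \<exists>t\<in>{0..T}. Y t \<omega> \<le> 0}"
    have H: "?H \<in> sets M" using sets_F[OF T exists_le_sets[OF Y'(1) T]] .
    have L: "?L \<in> sets M" by (rule loss_measurable[OF \<sigma> E Y'(1)])
    have "prob {\<omega>\<in>space M. (\<omega>, \<sigma> \<omega>) \<in> E} \<le> prob (?L \<union> ?H)"
    proof (rule finite_measure_mono)
      show "?L \<union> ?H \<in> sets M" using H L by simp
      show "{\<omega>\<in>space M. (\<omega>, \<sigma> \<omega>) \<in> E} \<subseteq> ?L \<union> ?H"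
      proof
        fix \<omega> assume "\<omega> \<in> {\<omega>\<in>space M. (\<omega>, \<sigma> \<omega>) \<in> E}"
        thus "\<omega> \<in> ?L \<union> ?H" using \<sigma>(2)[of \<omega>] by (cases "Y (\<sigma> \<omega>) \<omega> = 0") force+
      qed
    qed
    also have "\<dots> \<le> prob ?L + prob ?H" using H L by (rule measure_Un_le[rotated])
    also have "prob ?H = 0"
      by (rule martingale_no_jump_at_zero_set[OF X d Y'(1,2)]) (rule jump, rule Y'(4))
    finally show ?thesis using Y'(5) by simp
  qed
  hence "prob {\<omega>\<in>space M. (\<omega>, \<sigma> \<omega>) \<in> E} \<le> 0" by (rule field_le_epsilon)
  thus ?thesis using measure_nonneg[of M] by (simp add: antisym)
qed

text \<open>
  Left-continuous step processes sampled on a grid; they are predictable and converge to the left limits.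
\<close>
definition left_step :: "(real \<Rightarrow> 'a \<Rightarrow> real) \<Rightarrow> nat \<Rightarrow> 'a \<times> real \<Rightarrow> real" where
  "left_step X k = (\<lambda>(\<omega>, t). \<Sum>i<Suc k.
     indicator {real i * T / Suc k<..real (Suc i) * T / Suc k} t * X (real i * T / Suc k) \<omega>)"

lemma predictable_indicator_times:
  assumes st: "0 \<le> s" "s < t" "t \<le> T" and Z: "Z \<in> borel_measurable (F s)"
  shows "(\<lambda>(\<omega>, u). indicator {s<..t} u * Z \<omega> :: real) \<in> borel_measurable (predictable_algebra M F T)"
proof (rule measurableI)
  fix S :: "real set" assume S: "S \<in> sets borel"
  have s: "s \<in> {0..T}" using st by simp
  let ?B = "Z -` S \<inter> space M"
  have B: "?B \<in> sets (F s)" using measurable_sets[OF Z S] space_F[OF s] by simp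
  have M': "space M \<in> sets (F s)" using sets.top[of "F s"] space_F[OF s] by simp
  have "space (predictable_algebra M F T) - space M \<times> {s<..t} \<in> sets (predictable_algebra M F T)"
    by (rule sets.compl_sets[OF predictable_rectangle[OF st M']])
  moreover have "(\<lambda>(\<omega>, u). indicator {s<..t} u * Z \<omega>) -` S \<inter> space (predictable_algebra M F T)
    = (?B \<times> {s<..t}) \<union> (if 0 \<in> S then space (predictable_algebra M F T) - space M \<times> {s<..t} else {})"
    using st by (auto simp: space_predictable_algebra indicator_def of_bool_def split: if_splits)
  ultimately show "(\<lambda>(\<omega>, u). indicator {s<..t} u * Z \<omega>) -` S \<inter> space (predictable_algebra M F T)
      \<in> sets (predictable_algebra M F T)"
    using predictable_rectangle[OF st B] by auto
qed simp

lemma grid_in_range: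
  assumes "i < Suc k"
  shows "0 \<le> real i * T / Suc k" "real i * T / Suc k < real (Suc i) * T / Suc k" "real (Suc i) * T / Suc k \<le> T"
proof -
  have "real (Suc i) * T \<le> real (Suc k) * T" using assms T_pos by (intro mult_right_mono) auto
  thus "0 \<le> real i * T / Suc k" "real i * T / Suc k < real (Suc i) * T / Suc k" "real (Suc i) * T / Suc k \<le> T"
    using T_pos by (auto simp: divide_strict_right_mono pos_divide_le_eq mult.commute simp del: of_nat_Suc)
qed

lemma left_step_measurable:
  assumes X: "adapted F T X"
  shows "left_step X k \<in> borel_measurable (predictable_algebra M F T)"
proof -
  have "(\<lambda>z. \<Sum>i<Suc k. (\<lambda>(\<omega>, t). indicator {real i * T / Suc k<..real (Suc i) * T / Suc k} t
      * X (real i * T / Suc k) \<omega>) z) \<in> borel_measurable (predictable_algebra M F T)"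
  proof (rule borel_measurable_sum)
    fix i assume "i \<in> {..<Suc k}"
    hence i: "i < Suc k" by simp
    have "real i * T / Suc k \<in> {0..T}" using grid_in_range[OF i] by auto
    hence "X (real i * T / Suc k) \<in> borel_measurable (F (real i * T / Suc k))"
      using X unfolding adapted_def by blast
    thus "(\<lambda>(\<omega>, t). indicator {real i * T / Suc k<..real (Suc i) * T / Suc k} t
      * X (real i * T / Suc k) \<omega>) \<in> borel_measurable (predictable_algebra M F T)"
      by (rule predictable_indicator_times[OF grid_in_range[OF i]])
  qed
  thus ?thesis by (simp add: left_step_def case_prod_beta)
qed

text \<open>
  The interval \<open>(i T/m, (i+1) T/m]\<close> containing \<open>t\<close> has \<open>i = \<lceil>t m / T\<rceil> - 1\<close>.
\<close>
lemma left_step_value: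
  assumes t: "t \<in> {0<..T}"
  obtains u where "0 \<le> u" "u < t" "t \<le> u + T / Suc k" "\<And>\<omega>. left_step X k (\<omega>, t) = X u \<omega>"
proof -
  define m where "m = real (Suc k)"
  have m: "m > 0" by (simp add: m_def)
  define j where "j = nat (\<lceil>t * m / T\<rceil> - 1)"
  have pos: "0 < t * m / T" using t m T_pos by simp
  hence ceil: "1 \<le> \<lceil>t * m / T\<rceil>" by linarith
  have j: "real j = of_int \<lceil>t * m / T\<rceil> - 1" using ceil by (simp add: j_def)
  have jt: "real j < t * m / T" "t * m / T \<le> real j + 1" unfolding j by linarith+
  have "t * m / T \<le> m" using t T_pos m by (simp add: pos_divide_le_eq mult.commute mult_left_mono)
  hence "real j < m" using jt by linarith
  hence jk: "j < Suc k" by (simp add: m_def)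
  have bounds: "real j * T / m < t" "t \<le> real (Suc j) * T / m"
    using jt T_pos m by (auto simp: field_simps)
  have only: "t \<in> {real i * T / m<..real (Suc i) * T / m} \<longleftrightarrow> i = j" for i
  proof
    assume "t \<in> {real i * T / m<..real (Suc i) * T / m}"
    hence "real i < t * m / T" "t * m / T \<le> real (Suc i)" using T_pos m by (auto simp: field_simps)
    thus "i = j" using jt by linarith
  qed (use bounds in auto)
  have "left_step X k (\<omega>, t) = (\<Sum>i<Suc k. if i = j then X (real j * T / m) \<omega> else 0)" for \<omega>
    unfolding left_step_def prod.case m_def[symmetric]
    by (intro sum.cong refl) (simp only: indicator_def only of_bool_def if_distrib if_True if_False mult_1 mult_zero_left cong: if_cong split: if_split, simp)
  hence "left_step X k (\<omega>, t) = X (real j * T / m) \<omega>" for \<omega>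
    using jk by simp
  moreover have "t \<le> real j * T / m + T / m" using bounds by (simp add: add_divide_distrib[symmetric] algebra_simps)
  moreover have "0 \<le> real j * T / m" using T_pos m by simp
  ultimately show ?thesis using bounds(1) that unfolding m_def by blast
qed

lemma left_step_tendsto:
  assumes t: "t \<in> {0<..T}" and l: "((\<lambda>s. X s \<omega>) \<longlongrightarrow> l) (at_left t)"
  shows "(\<lambda>k. left_step X k (\<omega>, t)) \<longlonglongrightarrow> l"
proof -
  have "\<exists>u. u < t \<and> t \<le> u + T / Suc k \<and> left_step X k (\<omega>, t) = X u \<omega>" for k
    using left_step_value[OF t, of k X] by metis
  then obtain u where u: "\<And>k. u k < t" "\<And>k. t \<le> u k + T / Suc k" "\<And>k. left_step X k (\<omega>, t) = X (u k) \<omega>"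
    by metis
  have "u \<longlonglongrightarrow> t"
  proof (rule tendsto_sandwich)
    have "(\<lambda>k. t - T * inverse (real (Suc k))) \<longlonglongrightarrow> t - T * 0"
      by (intro tendsto_intros LIMSEQ_inverse_real_of_nat)
    thus "(\<lambda>k. t - T / Suc k) \<longlonglongrightarrow> t" by (simp add: divide_inverse)
    show "\<forall>\<^sub>F k in sequentially. t - T / Suc k \<le> u k"
    proof (intro always_eventually allI)
      fix k show "t - T / Suc k \<le> u k" using u(2)[of k] by linarith
    qed
    show "\<forall>\<^sub>F k in sequentially. u k \<le> t" using u(1) by (simp add: less_imp_le)
  qed simp
  hence "filterlim u (at_left t) sequentially"
    unfolding at_within_def filterlim_inf filterlim_principal
    using u(1) by (auto intro!: always_eventually simp: less_le)
  hence "(\<lambda>k. X (u k) \<omega>) \<longlonglongrightarrow> l" by (rule filterlim_compose[OF l])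
  thus ?thesis by (simp add: u(3))
qed

lemma predictable_until_stopping:
  assumes \<tau>: "stopping_time F \<tau>" "\<And>\<omega>. \<tau> \<omega> \<in> {0..T}"
  shows "{(\<omega>, t). \<omega> \<in> space M \<and> t \<in> {0..T} \<and> t \<le> \<tau> \<omega>} \<in> sets (predictable_algebra M F T)"
proof -
  have "(\<Union>q\<in>\<rat> \<inter> {0..<T}. {\<omega>\<in>space M. \<tau> \<omega> \<le> q} \<times> {q<..T}) \<in> sets (predictable_algebra M F T)"
  proof (rule sets.countable_UN'')
    show "countable (\<rat> \<inter> {0..<T})" by (rule countable_subset[OF _ countable_rat]) auto
    fix q assume "q \<in> \<rat> \<inter> {0..<T}"
    hence q: "0 \<le> q" "q < T" "q \<in> {0..T}" by auto
    show "{\<omega>\<in>space M. \<tau> \<omega> \<le> q} \<times> {q<..T} \<in> sets (predictable_algebra M F T)"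
      by (rule predictable_rectangle[OF q(1,2) order_refl stopping_le_sets[OF \<tau>(1) q(3) q(3) order_refl]])
  qed
  hence "space (predictable_algebra M F T) - (\<Union>q\<in>\<rat> \<inter> {0..<T}. {\<omega>\<in>space M. \<tau> \<omega> \<le> q} \<times> {q<..T})
      \<in> sets (predictable_algebra M F T)" by (rule sets.compl_sets)
  also have "space (predictable_algebra M F T) - (\<Union>q\<in>\<rat> \<inter> {0..<T}. {\<omega>\<in>space M. \<tau> \<omega> \<le> q} \<times> {q<..T})
    = {(\<omega>, t). \<omega> \<in> space M \<and> t \<in> {0..T} \<and> t \<le> \<tau> \<omega>}"
  proof -
    have "t \<le> \<tau> \<omega> \<longleftrightarrow> (\<forall>q\<in>\<rat> \<inter> {0..<T}. \<not> (\<tau> \<omega> \<le> q \<and> q < t))" if t: "t \<in> {0..T}" for t \<omega>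
    proof
      assume *: "\<forall>q\<in>\<rat> \<inter> {0..<T}. \<not> (\<tau> \<omega> \<le> q \<and> q < t)"
      show "t \<le> \<tau> \<omega>"
      proof (rule ccontr)
        assume "\<not> t \<le> \<tau> \<omega>"
        then obtain q where q: "q \<in> \<rat>" "\<tau> \<omega> < q" "q < t" using Rats_dense_in_real[of "\<tau> \<omega>" t] by auto
        hence "q \<in> \<rat> \<inter> {0..<T}" using \<tau>(2)[of \<omega>] t by auto
        thus False using * q by auto
      qed
    qed auto
    thus ?thesis unfolding space_predictable_algebra by auto
  qed
  finally show ?thesis .
qed

text \<open>
  The set \<open>E\<close> of jumps of size \<open>d\<close> is predictable, as \<open>L\<close> coincides with a predictable process and its left
  limits are limits of step processes. Up to a localizing time \<open>L\<close> jumps like a martingale, so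
  the first jump misses \<open>E\<close> almost surely; a path with a jump would have its first jump in \<open>E\<close>.
\<close>
lemma predictable_local_martingale_no_jump:
  assumes L: "local_martingale M F T L" and A: "predictable M F T A"
    and eq: "AE \<omega> in M. \<forall>t\<in>{0..T}. L t \<omega> = A t \<omega>" and d: "d > 0"
  shows "AE \<omega> in M. \<forall>t\<in>{0..T}. \<not> has_jump d (\<lambda>t. L t \<omega>) t"
proof -
  let ?P = "predictable_algebra M F T"
  note Lad = local_martingaleD(1)[OF L] and Lcad = local_martingaleD(2)[OF L]
  obtain \<tau> where \<tau>: "localizing_sequence M F T \<tau>"
    "\<And>n. martingale M F T (\<lambda>t \<omega>. L (min t (\<tau> n \<omega>)) \<omega> - L 0 \<omega>)"
    using L unfolding local_martingale_def by blast
  obtain N where N: "N \<in> null_sets M" "\<And>\<omega>. \<omega> \<in> space M - N \<Longrightarrow> \<forall>t\<in>{0..T}. L t \<omega> = A t \<omega>"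
    using AE_E3[OF eq] by blast
  define \<sigma> where "\<sigma> \<omega> = first_jump T d (\<lambda>t. L t \<omega>)" for \<omega>
  have \<sigma>: "\<sigma> \<in> borel_measurable M" "\<sigma> \<omega> \<in> {0..T}" for \<omega>
    using first_jump_measurable[OF Lad Lcad d] first_jump_range T_pos by (simp_all add: \<sigma>_def[abs_def])
  define E where "E = {z\<in>space ?P. d \<le> (\<lambda>(\<omega>, t). A t \<omega>) z - lim (\<lambda>k. left_step L k z)}
    \<inter> ((space M - N) \<times> {0<..T})"
  have E: "E \<in> sets ?P"
    unfolding E_def
  proof (rule sets.Int)
    have [measurable]: "(\<lambda>(\<omega>, t). A t \<omega>) \<in> borel_measurable ?P" "left_step L k \<in> borel_measurable ?P" for k
      using A left_step_measurable[OF Lad] by (simp_all add: predictable_def)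
    have [measurable]: "(\<lambda>z. lim (\<lambda>k. left_step L k z)) \<in> borel_measurable ?P"
      by (rule borel_measurable_lim_metric) measurable
    show "{z\<in>space ?P. d \<le> (\<lambda>(\<omega>, t). A t \<omega>) z - lim (\<lambda>k. left_step L k z)} \<in> sets ?P"
      by measurable
    have "space M - N \<in> sets (F 0)"
      using null_in_F[OF N(1), of 0] sets.top[of "F 0"] space_F[of 0] T_pos by auto
    thus "(space M - N) \<times> {0<..T} \<in> sets ?P"
      by (intro predictable_rectangle) (use T_pos in auto)
  qed
  have E_iff: "(\<omega>, t) \<in> E \<longleftrightarrow> has_jump d (\<lambda>t. L t \<omega>) t"
    if \<omega>: "\<omega> \<in> space M - N" and t: "t \<in> {0<..T}" for \<omega> t
  proof -
    have "cadlag_path T (\<lambda>t. L t \<omega>)" using Lcad \<omega> by (simp add: cadlag_def)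
    then obtain l where l: "((\<lambda>t. L t \<omega>) \<longlongrightarrow> l) (at_left t)" using t unfolding cadlag_path_def by blast
    have "lim (\<lambda>k. left_step L k (\<omega>, t)) = l" by (rule limI[OF left_step_tendsto[where X=L and \<omega>=\<omega>, OF t l]])
    moreover have "A t \<omega> = L t \<omega>" using N(2)[OF \<omega>] t by simp
    moreover have "has_jump d (\<lambda>t. L t \<omega>) t \<longleftrightarrow> l + d \<le> L t \<omega>"
    proof
      assume "has_jump d (\<lambda>t. L t \<omega>) t"
      then obtain l' where l': "((\<lambda>t. L t \<omega>) \<longlongrightarrow> l') (at_left t)" "l' + d \<le> L t \<omega>"
        unfolding has_jump_def by blast
      have "l' = l" by (rule tendsto_unique[OF _ l'(1) l]) simp
      thus "l + d \<le> L t \<omega>" using l'(2) by simp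
    next
      assume "l + d \<le> L t \<omega>"
      moreover have "0 < t" using t by simp
      ultimately show "has_jump d (\<lambda>t. L t \<omega>) t" using l unfolding has_jump_def by blast
    qed
    moreover have "(\<omega>, t) \<in> E \<longleftrightarrow> d \<le> A t \<omega> - lim (\<lambda>k. left_step L k (\<omega>, t))"
      using \<omega> t unfolding E_def space_predictable_algebra by simp
    ultimately show ?thesis by linarith
  qed
  \<comment> \<open>Before \<open>\<tau> n\<close> the path of the localized martingale has the same jumps as that of \<open>L\<close>.\<close>
  have "AE \<omega> in M. \<not> ((\<omega>, \<sigma> \<omega>) \<in> E \<and> \<sigma> \<omega> \<le> \<tau> n \<omega>)" for n
  proof -
    note \<tau>n = localizing_sequenceD(1,2)[OF \<tau>(1), of n]
    let ?E = "E \<inter> {(\<omega>, t). \<omega> \<in> space M \<and> t \<in> {0..T} \<and> t \<le> \<tau> n \<omega>}"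
    have En: "?E \<in> sets ?P" by (intro sets.Int E predictable_until_stopping[OF \<tau>n])
    have "prob {\<omega>\<in>space M. (\<omega>, \<sigma> \<omega>) \<in> ?E} = 0"
    proof (rule martingale_no_predictable_jump[OF \<tau>(2) cadlag_stopped[OF Lcad] d \<sigma> En])
      fix \<omega> t assume "(\<omega>, t) \<in> ?E"
      hence e: "(\<omega>, t) \<in> E" "t \<le> \<tau> n \<omega>" by auto
      hence \<omega>: "\<omega> \<in> space M - N" "t \<in> {0<..T}" by (auto simp: E_def)
      with e have "has_jump d (\<lambda>t. L t \<omega>) t" using E_iff by blast
      then obtain l where l: "0 < t" "((\<lambda>t. L t \<omega>) \<longlongrightarrow> l) (at_left t)" "l + d \<le> L t \<omega>"
        by (auto simp: has_jump_def)
      have "((\<lambda>s. L s \<omega> - L 0 \<omega>) \<longlongrightarrow> l - L 0 \<omega>) (at_left t)" by (intro tendsto_intros l)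
      moreover have "\<forall>\<^sub>F s in at_left t. L s \<omega> - L 0 \<omega> = L (min s (\<tau> n \<omega>)) \<omega> - L 0 \<omega>"
        using e(2) by (auto simp: eventually_at_filter min_def)
      ultimately have "((\<lambda>s. L (min s (\<tau> n \<omega>)) \<omega> - L 0 \<omega>) \<longlongrightarrow> l - L 0 \<omega>) (at_left t)"
        by (rule Lim_transform_eventually)
      thus "has_jump d (\<lambda>s. L (min s (\<tau> n \<omega>)) \<omega> - L 0 \<omega>) t"
        using l e(2) unfolding has_jump_def by (intro conjI exI[of _ "l - L 0 \<omega>"]) (auto simp: min_def)
    qed
    hence "AE \<omega> in M. \<not> (\<omega>, \<sigma> \<omega>) \<in> ?E"
      by (subst (asm) prob_eq_0[OF graph_measurable[OF \<sigma> En]]) auto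
    thus ?thesis
      using AE_space
    proof eventually_elim
      case (elim \<omega>)
      thus ?case using \<sigma>(2)[of \<omega>] by auto
    qed
  qed
  hence "AE \<omega> in M. \<forall>n. \<not> ((\<omega>, \<sigma> \<omega>) \<in> E \<and> \<sigma> \<omega> \<le> \<tau> n \<omega>)"
    unfolding AE_all_countable by blast
  thus ?thesis
    using localizing_sequenceD(3)[OF \<tau>(1)] AE_not_in[OF N(1)] AE_space
  proof eventually_elim
    case (elim \<omega>)
    then obtain n where n: "\<tau> n \<omega> = T" by blast
    hence notE: "(\<omega>, \<sigma> \<omega>) \<notin> E" using elim(1) \<sigma>(2)[of \<omega>] by auto
    have path: "cadlag_path T (\<lambda>t. L t \<omega>)" using Lcad elim by (simp add: cadlag_def)
    show ?case
    proof (intro ballI notI)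
      fix t assume t: "t \<in> {0..T}" "has_jump d (\<lambda>t. L t \<omega>) t"
      have J: "has_jump d (\<lambda>t. L t \<omega>) (\<sigma> \<omega>)"
        unfolding \<sigma>_def by (rule first_jump_attained(1)[OF path d t])
      hence "\<sigma> \<omega> \<in> {0<..T}" using \<sigma>(2)[of \<omega>] by (auto simp: has_jump_def)
      thus False using E_iff[of \<omega> "\<sigma> \<omega>"] J notE elim by blast
    qed
  qed
qed

theorem predictable_local_martingale_continuous:
  assumes L: "local_martingale M F T L" and A: "predictable M F T A"
    and eq: "AE \<omega> in M. \<forall>t\<in>{0..T}. L t \<omega> = A t \<omega>"
  shows "AE \<omega> in M. continuous_on {0..T} (\<lambda>t. L t \<omega>)"
proof -
  have mL: "local_martingale M F T (\<lambda>t \<omega>. - L t \<omega>)"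
    using local_martingale_diff[OF local_martingale_diff[OF L L] L] by simp
  have mA: "predictable M F T (\<lambda>t \<omega>. - A t \<omega>)"
    using borel_measurable_uminus[OF A[unfolded predictable_def]] by (simp add: predictable_def case_prod_beta)
  have meq: "AE \<omega> in M. \<forall>t\<in>{0..T}. - L t \<omega> = - A t \<omega>" using eq by simp
  have "AE \<omega> in M. \<forall>n. \<forall>t\<in>{0..T}. \<not> has_jump (1 / real (Suc n)) (\<lambda>t. L t \<omega>) t"
    by (subst AE_all_countable, intro allI predictable_local_martingale_no_jump[OF L A eq]) simp
  moreover have "AE \<omega> in M. \<forall>n. \<forall>t\<in>{0..T}. \<not> has_jump (1 / real (Suc n)) (\<lambda>t. - L t \<omega>) t"
    by (subst AE_all_countable, intro allI predictable_local_martingale_no_jump[OF mL mA meq]) simp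
  ultimately show ?thesis
    using AE_space
  proof eventually_elim
    case (elim \<omega>)
    have "cadlag_path T (\<lambda>t. L t \<omega>)" using local_martingaleD(2)[OF L] elim(3) by (simp add: cadlag_def)
    thus ?case using elim(1,2) by (intro continuous_if_no_jumps[OF T_pos]) blast+
  qed
qed

end

section \<open>Bounded continuous martingales of vanishing quadratic variation\<close>

lemma set_integral_Ioc_eq_integral:
  fixes h :: "real \<Rightarrow> real"
  assumes h: "continuous_on {a..b} h" and "a \<le> b"
  shows "set_integrable lborel {a<..b} h" "(LINT s:{a<..b}|lborel. h s) = integral {a..b} h"
proof -
  have int: "set_integrable lborel {a..b} h" by (rule borel_integrable_atLeastAtMost') fact
  show "set_integrable lborel {a<..b} h" by (rule set_integrable_subset[OF int]) auto
  have "(LINT s:{a<..b}|lborel. h s) = (LBINT s=a..b. h s)"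
    by (rule interval_integral_Ioc[symmetric]) fact
  also have "\<dots> = integral {a..b} h"
    by (rule interval_integral_eq_integral[OF \<open>a \<le> b\<close> int])
  finally show "(LINT s:{a<..b}|lborel. h s) = integral {a..b} h" .
qed

text \<open>
  The integrals of \<open>h (s + e)\<close> and \<open>h s\<close> cancel except on the two end intervals of length \<open>e\<close>.
\<close>
lemma integral_increment_eventually_const:
  fixes h :: "real \<Rightarrow> real"
  assumes h: "continuous_on UNIV h" and const: "\<And>s. T \<le> s \<Longrightarrow> h s = c" and e: "0 < e" "e \<le> T"
  shows "(LINT s:{0<..T}|lborel. h (s + e) - h s) = e * c - (LINT s:{0<..e}|lborel. h s)"
proof -
  have cont: "continuous_on S h" for S using h by (rule continuous_on_subset) simp
  have int: "h integrable_on {a..b}" for a b by (rule integrable_continuous_real[OF cont])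
  have cont': "continuous_on S (\<lambda>s. h (s + e))" for S
    by (rule continuous_on_compose2[OF h]) (auto intro!: continuous_intros)
  have "(LINT s:{0<..T}|lborel. h (s + e) - h s) = integral {0..T} (\<lambda>s. h (s + e) - h s)"
    using e by (intro set_integral_Ioc_eq_integral continuous_intros cont cont') auto
  also have "\<dots> = integral {0..T} (\<lambda>s. h (s + e)) - integral {0..T} h"
    by (intro integral_diff integrable_continuous_real cont cont')
  also have "integral {0..T} (\<lambda>s. h (s + e)) = integral {0 + e..T + e} h"
    using integral_shift[OF cont, where a=0 and b=T and c=e] by (simp add: o_def)
  also have "\<dots> = integral {e..T} h + integral {T..T + e} h"
    using e Henstock_Kurzweil_Integration.integral_combine[of e T "T + e" h] int by simp
  also have "integral {T..T + e} h = integral {T..T + e} (\<lambda>_. c)"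
    by (intro Henstock_Kurzweil_Integration.integral_cong) (auto intro: const)
  also have "\<dots> = e * c" using e by simp
  also have "integral {0..T} h = integral {0..e} h + integral {e..T} h"
    using e Henstock_Kurzweil_Integration.integral_combine[of 0 e T h] int by simp
  also have "integral {0..e} h = (LINT s:{0<..e}|lborel. h s)"
    using e by (intro set_integral_Ioc_eq_integral(2)[symmetric] cont) auto
  finally show ?thesis by simp
qed

lemma (in usual_filtered_prob_space) martingale_increment_orthogonal:
  assumes X: "martingale M F T X" and st: "s \<in> {0..T}" "t \<in> {0..T}" "s \<le> t"
    and Z: "Z \<in> borel_measurable (F s)" "\<And>\<omega>. \<omega> \<in> space M \<Longrightarrow> \<bar>Z \<omega>\<bar> \<le> C"
  shows "expectation (\<lambda>\<omega>. Z \<omega> * (X t \<omega> - X s \<omega>)) = 0"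
proof -
  have sub: "subalgebra M (F s)" by (rule subalgebra_F[OF st(1)])
  interpret sub: sigma_finite_subalgebra M "F s"
    by (intro finite_measure_subalgebra_is_sigma_finite finite_measure_subalgebra.intro
        finite_measure_subalgebra_axioms.intro sub) unfold_locales
  have ZM [measurable]: "Z \<in> borel_measurable M" by (rule measurable_F_M[OF st(1) Z(1)])
  have int: "integrable M (\<lambda>\<omega>. Z \<omega> * X u \<omega>)" if u: "u \<in> {0..T}" for u
  proof (rule Bochner_Integration.integrable_bound)
    show "integrable M (\<lambda>\<omega>. C * X u \<omega>)" using martingale_integrable[OF X u] by simp
    show "(\<lambda>\<omega>. Z \<omega> * X u \<omega>) \<in> borel_measurable M"
      using martingale_integrable[OF X u] by measurable
    show "AE \<omega> in M. norm (Z \<omega> * X u \<omega>) \<le> norm (C * X u \<omega>)"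
      using Z(2) by (intro AE_I2) (force simp: abs_mult intro!: mult_right_mono)
  qed
  have "expectation (\<lambda>\<omega>. Z \<omega> * X t \<omega>) = expectation (\<lambda>\<omega>. Z \<omega> * real_cond_exp M (F s) (X t) \<omega>)"
    using martingale_integrable[OF X st(2)] by (intro sub.real_cond_exp_intg(2)[symmetric] int[OF st(2)] Z(1)) auto
  also have "\<dots> = expectation (\<lambda>\<omega>. Z \<omega> * X s \<omega>)"
  proof (rule integral_cong_AE)
    have "AE \<omega> in M. real_cond_exp M (F s) (X t) \<omega> = X s \<omega>"
      using X st unfolding martingale_def by simp
    thus "AE \<omega> in M. Z \<omega> * real_cond_exp M (F s) (X t) \<omega> = Z \<omega> * X s \<omega>" by eventually_elim simp
    show "(\<lambda>\<omega>. Z \<omega> * X s \<omega>) \<in> borel_measurable M"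
      using martingale_integrable[OF X st(1)] by measurable
  qed measurable
  finally show ?thesis
    using int st by (simp add: right_diff_distrib)
qed

locale bounded_continuous_martingale = usual_filtered_prob_space +
  fixes N :: "real \<Rightarrow> 'a \<Rightarrow> real" and K :: real
  assumes martingale_N: "martingale M F T N"
    and continuous_N: "\<And>\<omega>. \<omega> \<in> space M \<Longrightarrow> continuous_on {0..T} (\<lambda>t. N t \<omega>)"
    and bound_N: "\<And>t \<omega>. t \<in> {0..T} \<Longrightarrow> \<omega> \<in> space M \<Longrightarrow> \<bar>N t \<omega>\<bar> \<le> K"
    and zero_N: "\<And>\<omega>. \<omega> \<in> space M \<Longrightarrow> N 0 \<omega> = 0"
begin

text \<open>
  Paths are continued as constants on both sides, so that increments reaching beyond \<open>T\<close> are those of the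
  process stopped at \<open>T\<close>.
\<close>
definition ext :: "real \<Rightarrow> 'a \<Rightarrow> real" where
  "ext s \<omega> = N (max 0 (min s T)) \<omega>"

definition incr :: "real \<Rightarrow> real \<Rightarrow> 'a \<Rightarrow> real" where
  "incr e s \<omega> = ext (s + e) \<omega> - ext s \<omega>"

text \<open>
  Divided by \<open>e\<close> and integrated over time, gains form a regularization of the stochastic integral of \<open>N\<close> with
  respect to itself.
\<close>
definition gain :: "real \<Rightarrow> real \<Rightarrow> 'a \<Rightarrow> real" where
  "gain e s \<omega> = ext s \<omega> * incr e s \<omega>"

definition time :: "real measure" where
  "time = restrict_space lborel {0<..T}"

text \<open>
  This is \<open>e\<close> times the regularized quadratic variation at \<open>T\<close>.
\<close>
definition quad :: "real \<Rightarrow> 'a \<Rightarrow> real" where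
  "quad e \<omega> = (\<integral>s. (incr e s \<omega>)\<^sup>2 \<partial>time)"

definition gains :: "real \<Rightarrow> 'a \<Rightarrow> real" where
  "gains e \<omega> = (\<integral>s. gain e s \<omega> \<partial>time)"

text \<open>
  The boundary term at time \<open>0\<close> that remains when integrated differences of \<open>N\<^sup>2\<close> telescope.
\<close>
definition start :: "real \<Rightarrow> 'a \<Rightarrow> real" where
  "start e \<omega> = (LINT s:{0<..e}|lborel. (ext s \<omega>)\<^sup>2)"

lemma clamp_range: "max 0 (min s T) \<in> {0..T}"
  using T_pos by auto

lemma K_nonneg: "0 \<le> K"
proof -
  obtain \<omega> where \<omega>: "\<omega> \<in> space M" using not_empty by blast
  have "\<bar>N 0 \<omega>\<bar> \<le> K" using T_pos by (intro bound_N \<omega>) auto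
  thus ?thesis by linarith
qed

lemma integral_time: "(\<integral>s. f s \<partial>time) = (LINT s:{0<..T}|lborel. f s)" for f :: "real \<Rightarrow> real"
  unfolding time_def set_lebesgue_integral_def by (subst integral_restrict_space) auto

lemma space_time: "space time = {0<..T}"
  by (simp add: time_def space_restrict_space)

lemma measurable_time: "f \<in> borel_measurable borel \<Longrightarrow> f \<in> borel_measurable time" for f :: "real \<Rightarrow> real"
  unfolding time_def by (intro measurable_restrict_space1) simp

lemma finite_measure_time: "finite_measure time"
proof
  have "emeasure time (space time) = emeasure lborel {0<..T}"
    unfolding space_time by (simp add: time_def emeasure_restrict_space)
  thus "emeasure time (space time) \<noteq> \<infinity>" using T_pos by simp
qed

lemma measure_time_ball: "measure time {u\<in>space time. \<bar>s - u\<bar> < e} \<le> 2 * e" if "e > 0"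
proof -
  have "measure time {u\<in>space time. \<bar>s - u\<bar> < e} = measure lborel {u\<in>{0<..T}. \<bar>s - u\<bar> < e}"
    unfolding space_time unfolding time_def by (rule measure_restrict_space) auto
  also have "\<dots> \<le> measure lborel {s - e<..<s + e}"
  proof (rule measure_mono_fmeasurable)
    show "{s - e<..<s + e} \<in> fmeasurable lborel"
      using that emeasure_lborel_Ioo[of "s - e" "s + e"] by (simp add: fmeasurable_def)
  qed (use that in auto)
  also have "\<dots> = 2 * e" using that by simp
  finally show ?thesis .
qed

lemma ext_bound: "\<omega> \<in> space M \<Longrightarrow> \<bar>ext s \<omega>\<bar> \<le> K"
  unfolding ext_def by (rule bound_N[OF clamp_range])

lemma incr_bound: "\<omega> \<in> space M \<Longrightarrow> \<bar>incr e s \<omega>\<bar> \<le> 2 * K"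
  unfolding incr_def using ext_bound[of \<omega> "s + e"] ext_bound[of \<omega> s] by linarith

lemma gain_bound: "\<omega> \<in> space M \<Longrightarrow> \<bar>gain e s \<omega>\<bar> \<le> K * (2 * K)"
  unfolding gain_def abs_mult by (intro mult_mono ext_bound incr_bound) (use K_nonneg in auto)

lemma incr_sq_bound: "\<omega> \<in> space M \<Longrightarrow> \<bar>(incr e s \<omega>)\<^sup>2\<bar> \<le> (2 * K)\<^sup>2"
  using incr_bound[of \<omega> e s] abs_le_square_iff[of "incr e s \<omega>" "2 * K"] K_nonneg by simp

lemma ext_continuous: "\<omega> \<in> space M \<Longrightarrow> continuous_on UNIV (\<lambda>s. ext s \<omega>)"
  unfolding ext_def
  by (rule continuous_on_compose2[OF continuous_N]) (use T_pos in \<open>auto intro!: continuous_intros\<close>)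

lemma ext_measurable_F: "s \<le> t \<Longrightarrow> t \<in> {0..T} \<Longrightarrow> ext s \<in> borel_measurable (F t)"
  unfolding ext_def[abs_def]
  by (rule adapted_mono_measurable[OF martingale_adapted[OF martingale_N] clamp_range]) (use T_pos in auto)

lemma ext_measurable_product: "(\<lambda>z. ext (f (snd z)) (fst z)) \<in> borel_measurable (M \<Otimes>\<^sub>M time)"
  if f: "f \<in> borel_measurable borel"
  unfolding ext_def
proof (rule measurable_at_random_time[where X="\<lambda>t z. N t (fst z)", OF _ _ order_refl])
  show "(\<lambda>z. N s (fst z)) \<in> borel_measurable (M \<Otimes>\<^sub>M time)" if "s \<in> {0..T}" for s
    using adapted_measurable[OF martingale_adapted[OF martingale_N] that] by measurable
  show "cadlag_path T (\<lambda>t. N t (fst z))" if "z \<in> space (M \<Otimes>\<^sub>M time)" for z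
    using that by (intro continuous_cadlag_path continuous_N) (auto simp: space_pair_measure)
  have "(\<lambda>s. max 0 (min (f s) T)) \<in> borel_measurable time" 
    by (intro measurable_time borel_measurable_max borel_measurable_min borel_measurable_const f)
  thus "(\<lambda>z. max 0 (min (f (snd z)) T)) \<in> borel_measurable (M \<Otimes>\<^sub>M time)" by measurable
  show "max 0 (min (f (snd z)) T) \<in> {0..T}" for z by (rule clamp_range)
qed

lemma measurable_product [measurable]:
  "(\<lambda>z. incr e (snd z) (fst z)) \<in> borel_measurable (M \<Otimes>\<^sub>M time)"
  "(\<lambda>z. gain e (snd z) (fst z)) \<in> borel_measurable (M \<Otimes>\<^sub>M time)"
proof -
  have [measurable]: "(\<lambda>z. ext (snd z + e) (fst z)) \<in> borel_measurable (M \<Otimes>\<^sub>M time)"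
    "(\<lambda>z. ext (snd z) (fst z)) \<in> borel_measurable (M \<Otimes>\<^sub>M time)"
    using ext_measurable_product[of "\<lambda>s. s + e"] ext_measurable_product[of "\<lambda>s. s"] by simp_all
  show "(\<lambda>z. incr e (snd z) (fst z)) \<in> borel_measurable (M \<Otimes>\<^sub>M time)"
    "(\<lambda>z. gain e (snd z) (fst z)) \<in> borel_measurable (M \<Otimes>\<^sub>M time)"
    unfolding gain_def incr_def by measurable
qed

lemma bounded_Fubini:
  assumes f: "(\<lambda>z. f (snd z) (fst z)) \<in> borel_measurable (M \<Otimes>\<^sub>M time)"
    and C: "\<And>s \<omega>. \<omega> \<in> space M \<Longrightarrow> \<bar>f s \<omega>\<bar> \<le> (C::real)"
  shows "expectation (\<lambda>\<omega>. \<integral>s. f s \<omega> \<partial>time) = (\<integral>s. expectation (f s) \<partial>time)"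
    and "integrable time (\<lambda>s. expectation (f s))"
    and "integrable M (\<lambda>\<omega>. \<integral>s. f s \<omega> \<partial>time)"
    and "\<omega> \<in> space M \<Longrightarrow> integrable time (\<lambda>s. f s \<omega>)"
    and "s \<in> space time \<Longrightarrow> integrable M (f s)"
proof -
  interpret time: finite_measure time by (rule finite_measure_time)
  interpret P: pair_sigma_finite M time ..
  interpret PF: finite_measure "M \<Otimes>\<^sub>M time" by (rule finite_measure_pair_measure) unfold_locales
  have int: "integrable (M \<Otimes>\<^sub>M time) (\<lambda>z. f (snd z) (fst z))"
    by (rule PF.integrable_const_bound[where B=C, OF AE_I2 f]) (use C in \<open>auto simp: space_pair_measure\<close>)
  hence int': "integrable (M \<Otimes>\<^sub>M time) (\<lambda>(\<omega>, s). f s \<omega>)" unfolding case_prod_beta' .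
  show "expectation (\<lambda>\<omega>. \<integral>s. f s \<omega> \<partial>time) = (\<integral>s. expectation (f s) \<partial>time)"
    by (rule P.Fubini_integral[OF int', symmetric])
  show "integrable time (\<lambda>s. expectation (f s))" by (rule P.integrable_snd[OF int'])
  show "integrable M (\<lambda>\<omega>. \<integral>s. f s \<omega> \<partial>time)" by (rule P.integrable_fst[OF int'])
  show "integrable time (\<lambda>s. f s \<omega>)" if \<omega>: "\<omega> \<in> space M"
  proof (rule time.integrable_const_bound[where B=C])
    show "(\<lambda>s. f s \<omega>) \<in> borel_measurable time"
      using measurable_compose[OF measurable_Pair1'[OF \<omega>] f] by simp
  qed (use C \<omega> in auto)
  show "integrable M (f s)" if s: "s \<in> space time"
  proof (rule integrable_const_bound[where B=C])
    show "f s \<in> borel_measurable M"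
      using measurable_compose[OF measurable_Pair2'[OF s] f] by simp
  qed (use C in auto)
qed

text \<open>
  Integrate \<open>(b - a)\<^sup>2 + 2 a (b - a) = b\<^sup>2 - a\<^sup>2\<close> over all increments; the right-hand side telescopes.
\<close>
lemma pathwise_identity:
  assumes e: "0 < e" "e \<le> T" and \<omega>: "\<omega> \<in> space M"
  shows "quad e \<omega> + 2 * gains e \<omega> = e * (N T \<omega>)\<^sup>2 - start e \<omega>"
proof -
  have int: "integrable time (\<lambda>s. (incr e s \<omega>)\<^sup>2)" "integrable time (\<lambda>s. gain e s \<omega>)"
    by (rule bounded_Fubini(4)[OF _ incr_sq_bound \<omega>], measurable)
       (rule bounded_Fubini(4)[OF _ gain_bound \<omega>], measurable)
  have "quad e \<omega> + 2 * gains e \<omega> = (\<integral>s. (incr e s \<omega>)\<^sup>2 + 2 * gain e s \<omega> \<partial>time)"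
    unfolding quad_def gains_def using int by simp
  also have "\<dots> = (\<integral>s. (ext (s + e) \<omega>)\<^sup>2 - (ext s \<omega>)\<^sup>2 \<partial>time)"
    by (simp add: gain_def incr_def power2_eq_square algebra_simps)
  also have "\<dots> = (LINT s:{0<..T}|lborel. (ext (s + e) \<omega>)\<^sup>2 - (ext s \<omega>)\<^sup>2)" by (rule integral_time)
  also have "\<dots> = e * (N T \<omega>)\<^sup>2 - start e \<omega>"
    unfolding start_def
  proof (rule integral_increment_eventually_const[where h="\<lambda>s. (ext s \<omega>)\<^sup>2", OF _ _ e])
    show "continuous_on UNIV (\<lambda>s. (ext s \<omega>)\<^sup>2)" by (intro continuous_intros ext_continuous \<omega>)
    show "(ext s \<omega>)\<^sup>2 = (N T \<omega>)\<^sup>2" if "T \<le> s" for s using that T_pos by (simp add: ext_def)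
  qed
  finally show ?thesis .
qed

lemma expectation_gain_zero:
  assumes e: "0 < e" and s: "s \<in> {0<..T}"
  shows "expectation (gain e s) = 0"
proof -
  have *: "s \<in> {0..T}" "min (s + e) T \<in> {0..T}" "s \<le> min (s + e) T" using e s by auto
  have "expectation (\<lambda>\<omega>. N s \<omega> * (N (min (s + e) T) \<omega> - N s \<omega>)) = 0"
    by (rule martingale_increment_orthogonal[OF martingale_N * _ bound_N[OF *(1)]])
       (use martingale_adapted[OF martingale_N] *(1) in \<open>simp_all add: adapted_def\<close>)
  moreover have "gain e s = (\<lambda>\<omega>. N s \<omega> * (N (min (s + e) T) \<omega> - N s \<omega>))"
    using e s T_pos by (intro ext) (simp add: gain_def incr_def ext_def)
  ultimately show ?thesis by simp
qed

lemma expectation_gains_zero: "0 < e \<Longrightarrow> expectation (gains e) = 0"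
proof -
  assume e: "0 < e"
  have "expectation (gains e) = (\<integral>s. expectation (gain e s) \<partial>time)"
    unfolding gains_def[abs_def] by (rule bounded_Fubini(1)[OF _ gain_bound]) measurable
  also have "\<dots> = (\<integral>s. 0 \<partial>time)"
    by (rule Bochner_Integration.integral_cong) (auto simp: space_time intro: expectation_gain_zero[OF e])
  finally show ?thesis by simp
qed

text \<open>
  Both the gain from \<open>s\<close> to \<open>s + e\<close> and the factor \<open>N\<close> at \<open>u\<close> are known at time \<open>u\<close>, when the second increment
  starts.
\<close>
lemma expectation_gain_separated:
  assumes e: "0 < e" and su: "s \<in> {0<..T}" "u \<in> {0<..T}" "s + e \<le> u"
  shows "expectation (\<lambda>\<omega>. gain e s \<omega> * gain e u \<omega>) = 0"
proof -
  have *: "u \<in> {0..T}" "min (u + e) T \<in> {0..T}" "u \<le> min (u + e) T" using e su by auto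
  have [measurable]: "ext s \<in> borel_measurable (F u)" "ext (s + e) \<in> borel_measurable (F u)" "ext u \<in> borel_measurable (F u)"
    using ext_measurable_F[OF _ *(1)] su e by auto
  have m: "(\<lambda>\<omega>. gain e s \<omega> * ext u \<omega>) \<in> borel_measurable (F u)"
    unfolding gain_def incr_def by measurable
  have b: "\<bar>gain e s \<omega> * ext u \<omega>\<bar> \<le> K * (2 * K) * K" if "\<omega> \<in> space M" for \<omega>
    unfolding abs_mult[of "gain e s \<omega>"] by (intro mult_mono gain_bound ext_bound that) (use K_nonneg in auto)
  have "expectation (\<lambda>\<omega>. (gain e s \<omega> * ext u \<omega>) * (N (min (u + e) T) \<omega> - N u \<omega>)) = 0"
    by (rule martingale_increment_orthogonal[OF martingale_N * m b])
  moreover have "gain e u \<omega> = ext u \<omega> * (N (min (u + e) T) \<omega> - N u \<omega>)" for \<omega>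
    using e su T_pos by (simp add: gain_def incr_def ext_def)
  ultimately show ?thesis by (simp add: mult.assoc)
qed

text \<open>
  Only pairs of times in the strip \<open>\<bar>s - u\<bar> < e\<close> around the diagonal contribute; there
  \<open>2 a b \<le> a\<^sup>2 + b\<^sup>2\<close> leads back to second moments of increments.
\<close>
lemma gain_product_bound:
  assumes e: "0 < e" and su: "s \<in> {0<..T}" "u \<in> {0<..T}"
  shows "expectation (\<lambda>\<omega>. gain e s \<omega> * gain e u \<omega>)
    \<le> indicator {u. \<bar>s - u\<bar> < e} u * (K\<^sup>2 / 2 * (expectation (\<lambda>\<omega>. (incr e s \<omega>)\<^sup>2) + expectation (\<lambda>\<omega>. (incr e u \<omega>)\<^sup>2)))"
proof (cases "\<bar>s - u\<bar> < e")
  case False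
  then consider "s + e \<le> u" | "u + e \<le> s" by linarith
  thus ?thesis
    using expectation_gain_separated[OF e su] expectation_gain_separated[OF e su(2,1)] False
    by cases (simp_all add: mult.commute)
next
  case True
  have st: "s \<in> space time" "u \<in> space time" using su by (simp_all add: space_time)
  have iI: "integrable M (\<lambda>\<omega>. (incr e v \<omega>)\<^sup>2)" if "v \<in> space time" for v
    by (rule bounded_Fubini(5)[OF _ incr_sq_bound that]) measurable
  have ig: "integrable M (gain e v)" if "v \<in> space time" for v
    by (rule bounded_Fubini(5)[OF _ gain_bound that]) measurable
  have "expectation (\<lambda>\<omega>. gain e s \<omega> * gain e u \<omega>)
      \<le> expectation (\<lambda>\<omega>. K\<^sup>2 / 2 * ((incr e s \<omega>)\<^sup>2 + (incr e u \<omega>)\<^sup>2))"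
  proof (rule integral_mono)
    show "integrable M (\<lambda>\<omega>. gain e s \<omega> * gain e u \<omega>)"
    proof (rule integrable_const_bound[where B="(K * (2 * K)) * (K * (2 * K))"])
      show "AE \<omega> in M. norm (gain e s \<omega> * gain e u \<omega>) \<le> (K * (2 * K)) * (K * (2 * K))"
        unfolding real_norm_def abs_mult[of "gain e s _"]
        by (intro AE_I2 mult_mono gain_bound) (use K_nonneg in auto)
    qed (use ig st in measurable)
    show "integrable M (\<lambda>\<omega>. K\<^sup>2 / 2 * ((incr e s \<omega>)\<^sup>2 + (incr e u \<omega>)\<^sup>2))" using iI st by simp
    fix \<omega> assume \<omega>: "\<omega> \<in> space M"
    have "gain e s \<omega> * gain e u \<omega> \<le> \<bar>ext s \<omega> * ext u \<omega>\<bar> * \<bar>incr e s \<omega> * incr e u \<omega>\<bar>"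
      unfolding gain_def abs_mult[symmetric] by (simp add: mult_ac)
    also have "\<dots> \<le> K\<^sup>2 * (((incr e s \<omega>)\<^sup>2 + (incr e u \<omega>)\<^sup>2) / 2)"
    proof (rule mult_mono)
      show "\<bar>ext s \<omega> * ext u \<omega>\<bar> \<le> K\<^sup>2"
        unfolding abs_mult power2_eq_square by (intro mult_mono ext_bound \<omega>) (use K_nonneg in auto)
      have "0 \<le> (\<bar>incr e s \<omega>\<bar> - \<bar>incr e u \<omega>\<bar>)\<^sup>2" by simp
      thus "\<bar>incr e s \<omega> * incr e u \<omega>\<bar> \<le> ((incr e s \<omega>)\<^sup>2 + (incr e u \<omega>)\<^sup>2) / 2"
        by (simp add: power2_diff abs_mult field_simps)
    qed auto
    finally show "gain e s \<omega> * gain e u \<omega> \<le> K\<^sup>2 / 2 * ((incr e s \<omega>)\<^sup>2 + (incr e u \<omega>)\<^sup>2)" by simp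
  qed
  also have "\<dots> = K\<^sup>2 / 2 * (expectation (\<lambda>\<omega>. (incr e s \<omega>)\<^sup>2) + expectation (\<lambda>\<omega>. (incr e u \<omega>)\<^sup>2))"
    using iI st by simp
  finally show ?thesis using True by simp
qed

lemma incr_sq_integrable: "s \<in> space time \<Longrightarrow> integrable M (\<lambda>\<omega>. (incr e s \<omega>)\<^sup>2)"
  by (rule bounded_Fubini(5)[OF _ incr_sq_bound]) measurable

lemma incr_sq_expectation_integrable: "integrable time (\<lambda>s. expectation (\<lambda>\<omega>. (incr e s \<omega>)\<^sup>2))"
  by (rule bounded_Fubini(2)[OF _ incr_sq_bound]) measurable

lemma quad_integrable: "integrable M (quad e)"
  unfolding quad_def[abs_def] by (rule bounded_Fubini(3)[OF _ incr_sq_bound]) measurable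

lemma gains_integrable: "integrable M (gains e)"
  unfolding gains_def[abs_def] by (rule bounded_Fubini(3)[OF _ gain_bound]) measurable

lemma expectation_quad: "expectation (quad e) = (\<integral>s. expectation (\<lambda>\<omega>. (incr e s \<omega>)\<^sup>2) \<partial>time)"
  unfolding quad_def[abs_def] by (rule bounded_Fubini(1)[OF _ incr_sq_bound]) measurable

lemma quad_nonneg: "0 \<le> quad e \<omega>"
  unfolding quad_def by simp

lemma gains_bound: "\<omega> \<in> space M \<Longrightarrow> \<bar>gains e \<omega>\<bar> \<le> K * (2 * K) * measure time (space time)"
proof -
  assume \<omega>: "\<omega> \<in> space M"
  interpret time: finite_measure time by (rule finite_measure_time)
  have "integrable time (\<lambda>s. gain e s \<omega>)"
    by (rule bounded_Fubini(4)[OF _ gain_bound \<omega>]) measurable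
  hence "\<bar>gains e \<omega>\<bar> \<le> (\<integral>s. K * (2 * K) \<partial>time)"
    unfolding gains_def real_norm_def[symmetric]
    by (intro integral_norm_bound[THEN order_trans] integral_mono) (use gain_bound[OF \<omega>] in auto)
  thus ?thesis by (simp add: mult_ac)
qed

lemma start_le:
  assumes e: "0 < e" and \<omega>: "\<omega> \<in> space M" and c: "\<And>s. s \<in> {0<..e} \<Longrightarrow> (ext s \<omega>)\<^sup>2 \<le> c"
  shows "0 \<le> start e \<omega>" "start e \<omega> \<le> e * c"
proof -
  have cont: "continuous_on {0..e} (\<lambda>s. (ext s \<omega>)\<^sup>2)"
    by (intro continuous_intros continuous_on_subset[OF ext_continuous[OF \<omega>]]) simp
  have "start e \<omega> \<le> (LINT s:{0<..e}|lborel. c)"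
    unfolding start_def
    by (intro set_integral_mono set_integral_Ioc_eq_integral(1)[OF cont] c) (use e in \<open>auto simp: set_integrable_def\<close>)
  also have "\<dots> = e * c" using e by (simp add: set_lebesgue_integral_def)
  finally show "start e \<omega> \<le> e * c" .
  show "0 \<le> start e \<omega>" unfolding start_def set_lebesgue_integral_def by (rule Bochner_Integration.integral_nonneg) simp
qed

lemma ext_sq_bound: "\<omega> \<in> space M \<Longrightarrow> (ext s \<omega>)\<^sup>2 \<le> K\<^sup>2"
  using ext_bound[of \<omega> s] abs_le_square_iff[of "ext s \<omega>" K] K_nonneg by simp

lemma start_bounds: "0 < e \<Longrightarrow> \<omega> \<in> space M \<Longrightarrow> 0 \<le> start e \<omega> \<and> start e \<omega> \<le> e * K\<^sup>2"
  using start_le[of e \<omega> "K\<^sup>2", OF _ _ ext_sq_bound] by blast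

lemma NT_sq_bound: "\<omega> \<in> space M \<Longrightarrow> (N T \<omega>)\<^sup>2 \<le> K\<^sup>2"
  using bound_N[of T \<omega>] T_pos abs_le_square_iff[of "N T \<omega>" K] K_nonneg by simp

lemma NT_sq_integrable: "integrable M (\<lambda>\<omega>. (N T \<omega>)\<^sup>2)"
proof (rule integrable_const_bound[where B="K\<^sup>2"])
  have [measurable]: "N T \<in> borel_measurable M"
    using adapted_measurable[OF martingale_adapted[OF martingale_N], of T] T_pos by simp
  show "(\<lambda>\<omega>. (N T \<omega>)\<^sup>2) \<in> borel_measurable M" by measurable
qed (use NT_sq_bound in auto)

lemma start_integrable:
  assumes e: "0 < e" "e \<le> T" shows "integrable M (start e)"
proof -
  have "integrable M (\<lambda>\<omega>. e * (N T \<omega>)\<^sup>2 - (quad e \<omega> + 2 * gains e \<omega>))"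
    using quad_integrable gains_integrable NT_sq_integrable by simp
  moreover have "integrable M (\<lambda>\<omega>. e * (N T \<omega>)\<^sup>2 - (quad e \<omega> + 2 * gains e \<omega>)) \<longleftrightarrow> integrable M (start e)"
    by (rule Bochner_Integration.integrable_cong) (simp_all add: pathwise_identity[OF e])
  ultimately show ?thesis by simp
qed

lemma expectation_identity:
  assumes e: "0 < e" "e \<le> T"
  shows "expectation (quad e) = e * expectation (\<lambda>\<omega>. (N T \<omega>)\<^sup>2) - expectation (start e)"
proof -
  have "expectation (quad e) = expectation (\<lambda>\<omega>. e * (N T \<omega>)\<^sup>2 - start e \<omega> - 2 * gains e \<omega>)"
    by (rule Bochner_Integration.integral_cong) (use pathwise_identity[OF e] in \<open>auto simp: algebra_simps\<close>)
  also have "\<dots> = e * expectation (\<lambda>\<omega>. (N T \<omega>)\<^sup>2) - expectation (start e) - 2 * expectation (gains e)"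
    using NT_sq_integrable start_integrable[OF e] gains_integrable by simp
  finally show ?thesis using expectation_gains_zero[OF e(1)] by simp
qed

text \<open>
  Gains have mean zero in the pathwise identity.
\<close>
lemma expectation_quad_le:
  assumes e: "0 < e" "e \<le> T"
  shows "expectation (quad e) \<le> e * K\<^sup>2"
proof -
  have "expectation (\<lambda>\<omega>. (N T \<omega>)\<^sup>2) \<le> expectation (\<lambda>\<omega>. K\<^sup>2)"
    by (intro integral_mono NT_sq_integrable NT_sq_bound) auto
  hence "e * expectation (\<lambda>\<omega>. (N T \<omega>)\<^sup>2) \<le> e * K\<^sup>2" using e prob_space by (intro mult_left_mono) auto
  moreover have "0 \<le> expectation (start e)"
    by (rule Bochner_Integration.integral_nonneg_AE) (use start_bounds[OF e(1)] in auto)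
  ultimately show ?thesis unfolding expectation_identity[OF e] by linarith
qed

text \<open>
  The square is a double integral over pairs of times. Integrating the bound of \<open>gain_product_bound\<close> over
  the strip yields a factor \<open>2 e\<close>, and the remaining integral of second moments of increments is
  the mean of \<open>quad e\<close>, at most \<open>e K\<^sup>2\<close>. The order \<open>e\<^sup>2\<close> is what makes \<open>gains e / e\<close> bounded in
  \<open>L\<^sup>2\<close>.
\<close>
lemma gains_second_moment:
  assumes e: "0 < e" "e \<le> T"
  shows "expectation (\<lambda>\<omega>. (gains e \<omega>)\<^sup>2) \<le> 2 * e\<^sup>2 * K ^ 4"
proof -
  interpret time: finite_measure time by (rule finite_measure_time)
  interpret TT: pair_sigma_finite time time ..
  interpret TTF: finite_measure "time \<Otimes>\<^sub>M time" by (rule finite_measure_pair_measure) unfold_locales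
  define I where "I s = expectation (\<lambda>\<omega>. (incr e s \<omega>)\<^sup>2)" for s
  define b where "b s u = (indicator {u. \<bar>s - u\<bar> < e} u :: real)" for s u
  have I_int: "integrable time I" unfolding I_def[abs_def] by (rule incr_sq_expectation_integrable)
  have I_meas [measurable]: "I \<in> borel_measurable time" using I_int by simp
  have I_nonneg: "0 \<le> I s" for s unfolding I_def by simp
  have I_total: "(\<integral>s. I s \<partial>time) \<le> e * K\<^sup>2"
    using expectation_quad[of e] expectation_quad_le[OF e] by (simp add: I_def)
  have b01: "0 \<le> b s u" "b s u \<le> 1" for s u by (simp_all add: b_def indicator_def)
  have id_meas [measurable]: "(\<lambda>s. s) \<in> borel_measurable time" by (rule measurable_time) simp
  have b_meas2 [measurable]: "(\<lambda>z. b (fst z) (snd z)) \<in> borel_measurable (time \<Otimes>\<^sub>M time)"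
  proof -
    have "{z\<in>space (time \<Otimes>\<^sub>M time). \<bar>fst z - snd z\<bar> < e} \<in> sets (time \<Otimes>\<^sub>M time)" by measurable
    thus ?thesis unfolding b_def by (simp add: indicator_def)
  qed
  have b_meas [measurable]: "b s \<in> borel_measurable time" for s
  proof -
    have "{u\<in>space time. \<bar>s - u\<bar> < e} \<in> sets time" by measurable
    thus ?thesis unfolding b_def[abs_def] by (simp add: indicator_def)
  qed
  have b_int: "integrable time (b s)" for s
    by (rule time.integrable_const_bound[where B=1]) (use b01 in auto)
  have b_total: "(\<integral>u. b s u \<partial>time) \<le> 2 * e" for s
  proof -
    have "(\<integral>u. b s u \<partial>time) = (\<integral>u. indicator {u\<in>space time. \<bar>s - u\<bar> < e} u \<partial>time)"
      by (rule Bochner_Integration.integral_cong) (auto simp: b_def indicator_def)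
    also have "\<dots> = measure time {u\<in>space time. \<bar>s - u\<bar> < e}" by simp
    finally show ?thesis using measure_time_ball[OF e(1), of s] by simp
  qed
  have bI_int: "integrable time (\<lambda>u. b s u * I u)" for s
    by (rule Bochner_Integration.integrable_bound[OF I_int])
       (use b01 I_nonneg in \<open>auto simp: mult_left_le_one_le\<close>)
  have swap: "integrable (time \<Otimes>\<^sub>M time) (\<lambda>(s, u). b s u * I u)"
  proof (rule TTF.integrable_const_bound[where B="(2 * K)\<^sup>2"])
    show "(\<lambda>(s, u). b s u * I u) \<in> borel_measurable (time \<Otimes>\<^sub>M time)"
      unfolding case_prod_beta' by measurable
    have "I u \<le> (2 * K)\<^sup>2" if "u \<in> space time" for u
    proof -
      have "I u \<le> expectation (\<lambda>_. (2 * K)\<^sup>2)"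
        unfolding I_def using incr_sq_bound by (intro integral_mono incr_sq_integrable[OF that]) auto
      thus ?thesis by (simp add: prob_space)
    qed
    hence "b s u * I u \<le> (2 * K)\<^sup>2" if "u \<in> space time" for s u
      using that b01[of s u] I_nonneg[of u] mult_left_le_one_le[of "I u" "b s u"] by fastforce
    thus "AE z in time \<Otimes>\<^sub>M time. norm (case z of (s, u) \<Rightarrow> b s u * I u) \<le> (2 * K)\<^sup>2"
      using b01 I_nonneg by (intro AE_I2) (auto simp: space_pair_measure)
  qed
  define J where "J s = (\<integral>u. b s u * I u \<partial>time)" for s
  have J_int: "integrable time J" unfolding J_def[abs_def] by (rule TT.integrable_fst[OF swap])
  have "(\<integral>s. J s \<partial>time) = (\<integral>u. (\<integral>s. b s u * I u \<partial>time) \<partial>time)"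
    unfolding J_def by (rule TT.Fubini_integral[OF swap, symmetric])
  also have "\<dots> = (\<integral>u. I u * (\<integral>s. b u s \<partial>time) \<partial>time)"
    by (simp add: b_def indicator_def abs_minus_commute mult.commute)
  also have "\<dots> \<le> (\<integral>u. I u * (2 * e) \<partial>time)"
  proof (rule integral_mono)
    have m: "(\<lambda>u. \<integral>s. b u s \<partial>time) \<in> borel_measurable time"
      using b_meas2 by (intro time.borel_measurable_lebesgue_integral) (simp add: case_prod_beta')
    have nn: "0 \<le> (\<integral>s. b u s \<partial>time)" for u using b01 by simp
    show "integrable time (\<lambda>u. I u * (\<integral>s. b u s \<partial>time))"
    proof (rule Bochner_Integration.integrable_bound)
      show "integrable time (\<lambda>u. I u * (2 * e))" using I_int by simp
      show "AE u in time. norm (I u * (\<integral>s. b u s \<partial>time)) \<le> norm (I u * (2 * e))"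
        using I_nonneg nn b_total e by (intro AE_I2) (auto simp: abs_mult intro!: mult_left_mono)
    qed (use m in measurable)
    show "integrable time (\<lambda>u. I u * (2 * e))" using I_int by simp
    show "I u * (\<integral>s. b u s \<partial>time) \<le> I u * (2 * e)" for u by (intro mult_left_mono b_total I_nonneg)
  qed
  finally have J_total: "(\<integral>s. J s \<partial>time) \<le> 2 * e * (\<integral>s. I s \<partial>time)" using I_int by (simp add: mult_ac)
  \<comment> \<open>Both integrations over time are pulled out of the expectation one after the other.\<close>
  have inner: "expectation (\<lambda>\<omega>. gain e s \<omega> * gains e \<omega>) \<le> K\<^sup>2 / 2 * (2 * e * I s + J s)"
    if s: "s \<in> space time" for s
  proof -
    have gs [measurable]: "gain e s \<in> borel_measurable M"
      using bounded_Fubini(5)[OF measurable_product(2) gain_bound s] by simp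
    have bd: "\<bar>gain e s \<omega> * gain e u \<omega>\<bar> \<le> (K * (2 * K)) * (K * (2 * K))" if "\<omega> \<in> space M" for u \<omega>
      unfolding abs_mult[of "gain e s \<omega>"] by (intro mult_mono gain_bound that) (use K_nonneg in auto)
    have ms: "(\<lambda>z. gain e s (fst z) * gain e (snd z) (fst z)) \<in> borel_measurable (M \<Otimes>\<^sub>M time)" by measurable
    have "expectation (\<lambda>\<omega>. gain e s \<omega> * gains e \<omega>) = expectation (\<lambda>\<omega>. \<integral>u. gain e s \<omega> * gain e u \<omega> \<partial>time)"
      by (simp add: gains_def)
    also have "\<dots> = (\<integral>u. expectation (\<lambda>\<omega>. gain e s \<omega> * gain e u \<omega>) \<partial>time)"
      by (rule bounded_Fubini(1)[OF ms bd])
    also have "\<dots> \<le> (\<integral>u. K\<^sup>2 / 2 * (I s * b s u + b s u * I u) \<partial>time)"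
    proof (rule integral_mono)
      show "integrable time (\<lambda>u. expectation (\<lambda>\<omega>. gain e s \<omega> * gain e u \<omega>))"
        by (rule bounded_Fubini(2)[OF ms bd])
      show "integrable time (\<lambda>u. K\<^sup>2 / 2 * (I s * b s u + b s u * I u))" using b_int bI_int by simp
      show "expectation (\<lambda>\<omega>. gain e s \<omega> * gain e u \<omega>) \<le> K\<^sup>2 / 2 * (I s * b s u + b s u * I u)"
        if "u \<in> space time" for u
        using gain_product_bound[OF e(1), of s u] s that unfolding space_time
        by (simp add: b_def I_def algebra_simps)
    qed
    also have "\<dots> = K\<^sup>2 / 2 * (I s * (\<integral>u. b s u \<partial>time) + J s)"
      using b_int bI_int by (simp add: J_def)
    also have "\<dots> \<le> K\<^sup>2 / 2 * (2 * e * I s + J s)"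
      using mult_left_mono[OF b_total I_nonneg, of s s] by (intro mult_left_mono add_right_mono) (auto simp: mult_ac)
    finally show ?thesis .
  qed
  let ?C = "(K * (2 * K)) * (K * (2 * K) * measure time (space time))"
  have bd: "\<bar>gain e s \<omega> * gains e \<omega>\<bar> \<le> ?C" if "\<omega> \<in> space M" for s \<omega>
    unfolding abs_mult by (intro mult_mono gain_bound gains_bound that) (use K_nonneg in auto)
  have [measurable]: "gains e \<in> borel_measurable M" using gains_integrable by simp
  have mg: "(\<lambda>z. gain e (snd z) (fst z) * gains e (fst z)) \<in> borel_measurable (M \<Otimes>\<^sub>M time)" by measurable
  have "expectation (\<lambda>\<omega>. (gains e \<omega>)\<^sup>2) = expectation (\<lambda>\<omega>. \<integral>s. gain e s \<omega> * gains e \<omega> \<partial>time)"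
    by (simp add: gains_def power2_eq_square)
  also have "\<dots> = (\<integral>s. expectation (\<lambda>\<omega>. gain e s \<omega> * gains e \<omega>) \<partial>time)"
    by (rule bounded_Fubini(1)[OF mg bd])
  also have "\<dots> \<le> (\<integral>s. K\<^sup>2 / 2 * (2 * e * I s + J s) \<partial>time)"
    by (intro integral_mono bounded_Fubini(2)[OF mg bd] inner) (use I_int J_int in auto)
  also have "\<dots> = K\<^sup>2 / 2 * (2 * e * (\<integral>s. I s \<partial>time) + (\<integral>s. J s \<partial>time))"
    using I_int J_int by simp
  also have "\<dots> \<le> K\<^sup>2 / 2 * (2 * e * (e * K\<^sup>2) + 2 * e * (e * K\<^sup>2))"
  proof -
    have "2 * e * (\<integral>s. I s \<partial>time) \<le> 2 * e * (e * K\<^sup>2)" using I_total e by (intro mult_left_mono) auto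
    thus ?thesis using J_total by (intro mult_left_mono) auto
  qed
  also have "\<dots> = 2 * e\<^sup>2 * K ^ 4" by (simp add: power2_eq_square power4_eq_xxxx algebra_simps)
  finally show ?thesis .
qed

lemma gains_sq_integrable: "integrable M (\<lambda>\<omega>. (gains e \<omega>)\<^sup>2)"
proof (rule integrable_const_bound[where B="(K * (2 * K) * measure time (space time))\<^sup>2"])
  show "(\<lambda>\<omega>. (gains e \<omega>)\<^sup>2) \<in> borel_measurable M" using gains_integrable[of e] by measurable
  show "AE \<omega> in M. norm ((gains e \<omega>)\<^sup>2) \<le> (K * (2 * K) * measure time (space time))\<^sup>2"
  proof (rule AE_I2)
    fix \<omega> assume "\<omega> \<in> space M"
    hence "\<bar>gains e \<omega>\<bar> \<le> \<bar>K * (2 * K) * measure time (space time)\<bar>"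
      using gains_bound[of \<omega> e] by linarith
    thus "norm ((gains e \<omega>)\<^sup>2) \<le> (K * (2 * K) * measure time (space time))\<^sup>2"
      by (simp only: abs_le_square_iff real_norm_def abs_power2)
  qed
qed

text \<open>
  From the pathwise identity, with \<open>(a - 2 g)\<^sup>2 \<le> 2 a\<^sup>2 + 8 g\<^sup>2\<close>.
\<close>
lemma quad_sq_le:
  assumes e: "0 < e" "e \<le> T" and \<omega>: "\<omega> \<in> space M"
  shows "(quad e \<omega>)\<^sup>2 \<le> 2 * (e * K\<^sup>2)\<^sup>2 + 8 * (gains e \<omega>)\<^sup>2"
proof -
  define a where "a = e * (N T \<omega>)\<^sup>2 - start e \<omega>"
  have q: "quad e \<omega> = a - 2 * gains e \<omega>" using pathwise_identity[OF e \<omega>] by (simp add: a_def)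
  have "0 \<le> e * (N T \<omega>)\<^sup>2" "e * (N T \<omega>)\<^sup>2 \<le> e * K\<^sup>2" using e NT_sq_bound[OF \<omega>] by (auto intro: mult_left_mono)
  hence "\<bar>a\<bar> \<le> e * K\<^sup>2" using start_bounds[OF e(1) \<omega>] unfolding a_def by linarith
  hence "a\<^sup>2 \<le> (e * K\<^sup>2)\<^sup>2" using abs_le_square_iff[of a "e * K\<^sup>2"] e by simp
  moreover have "(a - 2 * gains e \<omega>)\<^sup>2 + (a + 2 * gains e \<omega>)\<^sup>2 = 2 * a\<^sup>2 + 8 * (gains e \<omega>)\<^sup>2"
    by (simp add: power2_eq_square algebra_simps)
  moreover have "0 \<le> (a + 2 * gains e \<omega>)\<^sup>2" by simp
  ultimately show ?thesis unfolding q by linarith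
qed

lemma quad_second_moment:
  assumes e: "0 < e" "e \<le> T"
  shows "integrable M (\<lambda>\<omega>. (quad e \<omega>)\<^sup>2)" "expectation (\<lambda>\<omega>. (quad e \<omega>)\<^sup>2) \<le> 18 * e\<^sup>2 * K ^ 4"
proof -
  have int: "integrable M (\<lambda>\<omega>. 2 * (e * K\<^sup>2)\<^sup>2 + 8 * (gains e \<omega>)\<^sup>2)" using gains_sq_integrable by simp
  show iq: "integrable M (\<lambda>\<omega>. (quad e \<omega>)\<^sup>2)"
  proof (rule Bochner_Integration.integrable_bound[OF int])
    show "(\<lambda>\<omega>. (quad e \<omega>)\<^sup>2) \<in> borel_measurable M" using quad_integrable[of e] by measurable
    show "AE \<omega> in M. norm ((quad e \<omega>)\<^sup>2) \<le> norm (2 * (e * K\<^sup>2)\<^sup>2 + 8 * (gains e \<omega>)\<^sup>2)"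
      using quad_sq_le[OF e] by (intro AE_I2) simp
  qed
  have "expectation (\<lambda>\<omega>. (quad e \<omega>)\<^sup>2) \<le> expectation (\<lambda>\<omega>. 2 * (e * K\<^sup>2)\<^sup>2 + 8 * (gains e \<omega>)\<^sup>2)"
    by (rule integral_mono[OF iq int quad_sq_le[OF e]])
  also have "\<dots> = 2 * (e * K\<^sup>2)\<^sup>2 + 8 * expectation (\<lambda>\<omega>. (gains e \<omega>)\<^sup>2)"
    using gains_sq_integrable by (simp add: prob_space)
  also have "\<dots> \<le> 2 * (e * K\<^sup>2)\<^sup>2 + 8 * (2 * e\<^sup>2 * K ^ 4)" using gains_second_moment[OF e] by simp
  also have "\<dots> = 18 * e\<^sup>2 * K ^ 4" by (simp add: power2_eq_square power4_eq_xxxx algebra_simps)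
  finally show "expectation (\<lambda>\<omega>. (quad e \<omega>)\<^sup>2) \<le> 18 * e\<^sup>2 * K ^ 4" .
qed

text \<open>
  With \<open>q = quad e / e\<close> and \<open>B\<close> the event \<open>q > \<delta>\<close>, pointwise \<open>q \<le> \<delta> + c 1\<^sub>B + q\<^sup>2 / c\<close>. As second
  moments are bounded uniformly in \<open>e\<close>, convergence in probability implies convergence of means.
\<close>
lemma expectation_quad_truncated:
  assumes e: "0 < e" "e \<le> T" and \<delta>: "0 < \<delta>" and c: "0 < c"
  shows "expectation (quad e) / e \<le> \<delta> + c * prob {\<omega>\<in>space M. \<delta> * e < quad e \<omega>} + 18 * K ^ 4 / c"
proof -
  let ?B = "{\<omega>\<in>space M. \<delta> * e < quad e \<omega>}"
  have [measurable]: "quad e \<in> borel_measurable M" using quad_integrable[of e] by simp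
  have B: "?B \<in> sets M" by measurable
  have iB: "integrable M (indicat_real ?B)"
    by (rule integrable_real_indicator[OF B]) (simp add: emeasure_eq_measure)
  have int: "integrable M (\<lambda>\<omega>. \<delta> * e + c * e * indicator ?B \<omega> + (quad e \<omega>)\<^sup>2 / (c * e))"
    using iB quad_second_moment(1)[OF e] by simp
  have "expectation (quad e) \<le> expectation (\<lambda>\<omega>. \<delta> * e + c * e * indicator ?B \<omega> + (quad e \<omega>)\<^sup>2 / (c * e))"
  proof (rule integral_mono[OF quad_integrable int])
    fix \<omega> assume \<omega>: "\<omega> \<in> space M"
    have ce: "0 < c * e" using c e by simp
    show "quad e \<omega> \<le> \<delta> * e + c * e * indicator ?B \<omega> + (quad e \<omega>)\<^sup>2 / (c * e)"
    proof (cases "\<omega> \<in> ?B")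
      case False
      hence "quad e \<omega> \<le> \<delta> * e" using \<omega> by simp
      moreover have "0 \<le> (quad e \<omega>)\<^sup>2 / (c * e)" using ce by simp
      ultimately show ?thesis using False by simp
    next
      case True
      have "quad e \<omega> \<le> c * e + (quad e \<omega>)\<^sup>2 / (c * e)"
      proof (cases "quad e \<omega> \<le> c * e")
        case True
        moreover have "0 \<le> (quad e \<omega>)\<^sup>2 / (c * e)" using ce by simp
        ultimately show ?thesis by linarith
      next
        case False
        hence "quad e \<omega> * (c * e) \<le> quad e \<omega> * quad e \<omega>" using quad_nonneg by (intro mult_left_mono) auto
        hence "quad e \<omega> \<le> (quad e \<omega>)\<^sup>2 / (c * e)" using ce by (simp add: pos_le_divide_eq power2_eq_square)
        thus ?thesis using ce by linarith
      qed
      moreover have "0 < \<delta> * e" using \<delta> e by simp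
      moreover have "c * e * indicator ?B \<omega> = c * e" using True by simp
      ultimately show ?thesis by linarith
    qed
  qed
  also have "\<dots> = \<delta> * e + c * e * prob ?B + expectation (\<lambda>\<omega>. (quad e \<omega>)\<^sup>2) / (c * e)"
    using iB quad_second_moment(1)[OF e] B by (simp add: prob_space)
  also have "\<dots> \<le> \<delta> * e + c * e * prob ?B + (18 * e\<^sup>2 * K ^ 4) / (c * e)"
    using quad_second_moment(2)[OF e] c e by (intro add_left_mono divide_right_mono) auto
  also have "\<dots> = e * (\<delta> + c * prob ?B + 18 * K ^ 4 / c)"
    using c e by (simp add: power2_eq_square field_simps)
  finally show ?thesis using e by (simp add: pos_divide_le_eq mult.commute)
qed

lemma start_quotient_tendsto:
  assumes e: "\<And>n. 0 < e n" "\<And>n. e n \<le> T" "e \<longlonglongrightarrow> 0"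
  shows "(\<lambda>n. expectation (start (e n)) / e n) \<longlonglongrightarrow> 0"
proof -
  have "(\<lambda>n. expectation (\<lambda>\<omega>. start (e n) \<omega> / e n)) \<longlonglongrightarrow> expectation (\<lambda>_. 0)"
  proof (rule integral_dominated_convergence[where w="\<lambda>_. K\<^sup>2"])
    show "(\<lambda>\<omega>. start (e n) \<omega> / e n) \<in> borel_measurable M" for n
      using start_integrable[OF e(1,2), of n] by measurable
    show "AE \<omega> in M. norm (start (e n) \<omega> / e n) \<le> K\<^sup>2" for n
      using start_bounds[OF e(1)[of n]] e(1)[of n] by (intro AE_I2) (simp add: pos_divide_le_eq mult.commute)
    show "AE \<omega> in M. (\<lambda>n. start (e n) \<omega> / e n) \<longlonglongrightarrow> 0"
    proof (rule AE_I2)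
      fix \<omega> assume \<omega>: "\<omega> \<in> space M"
      show "(\<lambda>n. start (e n) \<omega> / e n) \<longlonglongrightarrow> 0"
      proof (rule LIMSEQ_I)
        fix r :: real assume r: "0 < r"
        have z: "(ext 0 \<omega>)\<^sup>2 = 0" using zero_N[OF \<omega>] T_pos by (simp add: ext_def)
        have "continuous_on UNIV (\<lambda>s. (ext s \<omega>)\<^sup>2)" by (intro continuous_intros ext_continuous \<omega>)
        then obtain d where d: "d > 0" "\<And>s. dist s 0 < d \<Longrightarrow> dist ((ext s \<omega>)\<^sup>2) ((ext 0 \<omega>)\<^sup>2) < r/2"
          unfolding continuous_on_iff using r by (metis UNIV_I half_gt_zero)
        have "\<forall>\<^sub>F n in sequentially. e n < d" using e(3) d(1) by (rule order_tendstoD)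
        then obtain n0 where n0: "\<And>n. n \<ge> n0 \<Longrightarrow> e n < d" by (auto simp: eventually_sequentially)
        have "norm (start (e n) \<omega> / e n - 0) < r" if "n \<ge> n0" for n
        proof -
          have "(ext s \<omega>)\<^sup>2 \<le> r/2" if "s \<in> {0<..e n}" for s
            using d(2)[of s] that n0[OF \<open>n \<ge> n0\<close>] unfolding z by (auto simp: dist_real_def)
          note st = start_le[OF e(1)[of n] \<omega> this]
          have "start (e n) \<omega> / e n \<le> r / 2" using st(2) e(1)[of n] by (simp add: pos_divide_le_eq mult.commute)
          moreover have "0 \<le> start (e n) \<omega> / e n" using st(1) e(1)[of n] by simp
          ultimately show ?thesis unfolding diff_0_right real_norm_def using r by linarith
        qed
        thus "\<exists>n0. \<forall>n\<ge>n0. norm (start (e n) \<omega> / e n - 0) < r" by blast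
      qed
    qed
  qed auto
  thus ?thesis by simp
qed

text \<open>
  The second moment of \<open>N T\<close> is the mean of \<open>quad e / e\<close> plus a boundary term, and both tend to \<open>0\<close>.
\<close>
theorem terminal_value_zero:
  assumes vanish: "\<And>\<delta>. 0 < \<delta> \<Longrightarrow> ((\<lambda>e. prob {\<omega>\<in>space M. \<delta> * e < quad e \<omega>}) \<longlongrightarrow> 0) (at_right 0)"
  shows "AE \<omega> in M. N T \<omega> = 0"
proof -
  define e where "e n = T / real (Suc n)" for n
  have e: "0 < e n" "e n \<le> T" for n using T_pos by (auto simp: e_def pos_divide_le_eq)
  have e0: "e \<longlonglongrightarrow> 0"
    using tendsto_mult[OF tendsto_const LIMSEQ_inverse_real_of_nat, of T] by (simp add: e_def[abs_def] divide_inverse)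
  have eR: "filterlim e (at_right 0) sequentially"
    unfolding at_within_def filterlim_inf filterlim_principal
    using e0 e(1) by (auto intro!: always_eventually simp: less_le)
  let ?V = "expectation (\<lambda>\<omega>. (N T \<omega>)\<^sup>2)"
  have "?V \<le> 0 + \<eta>" if \<eta>: "0 < \<eta>" for \<eta>
  proof -
    \<comment> \<open>With this \<open>c\<close> the term \<open>18 K\<^sup>4 / c\<close> is at most \<open>\<eta> / 4\<close>; the summand \<open>1\<close> covers \<open>K = 0\<close>.\<close>
    define c where "c = 1 + 72 * K ^ 4 / \<eta>"
    have c: "0 < c" using \<eta> by (auto simp: c_def intro!: add_pos_nonneg)
    have "72 * K ^ 4 \<le> c * \<eta>" using \<eta> by (simp add: c_def field_simps)
    hence c18: "18 * K ^ 4 / c \<le> \<eta> / 4" using c by (simp add: pos_divide_le_eq field_simps)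
    have "(\<lambda>n. prob {\<omega>\<in>space M. \<eta> / 4 * e n < quad (e n) \<omega>}) \<longlonglongrightarrow> 0"
      using \<eta> by (intro filterlim_compose[OF vanish eR]) auto
    hence "\<forall>\<^sub>F n in sequentially. prob {\<omega>\<in>space M. \<eta> / 4 * e n < quad (e n) \<omega>} < \<eta> / (4 * c)"
      using \<eta> c by (intro order_tendstoD) auto
    moreover have "\<forall>\<^sub>F n in sequentially. expectation (start (e n)) / e n < \<eta> / 4"
      using start_quotient_tendsto[OF e e0] \<eta> by (intro order_tendstoD) auto
    ultimately have "\<forall>\<^sub>F n in sequentially. prob {\<omega>\<in>space M. \<eta> / 4 * e n < quad (e n) \<omega>} < \<eta> / (4 * c)
        \<and> expectation (start (e n)) / e n < \<eta> / 4" by (rule eventually_conj)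
    then obtain n where n: "prob {\<omega>\<in>space M. \<eta> / 4 * e n < quad (e n) \<omega>} < \<eta> / (4 * c)"
      "expectation (start (e n)) / e n < \<eta> / 4" by (auto simp: eventually_sequentially)
    have "c * prob {\<omega>\<in>space M. \<eta> / 4 * e n < quad (e n) \<omega>} \<le> c * (\<eta> / (4 * c))"
      using n(1) c by (intro mult_left_mono) auto
    also have "\<dots> = \<eta> / 4" using c by simp
    finally have p: "c * prob {\<omega>\<in>space M. \<eta> / 4 * e n < quad (e n) \<omega>} \<le> \<eta> / 4" .
    have "?V = expectation (quad (e n)) / e n + expectation (start (e n)) / e n"
      using expectation_identity[OF e, of n] e(1)[of n] by (simp add: field_simps)
    also have "expectation (quad (e n)) / e n \<le> \<eta> / 4
        + c * prob {\<omega>\<in>space M. \<eta> / 4 * e n < quad (e n) \<omega>} + 18 * K ^ 4 / c"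
      using \<eta> by (intro expectation_quad_truncated[OF e _ c]) simp
    finally show ?thesis using p n(2) c18 by linarith
  qed
  hence "?V \<le> 0" by (rule field_le_epsilon)
  moreover have "0 \<le> ?V" by simp
  ultimately have "?V = 0" by linarith
  hence "AE \<omega> in M. (N T \<omega>)\<^sup>2 = 0"
    by (subst (asm) integral_nonneg_eq_0_iff_AE[OF NT_sq_integrable]) auto
  thus ?thesis by eventually_elim simp
qed

end

section \<open>Continuous local martingales orthogonal to themselves\<close>

lemma continuous_zero_on_rationals:
  fixes x :: "real \<Rightarrow> real"
  assumes x: "continuous_on {0..T} x" and zero: "\<And>q. q \<in> \<rat> \<inter> {0..T} \<Longrightarrow> x q = 0" and t: "t \<in> {0..T}"
  shows "x t = 0"
proof -
  have "continuous_on {0..T} (\<lambda>s. - \<bar>x s\<bar>)" by (intro continuous_intros x)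
  moreover have "0 \<le> T" "\<exists>s\<in>{0..T}. - \<bar>x s\<bar> \<le> - \<bar>x t\<bar>" using t by auto
  ultimately have *: "\<exists>q\<in>\<rat> \<inter> {0..T}. - \<bar>x q\<bar> < - \<bar>x t\<bar> + 1 / real (Suc k)" for k
    using exists_le_iff_rational[of T "\<lambda>s. - \<bar>x s\<bar>" "- \<bar>x t\<bar>"] by blast
  have "\<bar>x t\<bar> \<le> 0 + e" if e: "0 < e" for e
  proof -
    obtain k where "1 / real (Suc k) < e" using nat_approx_posE[OF e] by blast
    moreover obtain q where "q \<in> \<rat> \<inter> {0..T}" "- \<bar>x q\<bar> < - \<bar>x t\<bar> + 1 / real (Suc k)" using *[of k] by blast
    ultimately show ?thesis using zero[of q] by simp
  qed
  hence "\<bar>x t\<bar> \<le> 0" by (rule field_le_epsilon)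
  thus ?thesis by simp
qed

text \<open>
  A larger value would have to be preceded by the value \<open>k\<close>, by the intermediate value theorem.
\<close>
lemma path_bound_until_hit:
  assumes x: "continuous_on {0..T} x" "x 0 = 0" and k: "0 \<le> k"
    and u: "u \<in> {0..T}" "u \<le> hit_time T (- k) (\<lambda>t. - \<bar>x t\<bar>)"
  shows "\<bar>x u\<bar> \<le> k"
proof (rule ccontr)
  assume "\<not> \<bar>x u\<bar> \<le> k"
  have "continuous_on {0..u} (\<lambda>t. \<bar>x t\<bar>)"
    using u(1) by (intro continuous_intros continuous_on_subset[OF x(1)]) auto
  then obtain v where v: "0 \<le> v" "v \<le> u" "\<bar>x v\<bar> = k"
    using IVT'[of "\<lambda>t. \<bar>x t\<bar>" 0 k u] x(2) k u(1) \<open>\<not> \<bar>x u\<bar> \<le> k\<close> by auto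
  have "hit_time T (- k) (\<lambda>t. - \<bar>x t\<bar>) \<le> v"
    using v u(1) by (intro hit_time_le) auto
  hence "v = u" using u(2) v(2) by linarith
  thus False using v(3) \<open>\<not> \<bar>x u\<bar> \<le> k\<close> by simp
qed

context usual_filtered_prob_space
begin

lemma AE_ball_rationals:
  assumes "\<And>q. q \<in> {0..T} \<Longrightarrow> AE \<omega> in M. P q \<omega>"
  shows "AE \<omega> in M. \<forall>q\<in>\<rat> \<inter> {0..T}. P q \<omega>"
proof -
  have "countable (\<rat> \<inter> {0..T})" by (rule countable_subset[OF _ countable_rat]) auto
  thus ?thesis using assms by (subst AE_ball_countable) auto
qed

text \<open>
  The localized martingales have constant mean \<open>0\<close> and are nonnegative, so they vanish at each rational time.
\<close>
lemma nonneg_local_martingale_zero: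
  assumes V: "local_martingale M F T V" and cont: "\<And>\<omega>. \<omega> \<in> space M \<Longrightarrow> continuous_on {0..T} (\<lambda>t. V t \<omega>)"
    and nonneg: "\<And>t \<omega>. 0 \<le> V t \<omega>" and zero: "AE \<omega> in M. V 0 \<omega> = 0"
  shows "AE \<omega> in M. \<forall>t\<in>{0..T}. V t \<omega> = 0"
proof -
  obtain \<tau> where \<tau>: "localizing_sequence M F T \<tau>"
    "\<And>n. martingale M F T (\<lambda>t \<omega>. V (min t (\<tau> n \<omega>)) \<omega> - V 0 \<omega>)"
    using V unfolding local_martingale_def by blast
  have 0: "0 \<in> {0..T}" using T_pos by simp
  have "AE \<omega> in M. V (min t (\<tau> n \<omega>)) \<omega> = 0" if t: "t \<in> {0..T}" for t n
  proof -
    let ?f = "\<lambda>t \<omega>. V (min t (\<tau> n \<omega>)) \<omega> - V 0 \<omega>"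
    have "min 0 (\<tau> n \<omega>) = 0" for \<omega> using localizing_sequenceD(2)[OF \<tau>(1), of n \<omega>] by auto
    hence z: "?f 0 \<omega> = 0" for \<omega> by simp
    have sp: "space M \<in> sets (F 0)" using sets.top[of "F 0"] space_F[OF 0] by simp
    have "expectation (\<lambda>\<omega>. indicator (space M) \<omega> * ?f t \<omega>) = expectation (\<lambda>\<omega>. indicator (space M) \<omega> * ?f 0 \<omega>)"
      using t by (intro martingale_indicator[OF \<tau>(2) 0 t _ sp]) auto
    hence "expectation (\<lambda>\<omega>. indicator (space M) \<omega> * ?f t \<omega>) = 0" unfolding z by simp
    moreover have "expectation (\<lambda>\<omega>. indicator (space M) \<omega> * ?f t \<omega>) = expectation (?f t)"
      by (rule Bochner_Integration.integral_cong) auto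
    ultimately have "expectation (?f t) = 0" by simp
    moreover have nn: "AE \<omega> in M. 0 \<le> ?f t \<omega>" using zero by eventually_elim (simp add: nonneg)
    ultimately have "AE \<omega> in M. ?f t \<omega> = 0"
      using integral_nonneg_eq_0_iff_AE[OF martingale_integrable[OF \<tau>(2) t] nn] by simp
    thus ?thesis using zero by eventually_elim simp
  qed
  hence "AE \<omega> in M. \<forall>q\<in>\<rat> \<inter> {0..T}. \<forall>n. V (min q (\<tau> n \<omega>)) \<omega> = 0"
    by (intro AE_ball_rationals) (simp only: AE_all_countable, blast)
  thus ?thesis
    using localizing_sequenceD(3)[OF \<tau>(1)] AE_space
  proof eventually_elim
    case (elim \<omega>)
    then obtain n where n: "\<tau> n \<omega> = T" by blast
    have "V q \<omega> = 0" if q: "q \<in> \<rat> \<inter> {0..T}" for q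
    proof -
      have "min q (\<tau> n \<omega>) = q" using q n by auto
      thus ?thesis using elim(1) q by metis
    qed
    thus ?case using continuous_zero_on_rationals[OF cont[OF elim(3)]] by blast
  qed
qed

lemma martingale_zero_if_terminal_zero:
  assumes X: "martingale M F T X" and zero: "AE \<omega> in M. X T \<omega> = 0" and t: "t \<in> {0..T}"
  shows "AE \<omega> in M. X t \<omega> = 0"
proof -
  have sub: "subalgebra M (F t)" by (rule subalgebra_F[OF t])
  interpret sub: sigma_finite_subalgebra M "F t"
    by (intro finite_measure_subalgebra_is_sigma_finite finite_measure_subalgebra.intro
        finite_measure_subalgebra_axioms.intro sub) unfold_locales
  have "X T \<in> borel_measurable M" using martingale_integrable[OF X, of T] T_pos by auto
  hence "AE \<omega> in M. real_cond_exp M (F t) (X T) \<omega> = real_cond_exp M (F t) (\<lambda>_. 0) \<omega>"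
    by (intro sub.real_cond_exp_cong zero) auto
  moreover have "AE \<omega> in M. real_cond_exp M (F t) (\<lambda>_. 0) \<omega> = 0"
    by (intro sub.real_cond_exp_F_meas) auto
  moreover have "AE \<omega> in M. real_cond_exp M (F t) (X T) \<omega> = X t \<omega>"
    using X t unfolding martingale_def by simp
  ultimately show ?thesis by eventually_elim simp
qed

text \<open>
  Stop \<open>L\<close> at a localizing time and when \<open>\<bar>L\<bar>\<close> reaches \<open>n\<close>, and let \<open>\<rho> n\<close> be the smaller of the two. Since
  the increments in the regularization are cut off at \<open>t\<close>, the regularized bracket of the stopped process
  at \<open>T\<close> is that of \<open>L\<close> at time \<open>\<rho> n\<close>, and convergence uniform in \<open>t\<close> covers the random time.
\<close>
theorem self_orthogonal_continuous_local_martingale_zero: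
  assumes L: "continuous_local_martingale M F T L" and zero: "\<And>\<omega>. \<omega> \<in> space M \<Longrightarrow> L 0 \<omega> = 0"
    and cov: "has_covariation M T L L (\<lambda>t \<omega>. 0)"
  shows "AE \<omega> in M. \<forall>t\<in>{0..T}. L t \<omega> = 0"
proof -
  have Lloc: "local_martingale M F T L" and cont: "\<And>\<omega>. \<omega> \<in> space M \<Longrightarrow> continuous_on {0..T} (\<lambda>t. L t \<omega>)"
    using L unfolding continuous_local_martingale_def by blast+
  note Lad = local_martingaleD(1)[OF Lloc] and Lcad = local_martingaleD(2)[OF Lloc]
  obtain \<tau> where \<tau>: "localizing_sequence M F T \<tau>"
    "\<And>n. martingale M F T (\<lambda>t \<omega>. L (min t (\<tau> n \<omega>)) \<omega> - L 0 \<omega>)"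
    using Lloc unfolding local_martingale_def by blast
  define h where "h n \<omega> = hit_time T (- real n) (\<lambda>t. - \<bar>L t \<omega>\<bar>)" for n \<omega>
  define \<rho> where "\<rho> n \<omega> = min (\<tau> n \<omega>) (h n \<omega>)" for n \<omega>
  have "continuous_process (\<lambda>t \<omega>. - \<bar>L t \<omega>\<bar>)"
    unfolding continuous_process_def adapted_def
  proof (intro conjI ballI)
    fix t assume "t \<in> {0..T}"
    hence [measurable]: "L t \<in> borel_measurable (F t)" using Lad by (simp add: adapted_def)
    show "(\<lambda>\<omega>. - \<bar>L t \<omega>\<bar>) \<in> borel_measurable (F t)" by measurable
  next
    fix \<omega> assume "\<omega> \<in> space M"
    thus "continuous_on {0..T} (\<lambda>t. - \<bar>L t \<omega>\<bar>)" by (intro continuous_intros cont)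
  qed
  hence h: "stopping_time F (h n)" "h n \<omega> \<in> {0..T}" for n \<omega>
    using hit_time_stopping hit_time_range T_pos by (simp_all add: h_def[abs_def])
  have \<rho>: "stopping_time F (\<rho> n)" "\<rho> n \<omega> \<in> {0..T}" for n \<omega>
    unfolding \<rho>_def[abs_def] using localizing_sequenceD(2)[OF \<tau>(1), of n \<omega>] h(2)[of n \<omega>]
    by (auto intro: stopping_time_min localizing_sequenceD(1)[OF \<tau>(1)] h(1))
  define N where "N n t \<omega> = L (min t (\<rho> n \<omega>)) \<omega>" for n t \<omega>
  have mart: "martingale M F T (N n)" for n
  proof (rule martingale_modification)
    show "martingale M F T (\<lambda>t \<omega>. L (min (min t (h n \<omega>)) (\<tau> n \<omega>)) \<omega> - L 0 \<omega>)"
      by (rule martingale_stopped[OF \<tau>(2) cadlag_stopped[OF Lcad] h])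
    show "adapted F T (N n)" unfolding N_def[abs_def] by (rule adapted_stopped[OF Lad Lcad \<rho>])
    show "AE \<omega> in M. \<forall>t\<in>{0..T}. N n t \<omega> = L (min (min t (h n \<omega>)) (\<tau> n \<omega>)) \<omega> - L 0 \<omega>"
      by (intro AE_I2) (simp add: N_def \<rho>_def zero min.commute min.left_commute)
  qed
  have in_range: "min t (\<rho> n \<omega>) \<in> {0..T}" if "t \<in> {0..T}" for t n \<omega>
    using \<rho>(2)[of n \<omega>] that by auto
  have bcm: "bounded_continuous_martingale M F T (N n) (real n)" for n
  proof (intro bounded_continuous_martingale.intro bounded_continuous_martingale_axioms.intro mart)
    show "usual_filtered_prob_space M F T" by unfold_locales
    show "continuous_on {0..T} (\<lambda>t. N n t \<omega>)" if "\<omega> \<in> space M" for \<omega>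
      unfolding N_def by (rule continuous_on_compose2[OF cont[OF that]])
        (use in_range in \<open>auto intro!: continuous_intros\<close>)
    show "\<bar>N n t \<omega>\<bar> \<le> real n" if "t \<in> {0..T}" "\<omega> \<in> space M" for t \<omega>
      unfolding N_def
      by (rule path_bound_until_hit[OF cont[OF that(2)] zero[OF that(2)] _ in_range[OF that(1)]])
        (auto simp: \<rho>_def h_def)
    show "N n 0 \<omega> = 0" if "\<omega> \<in> space M" for \<omega>
      using zero[OF that] \<rho>(2)[of n \<omega>] by (simp add: N_def)
  qed
  have terminal: "AE \<omega> in M. N n T \<omega> = 0" for n
  proof -
    interpret N: bounded_continuous_martingale M F T "N n" "real n" by (rule bcm)
    let ?Q = "\<lambda>e t \<omega>. LINT s:{0<..t}|lborel. cov_integrand L L e t \<omega> s"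
    have quad: "N.quad e \<omega> = e * ?Q e (\<rho> n \<omega>) \<omega>" if e: "0 < e" for e \<omega>
    proof -
      have "N.quad e \<omega> = (LINT s:{0<..T}|lborel. (N.incr e s \<omega>)\<^sup>2)"
        unfolding N.quad_def by (rule N.integral_time)
      also have "\<dots> = (LINT s:{0<..\<rho> n \<omega>}|lborel. e * cov_integrand L L e (\<rho> n \<omega>) \<omega> s)"
        unfolding set_lebesgue_integral_def
      proof (rule Bochner_Integration.integral_cong[OF refl])
        fix s :: real
        have r: "\<rho> n \<omega> \<in> {0..T}" by (rule \<rho>(2))
        consider "s \<le> 0" | "0 < s" "s \<le> \<rho> n \<omega>" | "0 < s" "\<rho> n \<omega> < s" by linarith
        thus "indicat_real {0<..T} s *\<^sub>R (N.incr e s \<omega>)\<^sup>2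
          = indicat_real {0<..\<rho> n \<omega>} s *\<^sub>R (e * cov_integrand L L e (\<rho> n \<omega>) \<omega> s)"
        proof cases
          case 2
          have "max 0 (min (s + e) T) = min (s + e) T" "max 0 (min s T) = s" using 2 r e by auto
          moreover have "min (min (s + e) T) (\<rho> n \<omega>) = min (s + e) (\<rho> n \<omega>)" "min s (\<rho> n \<omega>) = s" using 2 r by auto
          ultimately have "N.incr e s \<omega> = L (min (s + e) (\<rho> n \<omega>)) \<omega> - L s \<omega>"
            by (simp add: N.incr_def N.ext_def N_def)
          thus ?thesis using 2 r e by (simp add: cov_integrand_def power2_eq_square)
        next
          case 3
          show ?thesis
          proof (cases "s \<le> T")
            case True
            have "max 0 (min (s + e) T) = min (s + e) T" "max 0 (min s T) = s" using 3 r e True by auto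
            moreover have "min (min (s + e) T) (\<rho> n \<omega>) = \<rho> n \<omega>" "min s (\<rho> n \<omega>) = \<rho> n \<omega>" using 3 r e by auto
            ultimately have "N.incr e s \<omega> = 0" by (simp add: N.incr_def N.ext_def N_def)
            thus ?thesis using 3 by simp
          qed (use 3 in simp)
        qed simp
      qed
      also have "\<dots> = e * ?Q e (\<rho> n \<omega>) \<omega>" by simp
      finally show ?thesis .
    qed
    have "((\<lambda>e. prob {\<omega>\<in>space M. \<delta> * e < N.quad e \<omega>}) \<longlongrightarrow> 0) (at_right 0)" if \<delta>: "0 < \<delta>" for \<delta>
    proof -
      let ?O = "\<lambda>e. outer_measure_of M {\<omega>\<in>space M. \<exists>t\<in>{0..T}. \<bar>?Q e t \<omega> - 0\<bar> > \<delta>}"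
      have O: "(?O \<longlongrightarrow> 0) (at_right 0)"
        using cov \<delta> unfolding has_covariation_def ucp_limit_def by blast
      have "((\<lambda>e. ennreal (prob {\<omega>\<in>space M. \<delta> * e < N.quad e \<omega>})) \<longlongrightarrow> 0) (at_right 0)"
      proof (rule tendsto_sandwich[OF _ _ tendsto_const O])
        have "ennreal (prob {\<omega>\<in>space M. \<delta> * e < N.quad e \<omega>}) \<le> ?O e" if e: "0 < e" for e
        proof -
          let ?B = "{\<omega>\<in>space M. \<delta> * e < N.quad e \<omega>}"
          have [measurable]: "N.quad e \<in> borel_measurable M" using N.quad_integrable[of e] by simp
          have B: "?B \<in> sets M" by measurable
          have "?B \<subseteq> {\<omega>\<in>space M. \<exists>t\<in>{0..T}. \<bar>?Q e t \<omega> - 0\<bar> > \<delta>}"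
          proof
            fix \<omega> assume \<omega>: "\<omega> \<in> ?B"
            hence "\<delta> * e < e * ?Q e (\<rho> n \<omega>) \<omega>" using quad[OF e, of \<omega>] by simp
            hence "\<delta> < ?Q e (\<rho> n \<omega>) \<omega>" using e by (simp add: mult.commute)
            hence "\<delta> < \<bar>?Q e (\<rho> n \<omega>) \<omega> - 0\<bar>" by linarith
            thus "\<omega> \<in> {\<omega>\<in>space M. \<exists>t\<in>{0..T}. \<bar>?Q e t \<omega> - 0\<bar> > \<delta>}" using \<omega> \<rho>(2)[of n \<omega>] by blast
          qed
          hence "outer_measure_of M ?B \<le> ?O e" by (rule outer_measure_of_mono)
          thus ?thesis using B by (simp add: emeasure_eq_measure)
        qed
        thus "\<forall>\<^sub>F e in at_right 0. ennreal (prob {\<omega>\<in>space M. \<delta> * e < N.quad e \<omega>}) \<le> ?O e"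
          by (auto simp: eventually_at_filter)
      qed simp
      hence "((\<lambda>e. ennreal (prob {\<omega>\<in>space M. \<delta> * e < N.quad e \<omega>})) \<longlongrightarrow> ennreal 0) (at_right 0)" by simp
      thus ?thesis by (rule tendsto_ennrealD) auto
    qed
    thus ?thesis by (rule N.terminal_value_zero)
  qed
  have "AE \<omega> in M. N n q \<omega> = 0" if "q \<in> {0..T}" for n q
    by (rule martingale_zero_if_terminal_zero[OF mart terminal that])
  hence "AE \<omega> in M. \<forall>q\<in>\<rat> \<inter> {0..T}. \<forall>n. N n q \<omega> = 0"
    by (intro AE_ball_rationals) (simp only: AE_all_countable, blast)
  thus ?thesis
    using localizing_sequenceD(3)[OF \<tau>(1)] AE_space
  proof eventually_elim
    case (elim \<omega>)
    then obtain m where m: "\<tau> m \<omega> = T" and inc: "incseq (\<lambda>n. \<tau> n \<omega>)" by blast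
    have "continuous_on {0..T} (\<lambda>t. \<bar>L t \<omega>\<bar>)" by (intro continuous_intros cont elim)
    then obtain v where v: "\<forall>t\<in>{0..T}. \<bar>L t \<omega>\<bar> \<le> \<bar>L v \<omega>\<bar>"
      using continuous_attains_sup[OF compact_Icc, of 0 T "\<lambda>t. \<bar>L t \<omega>\<bar>"] T_pos by auto
    obtain k :: nat where k: "\<bar>L v \<omega>\<bar> < k" using reals_Archimedean2 by blast
    \<comment> \<open>For this \<open>n\<close> neither of the two stopping times is reached before \<open>T\<close>.\<close>
    define n where "n = max m k"
    have "T \<le> \<tau> n \<omega>" using incseqD[OF inc, of m n] m by (simp add: n_def)
    hence "\<tau> n \<omega> = T" using localizing_sequenceD(2)[OF \<tau>(1), of n \<omega>] by simp
    moreover have "h n \<omega> = T"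
    proof -
      have "\<not> (\<exists>t\<in>{0..T}. - \<bar>L t \<omega>\<bar> \<le> - real n)" using v k by (fastforce simp: n_def)
      thus ?thesis by (simp add: h_def hit_time_def)
    qed
    ultimately have r: "\<rho> n \<omega> = T" by (simp add: \<rho>_def)
    have "L q \<omega> = 0" if q: "q \<in> \<rat> \<inter> {0..T}" for q
    proof -
      have "min q (\<rho> n \<omega>) = q" using q r by auto
      moreover have "N n q \<omega> = 0" using elim(1) q by blast
      ultimately show ?thesis by (simp add: N_def)
    qed
    thus ?case using continuous_zero_on_rationals[OF cont[OF elim(3)]] by blast
  qed
qed

section \<open>Uniqueness of the decomposition\<close>

text \<open>
  The events in the definition of u.c.p. convergence need not be measurable; measurable hulls of equal
  measure reduce the claim to subadditivity of the measure.
\<close>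
lemma outer_measure_of_union_null:
  assumes "A \<subseteq> space M" "B \<subseteq> space M" "N \<in> null_sets M" "C \<subseteq> A \<union> B \<union> N"
  shows "outer_measure_of M C \<le> outer_measure_of M A + outer_measure_of M B"
proof -
  obtain A' where A': "A' \<in> sets M" "A \<subseteq> A'" "outer_measure_of M A = emeasure M A'"
    using outer_measure_of_attain[OF assms(1)] by blast
  obtain B' where B': "B' \<in> sets M" "B \<subseteq> B'" "outer_measure_of M B = emeasure M B'"
    using outer_measure_of_attain[OF assms(2)] by blast
  have "outer_measure_of M C \<le> outer_measure_of M (A' \<union> B' \<union> N)"
    by (rule outer_measure_of_mono) (use assms(4) A'(2) B'(2) in blast)
  also have "\<dots> = emeasure M (A' \<union> B' \<union> N)" using A' B' assms(3) by (intro outer_measure_of_eq) auto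
  also have "\<dots> = emeasure M (A' \<union> B')" using A' B' assms(3) by (intro emeasure_Un_null_set) auto
  also have "\<dots> \<le> emeasure M A' + emeasure M B'" by (rule emeasure_subadditive) (use A' B' in auto)
  finally show ?thesis using A' B' by simp
qed

lemma has_covariation_diff:
  assumes X: "has_covariation M T X Y (\<lambda>t \<omega>. 0)" and X': "has_covariation M T X' Y (\<lambda>t \<omega>. 0)"
    and eq: "AE \<omega> in M. \<forall>t\<in>{0..T}. Z t \<omega> = X t \<omega> - X' t \<omega>"
  shows "has_covariation M T Z Y (\<lambda>t \<omega>. 0)"
proof -
  let ?I = "\<lambda>X e t \<omega>. LINT s:{0<..t}|lborel. cov_integrand X Y e t \<omega> s"
  let ?int = "\<lambda>X \<omega>. \<forall>e>0. \<forall>t\<in>{0..T}. set_integrable lborel {0<..t} (cov_integrand X Y e t \<omega>)"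
  have intX: "AE \<omega> in M. ?int X \<omega>" "AE \<omega> in M. ?int X' \<omega>"
    using X X' unfolding has_covariation_def by blast+
  have good: "AE \<omega> in M. ?int Z \<omega> \<and> (\<forall>e>0. \<forall>t\<in>{0..T}. ?I Z e t \<omega> = ?I X e t \<omega> - ?I X' e t \<omega>)"
    using intX eq
  proof eventually_elim
    case (elim \<omega>)
    have "set_integrable lborel {0<..t} (cov_integrand Z Y e t \<omega>) \<and> ?I Z e t \<omega> = ?I X e t \<omega> - ?I X' e t \<omega>"
      if e: "e > 0" and t: "t \<in> {0..T}" for e t
    proof -
      have i: "set_integrable lborel {0<..t} (cov_integrand X Y e t \<omega>)"
        "set_integrable lborel {0<..t} (cov_integrand X' Y e t \<omega>)" using elim(1,2) e t by blast+
      have c: "cov_integrand Z Y e t \<omega> s = cov_integrand X Y e t \<omega> s - cov_integrand X' Y e t \<omega> s"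
        if "s \<in> {0<..t}" for s
      proof -
        have "s \<in> {0..T}" "min (s + e) t \<in> {0..T}" using that t e by auto
        hence Z: "Z s \<omega> = X s \<omega> - X' s \<omega>" "Z (min (s + e) t) \<omega> = X (min (s + e) t) \<omega> - X' (min (s + e) t) \<omega>"
          using elim(3) by blast+
        show ?thesis
          unfolding cov_integrand_def Z diff_divide_distrib[symmetric] by (simp add: algebra_simps)
      qed
      have "set_integrable lborel {0<..t} (cov_integrand Z Y e t \<omega>) \<longleftrightarrow>
        set_integrable lborel {0<..t} (\<lambda>s. cov_integrand X Y e t \<omega> s - cov_integrand X' Y e t \<omega> s)"
        by (rule set_integrable_cong) (use c in auto)
      moreover have "?I Z e t \<omega> = (LINT s:{0<..t}|lborel. cov_integrand X Y e t \<omega> s - cov_integrand X' Y e t \<omega> s)"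
        by (rule set_lebesgue_integral_cong) (use c in auto)
      ultimately show ?thesis using set_integral_diff[OF i] by simp
    qed
    thus ?case by blast
  qed
  have "ucp_limit M T (?I Z) (\<lambda>t \<omega>. 0)"
    unfolding ucp_limit_def
  proof (intro allI impI)
    fix \<delta> :: real assume \<delta>: "0 < \<delta>"
    let ?E = "\<lambda>X \<delta> e. {\<omega>\<in>space M. \<exists>t\<in>{0..T}. \<bar>?I X e t \<omega> - 0\<bar> > \<delta>}"
    have lim: "((\<lambda>e. outer_measure_of M (?E X (\<delta>/2) e)) \<longlongrightarrow> 0) (at_right 0)"
      "((\<lambda>e. outer_measure_of M (?E X' (\<delta>/2) e)) \<longlongrightarrow> 0) (at_right 0)"
      using X X' half_gt_zero[OF \<delta>] unfolding has_covariation_def ucp_limit_def by blast+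
    define P where "P \<omega> \<longleftrightarrow> (\<forall>e>0. \<forall>t\<in>{0..T}. ?I Z e t \<omega> = ?I X e t \<omega> - ?I X' e t \<omega>)" for \<omega>
    have "AE \<omega> in M. P \<omega>" using good unfolding P_def by eventually_elim blast
    then obtain N where N: "N \<in> null_sets M" "\<And>\<omega>. \<omega> \<in> space M - N \<Longrightarrow> P \<omega>"
      using AE_E3[of P M] by blast
    show "((\<lambda>e. outer_measure_of M (?E Z \<delta> e)) \<longlongrightarrow> 0) (at_right 0)"
    proof (rule tendsto_sandwich[OF _ _ tendsto_const])
      show "((\<lambda>e. outer_measure_of M (?E X (\<delta>/2) e) + outer_measure_of M (?E X' (\<delta>/2) e)) \<longlongrightarrow> 0) (at_right 0)"
        using tendsto_add[OF lim] by simp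
      have "outer_measure_of M (?E Z \<delta> e) \<le> outer_measure_of M (?E X (\<delta>/2) e) + outer_measure_of M (?E X' (\<delta>/2) e)"
        if e: "e > 0" for e
      proof (rule outer_measure_of_union_null[OF _ _ N(1)])
        show "?E Z \<delta> e \<subseteq> ?E X (\<delta>/2) e \<union> ?E X' (\<delta>/2) e \<union> N"
        proof
          fix \<omega> assume "\<omega> \<in> ?E Z \<delta> e"
          then obtain t where t: "\<omega> \<in> space M" "t \<in> {0..T}" "\<bar>?I Z e t \<omega> - 0\<bar> > \<delta>" by blast
          show "\<omega> \<in> ?E X (\<delta>/2) e \<union> ?E X' (\<delta>/2) e \<union> N"
          proof (cases "\<omega> \<in> N")
            case False
            hence "P \<omega>" using N(2)[of \<omega>] t(1) by blast
            hence "?I Z e t \<omega> = ?I X e t \<omega> - ?I X' e t \<omega>" unfolding P_def using t(2) e by blast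
            hence "\<bar>?I X e t \<omega> - 0\<bar> > \<delta>/2 \<or> \<bar>?I X' e t \<omega> - 0\<bar> > \<delta>/2" using t(3) by linarith
            thus ?thesis using t by blast
          qed blast
        qed
      qed auto
      thus "\<forall>\<^sub>F e in at_right 0. outer_measure_of M (?E Z \<delta> e)
          \<le> outer_measure_of M (?E X (\<delta>/2) e) + outer_measure_of M (?E X' (\<delta>/2) e)"
        by (auto simp: eventually_at_filter)
    qed simp
  qed
  moreover have "AE \<omega> in M. ?int Z \<omega>" using good by eventually_elim blast
  ultimately show ?thesis unfolding has_covariation_def by blast
qed

lemma continuous_local_martingale_diff:
  assumes X: "continuous_local_martingale M F T X" and Y: "continuous_local_martingale M F T Y"
  shows "continuous_local_martingale M F T (\<lambda>t \<omega>. X t \<omega> - Y t \<omega>)"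
  unfolding continuous_local_martingale_def
proof (intro conjI ballI)
  show "local_martingale M F T (\<lambda>t \<omega>. X t \<omega> - Y t \<omega>)"
    using X Y unfolding continuous_local_martingale_def by (intro local_martingale_diff) blast+
  show "continuous_on {0..T} (\<lambda>t. X t \<omega> - Y t \<omega>)" if "\<omega> \<in> space M" for \<omega>
    using X Y that unfolding continuous_local_martingale_def by (intro continuous_on_diff) blast+
qed

lemma predictable_diff:
  assumes "predictable M F T A" "predictable M F T B"
  shows "predictable M F T (\<lambda>t \<omega>. A t \<omega> - B t \<omega>)"
  using borel_measurable_diff[OF assms[unfolded predictable_def]]
  by (simp add: predictable_def case_prod_beta)

text \<open>
  \<open>L\<close> is continuous almost surely. Setting it to \<open>0\<close> on the exceptional null set turns it into a continuous
  local martingale, which may then be used as the test process in the orthogonality of \<open>A\<close> and \<open>B\<close>; it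
  follows that it is orthogonal to itself.
\<close>
lemma predictable_orthogonal_local_martingale_zero:
  assumes L: "local_martingale M F T L" and zero: "AE \<omega> in M. L 0 \<omega> = 0"
    and A: "predictable M F T A" "orthogonal_process M F T A"
    and B: "predictable M F T B" "orthogonal_process M F T B"
    and eq: "AE \<omega> in M. \<forall>t\<in>{0..T}. L t \<omega> = A t \<omega> - B t \<omega>"
  shows "AE \<omega> in M. \<forall>t\<in>{0..T}. L t \<omega> = 0"
proof -
  have "AE \<omega> in M. continuous_on {0..T} (\<lambda>t. L t \<omega>)"
    by (rule predictable_local_martingale_continuous[OF L predictable_diff[OF A(1) B(1)] eq])
  hence "AE \<omega> in M. continuous_on {0..T} (\<lambda>t. L t \<omega>) \<and> L 0 \<omega> = 0" using zero by eventually_elim simp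
  then obtain N where N: "N \<in> null_sets M"
    "\<And>\<omega>. \<omega> \<in> space M - N \<Longrightarrow> continuous_on {0..T} (\<lambda>t. L t \<omega>) \<and> L 0 \<omega> = 0"
    using AE_E3[of "\<lambda>\<omega>. continuous_on {0..T} (\<lambda>t. L t \<omega>) \<and> L 0 \<omega> = 0" M] by blast
  define L' where "L' t \<omega> = (if \<omega> \<in> N then 0 else L t \<omega>)" for t \<omega>
  have eq': "AE \<omega> in M. \<forall>t\<in>{0..T}. L' t \<omega> = L t \<omega>"
    using AE_not_in[OF N(1)] by eventually_elim (simp add: L'_def)
  have cont: "continuous_on {0..T} (\<lambda>t. L' t \<omega>)" and zero': "L' 0 \<omega> = 0" if "\<omega> \<in> space M" for \<omega>
    using N(2)[of \<omega>] that by (cases "\<omega> \<in> N"; simp add: L'_def)+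
  have "cadlag M T L'" using cont by (simp add: cadlag_def continuous_cadlag_path)
  hence "local_martingale M F T L'" by (rule local_martingale_modification[OF L _ eq'])
  hence L': "continuous_local_martingale M F T L'"
    unfolding continuous_local_martingale_def using cont by blast
  have "AE \<omega> in M. \<forall>t\<in>{0..T}. L' t \<omega> = A t \<omega> - B t \<omega>"
    using eq eq' by eventually_elim simp
  hence cov: "has_covariation M T L' L' (\<lambda>t \<omega>. 0)"
    using A(2) B(2) L' unfolding orthogonal_process_def by (intro has_covariation_diff[of A L' B L']) blast+
  have "AE \<omega> in M. \<forall>t\<in>{0..T}. L' t \<omega> = 0"
    by (rule self_orthogonal_continuous_local_martingale_zero[OF L' _ cov]) (rule zero')
  thus ?thesis using eq' by eventually_elim simp
qed

text \<open>
  Testing \<open>D\<close> and \<open>D'\<close> against \<open>N\<close> shows that \<open>(D - D') N = N\<^sup>2\<close> is a local martingale.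
\<close>
lemma purely_discontinuous_difference_zero:
  assumes D: "purely_discontinuous_local_martingale M F T D" "purely_discontinuous_local_martingale M F T D'"
    and N: "continuous_local_martingale M F T N" and zero: "AE \<omega> in M. N 0 \<omega> = 0"
    and eq: "AE \<omega> in M. \<forall>t\<in>{0..T}. N t \<omega> = D t \<omega> - D' t \<omega>"
  shows "AE \<omega> in M. \<forall>t\<in>{0..T}. N t \<omega> = 0"
proof -
  have cont: "continuous_on {0..T} (\<lambda>t. N t \<omega>)" if "\<omega> \<in> space M" for \<omega>
    using N that unfolding continuous_local_martingale_def by blast
  have "local_martingale M F T (\<lambda>t \<omega>. D t \<omega> * N t \<omega> - D' t \<omega> * N t \<omega>)"
    using D N unfolding purely_discontinuous_local_martingale_def by (intro local_martingale_diff) blast+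
  moreover have "AE \<omega> in M. \<forall>t\<in>{0..T}. (N t \<omega>)\<^sup>2 = D t \<omega> * N t \<omega> - D' t \<omega> * N t \<omega>"
    using eq by eventually_elim (simp add: power2_eq_square left_diff_distrib)
  moreover have cont2: "continuous_on {0..T} (\<lambda>t. (N t \<omega>)\<^sup>2)" if "\<omega> \<in> space M" for \<omega>
    by (intro continuous_intros cont that)
  moreover have "cadlag M T (\<lambda>t \<omega>. (N t \<omega>)\<^sup>2)"
    using cont2 by (simp add: cadlag_def continuous_cadlag_path)
  ultimately have "local_martingale M F T (\<lambda>t \<omega>. (N t \<omega>)\<^sup>2)"
    by (blast intro: local_martingale_modification)
  hence "AE \<omega> in M. \<forall>t\<in>{0..T}. (N t \<omega>)\<^sup>2 = 0"
    by (rule nonneg_local_martingale_zero[OF _ cont2]) (use zero in auto)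
  thus ?thesis by eventually_elim simp
qed

end

theorem proposition5p9:
  fixes M :: "'a measure" and F :: "real \<Rightarrow> 'a measure" and T :: real
    and X Mc Md A Mc' Md' A' :: "real \<Rightarrow> 'a \<Rightarrow> real"
  assumes "usual_filtered_prob_space M F T"
    and "cadlag M T X"
    and "special_weak_dirichlet M F T X"
    and "cont_disc_decomposition M F T X Mc Md A"
    and "AE \<omega> in M. A 0 \<omega> = 0" and "AE \<omega> in M. Md 0 \<omega> = 0"
    and "cont_disc_decomposition M F T X Mc' Md' A'"
    and "AE \<omega> in M. A' 0 \<omega> = 0" and "AE \<omega> in M. Md' 0 \<omega> = 0"
  shows "indistinguishable M T Mc Mc' \<and> indistinguishable M T Md Md' \<and> indistinguishable M T A A'"
proof -
  interpret usual_filtered_prob_space M F T by fact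
  have Mc: "continuous_local_martingale M F T Mc" "continuous_local_martingale M F T Mc'"
    and Md: "purely_discontinuous_local_martingale M F T Md" "purely_discontinuous_local_martingale M F T Md'"
    and A: "predictable M F T A" "orthogonal_process M F T A"
    and A': "predictable M F T A'" "orthogonal_process M F T A'"
    and X: "AE \<omega> in M. \<forall>t\<in>{0..T}. X t \<omega> = Mc t \<omega> + Md t \<omega> + A t \<omega>"
      "AE \<omega> in M. \<forall>t\<in>{0..T}. X t \<omega> = Mc' t \<omega> + Md' t \<omega> + A' t \<omega>"
    using assms(4,7) unfolding cont_disc_decomposition_def indistinguishable_def by blast+
  have 0: "0 \<in> {0..T}" using T_pos by simp
  define L where "L t \<omega> = (Mc t \<omega> - Mc' t \<omega>) - (Md' t \<omega> - Md t \<omega>)" for t \<omega>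
  have L: "local_martingale M F T L"
    unfolding L_def[abs_def]
    using Mc Md unfolding continuous_local_martingale_def purely_discontinuous_local_martingale_def
    by (intro local_martingale_diff) blast+
  have eq: "AE \<omega> in M. \<forall>t\<in>{0..T}. L t \<omega> = A' t \<omega> - A t \<omega>"
    using X
  proof eventually_elim
    case (elim \<omega>)
    show ?case
    proof
      fix t assume "t \<in> {0..T}"
      hence "X t \<omega> = Mc t \<omega> + Md t \<omega> + A t \<omega>" "X t \<omega> = Mc' t \<omega> + Md' t \<omega> + A' t \<omega>" using elim by blast+
      thus "L t \<omega> = A' t \<omega> - A t \<omega>" by (simp add: L_def)
    qed
  qed
  have "AE \<omega> in M. L 0 \<omega> = 0"
    using eq assms(5,8) by eventually_elim (use 0 in simp)
  hence L0: "AE \<omega> in M. \<forall>t\<in>{0..T}. L t \<omega> = 0"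
    by (rule predictable_orthogonal_local_martingale_zero[OF L _ A' A eq])
  define C where "C t \<omega> = Mc t \<omega> - Mc' t \<omega>" for t \<omega>
  have C: "continuous_local_martingale M F T C"
    unfolding C_def[abs_def] by (rule continuous_local_martingale_diff[OF Mc])
  have eqC: "AE \<omega> in M. \<forall>t\<in>{0..T}. C t \<omega> = Md' t \<omega> - Md t \<omega>"
    using L0 by eventually_elim (simp add: L_def C_def)
  have "AE \<omega> in M. C 0 \<omega> = 0"
    using eqC assms(6,9) by eventually_elim (use 0 in simp)
  hence C0: "AE \<omega> in M. \<forall>t\<in>{0..T}. C t \<omega> = 0"
    by (rule purely_discontinuous_difference_zero[OF Md(2,1) C _ eqC])
  have "indistinguishable M T Mc Mc'"
    unfolding indistinguishable_def using C0 by eventually_elim (simp add: C_def)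
  moreover have "indistinguishable M T Md Md'"
    unfolding indistinguishable_def using C0 eqC by eventually_elim simp
  moreover have "indistinguishable M T A A'"
    unfolding indistinguishable_def using L0 eq by eventually_elim simp
  ultimately show ?thesis by blast
qed

end
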